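(* The conjugation map $\mathcal{C}^{\Theta}:P(\Theta,R^{\dagger})/\mathbb{R}\to P(\Theta,\alpha^{\dagger})/\mathbb{R}$ is an isometry relative to the Riemannian metrics induced by the discrete Dirichlet energies with geometric edge weights.
   Context: Setting. $(V,E,F)$ is a cell decomposition of a topological open disk $\Omega$ whose 1-skeleton $G=(V,E)$ has one infinite end, has uniformly bounded vertex degrees and face degrees, and is transient (simple random walk escapes to infinity with positive probability). $(V^*,E^*,F^* )$ is the dual cell decomposition, with $V^*\cong F$, $E^*\cong E$, $F^*\cong V$. For an oriented edge $ij\in\vec E$ (from $i$ to $j$), $\phi$ denotes its left face and $\psi$ its right face, and $\phi\psi\in E^*$ is the dual edge crossing $ij$. For some small constant $\epsilon_0>0$, $\Theta:E^*\to(\epsilon_0,\pi-\epsilon_0)$, $\Theta_{\phi\psi}=\Theta_{\psi\phi}$, satisfies: (A1) $\sum_{\phi\psi\in\gamma}\Theta_{\phi\psi}=2\pi$ for every closed loop $\gamma$ in the dual graph bounding exactly one dual face; (A2) $\sum_{\phi\psi\in\gamma}\Theta_{\phi\psi}>2\pi+\epsilon_0$ for every closed loop $\gamma$ in the dual graph bounding more than one dual face. Circle patterns. For $R:F\to\mathbb{R}_{>0}$ and adjacent faces $\phi,\psi$ the half-angle at $\phi$ is $\alpha_{\phi\psi}=\cot^{-1}\big(\frac{R_\phi-R_\psi\cos\Theta_{\phi\psi}}{R_\psi\sin\Theta_{\phi\psi}}\big)\in(0,\pi)$; $\alpha_{\phi\psi}+\alpha_{\psi\phi}=\pi-\Theta_{\phi\psi}$.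 $\tilde P(\Theta)$ is the set of $R:F\to\mathbb{R}_{>0}$ that are the Euclidean radii of a circle pattern in the plane (possibly not globally embedded) with intersection angles $\Theta$; equivalently $\sum_{\psi\sim\phi}\alpha_{\phi\psi}=\pi$ for every $\phi\in F$. For each dual edge $\phi\psi$ crossing $ij$, take the Euclidean kite with vertices $\phi,i,\psi,j$, sides $R_\phi$ at $\phi$, $R_\psi$ at $\psi$, and angle $\Theta_{\phi\psi}$ at $i$ and $j$ in triangles $\phi\psi i$, $\phi\psi j$; for $R\in\tilde P(\Theta)$ gluing the kites yields a smooth flat metric $\sigma(\Theta,R)$ on $\Omega$. $R^\dagger\in\tilde P(\Theta)$ is a fixed function for which the developing map (local isometry) $(\Omega,\sigma(\Theta,R^\dagger))\to\mathbb{R}^2$ is an isometry onto the open unit disk $\mathbb{D}$ (it exists by the known discrete uniformization theorem); $\alpha^\dagger$ denotes its half-angles. Spaces. $\mathbf{D}(F)$ (resp. $\mathbf{D}(V)$) is the Hilbert space of real functions on $F$ (resp. $V$) with $\sum_{\phi\psi\in E^*}|u_\phi-u_\psi|^2<\infty$ (resp. $\sum_{ij\in E}|v_i-v_j|^2<\infty$), with norm squared equal to this energy plus the square of the value at a fixed base element. $P(\Theta,R^\dagger)=\{u\in\mathbf{D}(F):e^uR^\dagger\in\tilde P(\Theta)\}$, a Hilbert submanifold of $\mathbf{D}(F)$. $P(\Theta,\alpha^\dagger)$, a Hilbert submanifold of $\mathbf{D}(V)$, is the set of $v\in\mathbf{D}(V)$ with $\alpha^\dagger_{\phi\psi}+\frac{v_j-v_i}{2}>0$,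 $\alpha^\dagger_{\psi\phi}-\frac{v_j-v_i}{2}>0$ for all $ij\in\vec E$ and, for every $i\in V$, $\sum_{j\sim i}\log\frac{\sin(\alpha^\dagger_{\phi\psi}+\frac{v_j-v_i}{2})}{\sin(\alpha^\dagger_{\psi\phi}-\frac{v_j-v_i}{2})}=0$. Quotients by $\mathbb{R}$ are by constant functions. Conjugation map. $\mathcal{C}^\Theta([u])=[v]$ iff for every oriented edge $ij$: $u_\psi-u_\phi=\log\frac{\sin(\alpha^\dagger_{\phi\psi}+\frac{v_j-v_i}{2})\,\sin\alpha^\dagger_{\psi\phi}}{\sin(\alpha^\dagger_{\psi\phi}+\frac{v_i-v_j}{2})\,\sin\alpha^\dagger_{\phi\psi}}$ (i.e. $u,v$ describe the same circle pattern up to rigid motions and scaling); it is a homeomorphism. Riemannian metrics. For $u\in P(\Theta,R^\dagger)$ and $R=e^uR^\dagger$, put $c^*_{\phi\psi}=\frac{2R_\phi R_\psi\sin\Theta_{\phi\psi}}{R_\phi^2+R_\psi^2-2R_\phi R_\psi\cos\Theta_{\phi\psi}}$. Then $T_uP(\Theta,R^\dagger)=\mathbf{HD}_{c^*}(F)=\{w\in\mathbf{D}(F):\sum_{\psi\sim\phi}c^*_{\phi\psi}(w_\psi-w_\phi)=0\ \forall\phi\}$, and the metric on $T_{[u]}(P(\Theta,R^\dagger)/\mathbb{R})=\mathbf{HD}_{c^*}(F)/\mathbb{R}$ is given by $\mathcal{E}_{c^*}(w)=\sum_{\phi\psi\in E^*}c^*_{\phi\psi}(w_\phi-w_\psi)^2$.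 For $v\in P(\Theta,\alpha^\dagger)$, put $c_{ij}=\frac12\big(\cot(\alpha^\dagger_{\phi\psi}+\frac{v_j-v_i}{2})+\cot(\alpha^\dagger_{\psi\phi}-\frac{v_j-v_i}{2})\big)$. Then $T_vP(\Theta,\alpha^\dagger)=\mathbf{HD}_c(V)=\{w\in\mathbf{D}(V):\sum_{j\sim i}c_{ij}(w_j-w_i)=0\ \forall i\}$, and the metric on $T_{[v]}(P(\Theta,\alpha^\dagger)/\mathbb{R})=\mathbf{HD}_c(V)/\mathbb{R}$ is given by $\mathcal{E}_c(w)=\sum_{ij\in E}c_{ij}(w_i-w_j)^2$. *)

theory Defs
  imports "HOL-Analysis.Analysis" "HOL-Probability.Probability_Mass_Function"
begin

section \<open>Cell decompositions of an open disk\<close>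

text \<open>
  The vertices and faces are the elements of the types \<open>'v\<close> and \<open>'f\<close>; an element of \<open>'e\<close> is an
  \<^emph>\<open>oriented\<close> edge, so an unoriented edge is a pair \<open>{e, rv e}\<close>.  \<open>src\<close> is the initial
  vertex, \<open>lface\<close> the left face, and \<open>nxt e\<close> the oriented edge following \<open>e\<close> in the
  counterclockwise boundary walk of its left face.  The remaining fields realise the cells in a
  topological space: \<open>vpos\<close> gives the 0-cells, \<open>edge_map e\<close> (on the unit interval) and
  \<open>face_map f\<close> (on the closed unit disk) are the characteristic maps of the 1- and 2-cells.
\<close>

record ('v, 'e, 'f, 'p) cell_complex =
  surface :: "'p set"
  src :: "'e \<Rightarrow> 'v"
  rv :: "'e \<Rightarrow> 'e"
  lface :: "'e \<Rightarrow> 'f"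
  nxt :: "'e \<Rightarrow> 'e"
  vpos :: "'v \<Rightarrow> 'p"
  edge_map :: "'e \<Rightarrow> real \<Rightarrow> 'p"
  face_map :: "'f \<Rightarrow> complex \<Rightarrow> 'p"

definition trg :: "('v, 'e, 'f, 'p) cell_complex \<Rightarrow> 'e \<Rightarrow> 'v"
  where "trg G e = src G (rv G e)"

definition rface :: "('v, 'e, 'f, 'p) cell_complex \<Rightarrow> 'e \<Rightarrow> 'f"
  where "rface G e = lface G (rv G e)"

definition open_edge :: "('v, 'e, 'f, 'p) cell_complex \<Rightarrow> 'e \<Rightarrow> 'p set"
  where "open_edge G e = edge_map G e ` {0<..<1}"

definition open_face :: "('v, 'e, 'f, 'p) cell_complex \<Rightarrow> 'f \<Rightarrow> 'p set"
  where "open_face G f = face_map G f ` ball 0 1"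

text \<open>
  The attaching map of a face \<open>f\<close> runs once, edge by edge, through the \<open>n\<close> oriented edges
  having \<open>f\<close> on their left.  Since each oriented edge has exactly one left face, every edge is
  traversed once in each direction, i.e. the faces are coherently oriented.
\<close>

definition face_attached :: "('v, 'e, 'f, 'p::topological_space) cell_complex \<Rightarrow> 'f \<Rightarrow> bool"
  where "face_attached G f \<longleftrightarrow>
    continuous_on (cball 0 1) (face_map G f) \<and>
    inj_on (face_map G f) (ball 0 1) \<and>
    (\<exists>e n. n > 0 \<and> (nxt G ^^ n) e = e \<and>
       bij_betw (\<lambda>k. (nxt G ^^ k) e) {..<n} {d. lface G d = f} \<and>
       (\<forall>k<n. \<forall>t\<in>{0..1}.
          face_map G f (cis (2 * pi * (real k + t) / real n)) = edge_map G ((nxt G ^^ k) e) t))"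

definition edge_attached :: "('v, 'e, 'f, 'p::topological_space) cell_complex \<Rightarrow> 'e \<Rightarrow> bool"
  where "edge_attached G e \<longleftrightarrow>
    continuous_on {0..1} (edge_map G e) \<and>
    inj_on (edge_map G e) {0<..<1} \<and>
    edge_map G e 0 = vpos G (src G e) \<and>
    (\<forall>t\<in>{0..1}. edge_map G (rv G e) t = edge_map G e (1 - t))"

definition locally_finite :: "('v, 'e, 'f, 'p::topological_space) cell_complex \<Rightarrow> bool"
  where "locally_finite G \<longleftrightarrow>
    (\<forall>x\<in>surface G. \<exists>U. open U \<and> x \<in> U \<and>
       finite {v. vpos G v \<in> U} \<and>
       finite {e. edge_map G e ` {0..1} \<inter> U \<noteq> {}} \<and>
       finite {f. face_map G f ` cball 0 1 \<inter> U \<noteq> {}})"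

definition disk_cell_decomposition :: "('v, 'e, 'f, 'p::topological_space) cell_complex \<Rightarrow> bool"
  where "disk_cell_decomposition G \<longleftrightarrow>
    surface G homeomorphic ball (0::complex) 1 \<and>
    (\<forall>e. rv G e \<noteq> e \<and> rv G (rv G e) = e) \<and>
    (\<forall>e. src G (nxt G e) = trg G e \<and> lface G (nxt G e) = lface G e) \<and>
    (\<forall>e. edge_attached G e) \<and>
    (\<forall>f. face_attached G f) \<and>
    range (vpos G) \<union> (\<Union>e. open_edge G e) \<union> (\<Union>f. open_face G f) = surface G \<and>
    inj (vpos G) \<and>
    (\<forall>e e'. e' \<noteq> e \<and> e' \<noteq> rv G e \<longrightarrow> open_edge G e \<inter> open_edge G e' = {}) \<and>
    (\<forall>f f'. f \<noteq> f' \<longrightarrow> open_face G f \<inter> open_face G f' = {}) \<and>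
    range (vpos G) \<inter> (\<Union>e. open_edge G e) = {} \<and>
    range (vpos G) \<inter> (\<Union>f. open_face G f) = {} \<and>
    (\<Union>e. open_edge G e) \<inter> (\<Union>f. open_face G f) = {} \<and>
    locally_finite G"

definition bounded_degrees :: "('v, 'e, 'f, 'p) cell_complex \<Rightarrow> bool"
  where "bounded_degrees G \<longleftrightarrow> (\<exists>M.
    (\<forall>v. finite {e. src G e = v} \<and> card {e. src G e = v} \<le> M) \<and>
    (\<forall>f. finite {e. lface G e = f} \<and> card {e. lface G e = f} \<le> M))"

definition component_avoiding :: "('v, 'e, 'f, 'p) cell_complex \<Rightarrow> 'v set \<Rightarrow> 'v \<Rightarrow> 'v set"
  where "component_avoiding G K x =
    {y. (x, y) \<in> {(src G e, trg G e) | e. src G e \<notin> K \<and> trg G e \<notin> K}\<^sup>*}"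

definition one_ended :: "('v, 'e, 'f, 'p) cell_complex \<Rightarrow> bool"
  where "one_ended G \<longleftrightarrow>
    (\<forall>K. finite K \<longrightarrow> (\<exists>!C. C \<in> component_avoiding G K ` (- K) \<and> infinite C))"

text \<open>
  Law of the list of the first \<open>n + 1\<close> positions of simple random walk started at \<open>x\<close>.
\<close>

primrec srw :: "('v, 'e, 'f, 'p) cell_complex \<Rightarrow> nat \<Rightarrow> 'v \<Rightarrow> 'v list pmf" where
  "srw G 0 x = return_pmf [x]"
| "srw G (Suc n) x =
     bind_pmf (pmf_of_set {e. src G e = x}) (\<lambda>e. map_pmf (\<lambda>xs. x # xs) (srw G n (trg G e)))"

text \<open>
  The events of not returning to the starting point within \<open>n\<close> steps decrease with \<open>n\<close>, so the
  probability of never returning is the infimum of their probabilities.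
\<close>

definition transient :: "('v, 'e, 'f, 'p) cell_complex \<Rightarrow> bool"
  where "transient G \<longleftrightarrow>
    (\<forall>x. (INF n. measure_pmf.prob (srw G n x) {xs. x \<notin> set (tl xs)}) > 0)"


section \<open>Intersection angles\<close>

text \<open>
  A closed loop in the dual graph is a list of oriented edges: crossing \<open>e\<close> from left to right is
  the dual edge from \<open>lface e\<close> to \<open>rface e\<close>.  No dual edge is used twice.  The dual faces are the
  (primal) vertices; the loop bounds the finite nonempty set \<open>S\<close> of dual faces if it consists of
  exactly the dual edges separating \<open>S\<close> from its complement.
\<close>

definition dual_loop :: "('v, 'e, 'f, 'p) cell_complex \<Rightarrow> 'e list \<Rightarrow> bool"
  where "dual_loop G es \<longleftrightarrow> es \<noteq> [] \<and> distinct es \<and>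
    (\<forall>e\<in>set es. rv G e \<notin> set es) \<and>
    (\<forall>k<length es. rface G (es ! k) = lface G (es ! (Suc k mod length es)))"

definition bounds :: "('v, 'e, 'f, 'p) cell_complex \<Rightarrow> 'e list \<Rightarrow> 'v set \<Rightarrow> bool"
  where "bounds G es S \<longleftrightarrow> finite S \<and> S \<noteq> {} \<and>
    {e. e \<in> set es \<or> rv G e \<in> set es} = {e. src G e \<in> S \<longleftrightarrow> trg G e \<notin> S}"

definition admissible_angles ::
    "('v, 'e, 'f, 'p) cell_complex \<Rightarrow> real \<Rightarrow> ('e \<Rightarrow> real) \<Rightarrow> bool"
  where "admissible_angles G \<epsilon>\<^sub>0 \<Theta> \<longleftrightarrow>
    (\<forall>e. \<epsilon>\<^sub>0 < \<Theta> e \<and> \<Theta> e < pi - \<epsilon>\<^sub>0 \<and> \<Theta> (rv G e) = \<Theta> e) \<and>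
    (\<forall>es S. dual_loop G es \<and> bounds G es S \<and> card S = 1 \<longrightarrow> (\<Sum>e\<leftarrow>es. \<Theta> e) = 2 * pi) \<and>
    (\<forall>es S. dual_loop G es \<and> bounds G es S \<and> card S > 1 \<longrightarrow> (\<Sum>e\<leftarrow>es. \<Theta> e) > 2 * pi + \<epsilon>\<^sub>0)"


section \<open>Circle patterns\<close>

definition arccot :: "real \<Rightarrow> real"
  where "arccot x = pi / 2 - arctan x"

text \<open>
  \<open>half_angle G \<Theta> R e\<close> is the half-angle at the left face of \<open>e\<close>; the one at the right face is
  \<open>half_angle G \<Theta> R (rv G e)\<close>.
\<close>

definition half_angle ::
    "('v, 'e, 'f, 'p) cell_complex \<Rightarrow> ('e \<Rightarrow> real) \<Rightarrow> ('f \<Rightarrow> real) \<Rightarrow> 'e \<Rightarrow> real"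
  where "half_angle G \<Theta> R e =
    arccot ((R (lface G e) - R (rface G e) * cos (\<Theta> e)) / (R (rface G e) * sin (\<Theta> e)))"

definition pattern_radii ::
    "('v, 'e, 'f, 'p) cell_complex \<Rightarrow> ('e \<Rightarrow> real) \<Rightarrow> ('f \<Rightarrow> real) set"
  where "pattern_radii G \<Theta> =
    {R. (\<forall>f. R f > 0) \<and> (\<forall>f. (\<Sum>e | lface G e = f. half_angle G \<Theta> R e) = pi)}"

text \<open>
  The developing map is affine on each of the two triangles forming a kite, hence it is given by the
  images \<open>z\<close> of the vertices and \<open>w\<close> of the face centres.  The triangle \<open>\<phi>\<psi>i\<close> of the oriented edge
  \<open>e\<close> from \<open>i\<close> to \<open>j\<close> is developed, preserving orientation, to a triangle with sides \<open>R \<phi>\<close>,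
  \<open>R \<psi>\<close> and angle \<open>\<Theta> e\<close> at \<open>i\<close>; the triangle \<open>\<phi>\<psi>j\<close> belongs to \<open>rv e\<close>.  The two triangles have to be
  considered separately because a kite need not be convex.  The developing map, being a local
  homeomorphism, is injective iff it never maps the interiors of two triangles to overlapping sets.
\<close>

definition developed_triangle ::
    "('v, 'e, 'f, 'p) cell_complex \<Rightarrow> ('v \<Rightarrow> complex) \<Rightarrow> ('f \<Rightarrow> complex) \<Rightarrow> 'e \<Rightarrow> complex set"
  where "developed_triangle G z w e =
    convex hull {z (src G e), w (lface G e), w (rface G e)}"

definition developing_map ::
    "('v, 'e, 'f, 'p) cell_complex \<Rightarrow> ('e \<Rightarrow> real) \<Rightarrow> ('f \<Rightarrow> real) \<Rightarrow>
     ('v \<Rightarrow> complex) \<Rightarrow> ('f \<Rightarrow> complex) \<Rightarrow> bool"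
  where "developing_map G \<Theta> R z w \<longleftrightarrow> (\<forall>e.
    cmod (w (lface G e) - z (src G e)) = R (lface G e) \<and>
    cmod (w (rface G e) - z (src G e)) = R (rface G e) \<and>
    (w (lface G e) - z (src G e)) / of_real (R (lface G e)) =
      cis (\<Theta> e) * ((w (rface G e) - z (src G e)) / of_real (R (rface G e))))"

definition uniformizing ::
    "('v, 'e, 'f, 'p) cell_complex \<Rightarrow> ('e \<Rightarrow> real) \<Rightarrow> ('f \<Rightarrow> real) \<Rightarrow> bool"
  where "uniformizing G \<Theta> R \<longleftrightarrow> R \<in> pattern_radii G \<Theta> \<and>
    (\<exists>z w. developing_map G \<Theta> R z w \<and>
       (\<forall>e e'. e \<noteq> e' \<longrightarrow>
          interior (developed_triangle G z w e) \<inter> interior (developed_triangle G z w e') = {}) \<and>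
       (\<Union>e. developed_triangle G z w e) = ball 0 1)"


section \<open>Dirichlet spaces modulo constants\<close>

text \<open>
  These notions are used for the graph \<open>(V, E)\<close> with \<open>s = src G\<close>, \<open>t = trg G\<close> and for the dual
  graph with \<open>s = lface G\<close>, \<open>t = rface G\<close>.  The factor \<open>1/2\<close> accounts for summing over oriented
  edges.
\<close>

definition grad :: "('e \<Rightarrow> 'a) \<Rightarrow> ('e \<Rightarrow> 'a) \<Rightarrow> ('a \<Rightarrow> real) \<Rightarrow> 'e \<Rightarrow> real"
  where "grad s t u e = u (t e) - u (s e)"

definition dirichlet_space :: "('e \<Rightarrow> 'a) \<Rightarrow> ('e \<Rightarrow> 'a) \<Rightarrow> ('a \<Rightarrow> real) set"
  where "dirichlet_space s t = {u. (\<lambda>e. (grad s t u e)\<^sup>2) summable_on UNIV}"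

definition energy :: "('e \<Rightarrow> 'a) \<Rightarrow> ('e \<Rightarrow> 'a) \<Rightarrow> ('e \<Rightarrow> real) \<Rightarrow> ('a \<Rightarrow> real) \<Rightarrow> real"
  where "energy s t c w = (\<Sum>\<^sub>\<infinity>e. c e * (grad s t w e)\<^sup>2) / 2"

definition finite_energy :: "('e \<Rightarrow> 'a) \<Rightarrow> ('e \<Rightarrow> 'a) \<Rightarrow> ('e \<Rightarrow> real) \<Rightarrow> ('a \<Rightarrow> real) \<Rightarrow> bool"
  where "finite_energy s t c w \<longleftrightarrow> (\<lambda>e. c e * (grad s t w e)\<^sup>2) summable_on UNIV"

text \<open>
  The norm of the quotient of \<open>dirichlet_space s t\<close> by the constants: minimising the squared norm,
  energy plus squared value at the base element, over a class makes the second summand vanish.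
\<close>

definition dnorm :: "('e \<Rightarrow> 'a) \<Rightarrow> ('e \<Rightarrow> 'a) \<Rightarrow> ('a \<Rightarrow> real) \<Rightarrow> real"
  where "dnorm s t u = sqrt (energy s t (\<lambda>_. 1) u)"

definition harmonic_dirichlet ::
    "('e \<Rightarrow> 'a) \<Rightarrow> ('e \<Rightarrow> 'a) \<Rightarrow> ('e \<Rightarrow> real) \<Rightarrow> ('a \<Rightarrow> real) set"
  where "harmonic_dirichlet s t c =
    {w \<in> dirichlet_space s t. \<forall>x. (\<Sum>e | s e = x. c e * grad s t w e) = 0}"

definition mod_const :: "('a \<Rightarrow> real) \<Rightarrow> ('a \<Rightarrow> real) set"
  where "mod_const u = {\<lambda>x. u x + k | k. True}"


section \<open>Isometries between the deformation spaces\<close>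

text \<open>
  \<open>A\<close> is a subset of the Dirichlet space \<open>(s, t)\<close> and \<open>B\<close> one of the Dirichlet space \<open>(s', t')\<close>,
  both invariant under adding constants, and \<open>\<Phi>\<close> maps \<open>A\<close> modulo constants to \<open>B\<close> modulo constants.
  \<open>c1_derivative\<close> says that \<open>\<Phi>\<close> is continuously Frechet differentiable relative to \<open>A\<close>, and that
  \<open>L u\<close>, a bounded linear map between the ambient spaces, is a derivative at the class of \<open>u\<close>.
  Boundedness with respect to the seminorms makes \<open>L u\<close> descend to the quotients by constants.
  As usual for derivatives along a submanifold, only the restriction of \<open>L u\<close> to the tangent space
  of \<open>A\<close> at \<open>u\<close> is determined; it is the differential of \<open>\<Phi>\<close>.
\<close>

definition bounded_linear_dirichlet ::
    "('e \<Rightarrow> 'a) \<Rightarrow> ('e \<Rightarrow> 'a) \<Rightarrow> ('e \<Rightarrow> 'b) \<Rightarrow> ('e \<Rightarrow> 'b) \<Rightarrow>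
     (('a \<Rightarrow> real) \<Rightarrow> ('b \<Rightarrow> real)) \<Rightarrow> bool"
  where "bounded_linear_dirichlet s t s' t' T \<longleftrightarrow>
    (\<forall>w\<in>dirichlet_space s t. T w \<in> dirichlet_space s' t') \<and>
    (\<forall>w1\<in>dirichlet_space s t. \<forall>w2\<in>dirichlet_space s t. \<forall>a b.
       T (\<lambda>x. a * w1 x + b * w2 x) = (\<lambda>y. a * T w1 y + b * T w2 y)) \<and>
    (\<exists>K. \<forall>w\<in>dirichlet_space s t. dnorm s' t' (T w) \<le> K * dnorm s t w)"

definition c1_derivative ::
    "('e \<Rightarrow> 'a) \<Rightarrow> ('e \<Rightarrow> 'a) \<Rightarrow> ('a \<Rightarrow> real) set \<Rightarrow>
     ('e \<Rightarrow> 'b) \<Rightarrow> ('e \<Rightarrow> 'b) \<Rightarrow>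
     (('a \<Rightarrow> real) set \<Rightarrow> ('b \<Rightarrow> real) set) \<Rightarrow>
     (('a \<Rightarrow> real) \<Rightarrow> ('a \<Rightarrow> real) \<Rightarrow> ('b \<Rightarrow> real)) \<Rightarrow> bool"
  where "c1_derivative s t A s' t' \<Phi> L \<longleftrightarrow>
    (\<forall>u\<in>A. bounded_linear_dirichlet s t s' t' (L u)) \<and>
    (\<forall>u\<in>A. \<forall>\<epsilon>>0. \<exists>\<delta>>0. \<forall>u'\<in>A. dnorm s t (\<lambda>x. u' x - u x) < \<delta> \<longrightarrow>
       (\<forall>v\<in>\<Phi> (mod_const u). \<forall>v'\<in>\<Phi> (mod_const u').
          dnorm s' t' (\<lambda>y. v' y - v y - L u (\<lambda>x. u' x - u x) y)
            \<le> \<epsilon> * dnorm s t (\<lambda>x. u' x - u x))) \<and>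
    (\<forall>u\<in>A. \<forall>\<epsilon>>0. \<exists>\<delta>>0. \<forall>u'\<in>A. dnorm s t (\<lambda>x. u' x - u x) < \<delta> \<longrightarrow>
       (\<forall>w\<in>dirichlet_space s t.
          dnorm s' t' (\<lambda>y. L u' w y - L u w y) \<le> \<epsilon> * dnorm s t w))"

text \<open>
  The metric on \<open>A\<close> modulo constants at the class of \<open>u\<close> is the energy with weights \<open>c u\<close> on
  the harmonic Dirichlet functions (modulo constants) for these weights, and similarly for \<open>B\<close>
  with weights \<open>c'\<close>.  \<open>\<Phi>\<close> is an isometry if it is a diffeomorphism whose differential is at every
  point a bijection between the tangent spaces preserving the metric.
\<close>

definition riemannian_isometry ::
    "('e \<Rightarrow> 'a) \<Rightarrow> ('e \<Rightarrow> 'a) \<Rightarrow> ('a \<Rightarrow> real) set \<Rightarrow> (('a \<Rightarrow> real) \<Rightarrow> 'e \<Rightarrow> real) \<Rightarrow>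
     ('e \<Rightarrow> 'b) \<Rightarrow> ('e \<Rightarrow> 'b) \<Rightarrow> ('b \<Rightarrow> real) set \<Rightarrow> (('b \<Rightarrow> real) \<Rightarrow> 'e \<Rightarrow> real) \<Rightarrow>
     (('a \<Rightarrow> real) set \<Rightarrow> ('b \<Rightarrow> real) set) \<Rightarrow> bool"
  where "riemannian_isometry s t A c s' t' B c' \<Phi> \<longleftrightarrow>
    bij_betw \<Phi> (mod_const ` A) (mod_const ` B) \<and>
    (\<forall>u\<in>A. \<forall>w\<in>harmonic_dirichlet s t (c u). finite_energy s t (c u) w) \<and>
    (\<forall>v\<in>B. \<forall>w\<in>harmonic_dirichlet s' t' (c' v). finite_energy s' t' (c' v) w) \<and>
    (\<exists>L L'.
       c1_derivative s t A s' t' \<Phi> L \<and>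
       c1_derivative s' t' B s t (inv_into (mod_const ` A) \<Phi>) L' \<and>
       (\<forall>u\<in>A. \<forall>v\<in>\<Phi> (mod_const u).
          bij_betw (\<lambda>W. \<Union>w\<in>W. mod_const (L u w))
            (mod_const ` harmonic_dirichlet s t (c u))
            (mod_const ` harmonic_dirichlet s' t' (c' v)) \<and>
          (\<forall>w\<in>harmonic_dirichlet s t (c u).
             energy s' t' (c' v) (L u w) = energy s t (c u) w)))"


section \<open>Deformation spaces and the conjugation map\<close>

definition P_radii ::
    "('v, 'e, 'f, 'p) cell_complex \<Rightarrow> ('e \<Rightarrow> real) \<Rightarrow> ('f \<Rightarrow> real) \<Rightarrow> ('f \<Rightarrow> real) set"
  where "P_radii G \<Theta> R\<^sub>0 =
    {u \<in> dirichlet_space (lface G) (rface G). (\<lambda>f. exp (u f) * R\<^sub>0 f) \<in> pattern_radii G \<Theta>}"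

text \<open>
  Below, \<open>\<alpha> e\<close> and \<open>\<alpha> (rv G e)\<close> are the half-angles at the left and at the
  right face of \<open>e\<close>.
\<close>

definition P_angles ::
    "('v, 'e, 'f, 'p) cell_complex \<Rightarrow> ('e \<Rightarrow> real) \<Rightarrow> ('v \<Rightarrow> real) set"
  where "P_angles G \<alpha> =
    {v \<in> dirichlet_space (src G) (trg G).
       (\<forall>e. \<alpha> e + (v (trg G e) - v (src G e)) / 2 > 0 \<and>
            \<alpha> (rv G e) - (v (trg G e) - v (src G e)) / 2 > 0) \<and>
       (\<forall>i. (\<Sum>e | src G e = i.
               ln (sin (\<alpha> e + (v (trg G e) - v (src G e)) / 2)
                 / sin (\<alpha> (rv G e) - (v (trg G e) - v (src G e)) / 2))) = 0)}"

definition conjugate ::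
    "('v, 'e, 'f, 'p) cell_complex \<Rightarrow> ('e \<Rightarrow> real) \<Rightarrow> ('f \<Rightarrow> real) \<Rightarrow> ('v \<Rightarrow> real) \<Rightarrow> bool"
  where "conjugate G \<alpha> u v \<longleftrightarrow> (\<forall>e.
    u (rface G e) - u (lface G e) =
      ln ((sin (\<alpha> e + (v (trg G e) - v (src G e)) / 2) * sin (\<alpha> (rv G e)))
        / (sin (\<alpha> (rv G e) + (v (src G e) - v (trg G e)) / 2) * sin (\<alpha> e))))"

definition conjugation_map ::
    "('v, 'e, 'f, 'p) cell_complex \<Rightarrow> ('e \<Rightarrow> real) \<Rightarrow> ('f \<Rightarrow> real) set \<Rightarrow> ('v \<Rightarrow> real) set"
  where "conjugation_map G \<alpha> U = {v \<in> P_angles G \<alpha>. \<exists>u\<in>U. conjugate G \<alpha> u v}"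

definition weight_radii ::
    "('v, 'e, 'f, 'p) cell_complex \<Rightarrow> ('e \<Rightarrow> real) \<Rightarrow> ('f \<Rightarrow> real) \<Rightarrow> ('f \<Rightarrow> real) \<Rightarrow> 'e \<Rightarrow> real"
  where "weight_radii G \<Theta> R\<^sub>0 u e =
    (let R = (\<lambda>f. exp (u f) * R\<^sub>0 f); \<phi> = lface G e; \<psi> = rface G e
     in 2 * R \<phi> * R \<psi> * sin (\<Theta> e) / ((R \<phi>)\<^sup>2 + (R \<psi>)\<^sup>2 - 2 * R \<phi> * R \<psi> * cos (\<Theta> e)))"

definition weight_angles ::
    "('v, 'e, 'f, 'p) cell_complex \<Rightarrow> ('e \<Rightarrow> real) \<Rightarrow> ('v \<Rightarrow> real) \<Rightarrow> 'e \<Rightarrow> real"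
  where "weight_angles G \<alpha> v e =
    (cot (\<alpha> e + (v (trg G e) - v (src G e)) / 2)
      + cot (\<alpha> (rv G e) - (v (trg G e) - v (src G e)) / 2)) / 2"

end

theory Submission
  imports Defs
begin

text \<open>
  On the two sides of an edge the half-angles and the logarithm of the ratio of the radii determine each other, and
  the derivatives of the two functions, with respect to suitably normalised arguments, are the weights
  \<open>c\<^sup>*\<close> and \<open>c = 1 / c\<^sup>*\<close>.  Hence the differential of the conjugation map sends \<open>w\<close> to a function with gradient
  \<open>c\<^sup>* \<nabla> w\<close>, the harmonic conjugate of \<open>w\<close>, which has the same energy.  Conjugates exist because closed cochains on
  a disk are exact.  The differential is extended from the tangent spaces to the whole Dirichlet space by
  means of the orthogonal projection onto the square-summable closed cochains.  Differentiability of
  the inverse needs the weights \<open>c\<close> to be bounded, i.e. the half-angles of the uniformizing pattern to be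
  bounded from below.  For this Ring Lemma, a short edge of a large circle would lie in
  a cluster of vertices isolated at some scale; seen from a distance the edges leaving the
  cluster make a single full turn, so they cross a dual loop whose angles
  sum up to only slightly more than \<open>2 * pi\<close>.
\<close>

section \<open>Projection onto closed subspaces of square-summable functions\<close>

text \<open>The conjugation map acts edge by edge: on each oriented edge one gradient is a function
  of one real variable of the other. A square-summable cochain is bounded pointwise by its norm, so
  Taylor estimates with constants independent of the edge yield Frechet differentiability;
  everything hinges on uniform bounds for two derivatives. From radii to angles they follow from
  \<open>\<Theta>\<close> staying away from 0. From angles to radii they involve cotangents of
  half-angles, whence the Ring Lemma; a square-summable gradient moves only finitely many
  half-angles by more than a given amount, so the bound carries over to all patterns of the space.
  The derivative has to be an operator on the full Dirichlet space, whereas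
  \<open>c\<^sup>* \<nabla> w\<close> is a gradient only for harmonic \<open>w\<close>; hence the
  projection. It fixes differences of gradients and does not increase norms, so remainder estimates
  survive it. In the Ring Lemma the angle sum of the loop exceeds \<open>2 * pi\<close> by exactly
  twice the total turn along the cluster. This excess is positive, which excludes loops around one
  vertex, and at most \<open>\<epsilon>\<^sub>0\<close>, which excludes loops around
  several.\<close>

definition l2 :: "('e \<Rightarrow> real) set" where
  "l2 = {f. (\<lambda>e. (f e)\<^sup>2) summable_on UNIV}"

definition l2_sq :: "('e \<Rightarrow> real) \<Rightarrow> real" where
  "l2_sq f = (\<Sum>\<^sub>\<infinity>e. (f e)\<^sup>2)"

definition l2_ip :: "('e \<Rightarrow> real) \<Rightarrow> ('e \<Rightarrow> real) \<Rightarrow> real" where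
  "l2_ip f g = (\<Sum>\<^sub>\<infinity>e. f e * g e)"

lemma l2_prod_summable:
  assumes "f \<in> l2" "g \<in> l2"
  shows "(\<lambda>e. f e * g e) summable_on UNIV"
proof (rule summable_on_comparison_test[where f="\<lambda>e. (f e)\<^sup>2 + (g e)\<^sup>2", THEN abs_summable_summable])
  show "(\<lambda>e. (f e)\<^sup>2 + (g e)\<^sup>2) summable_on UNIV"
    using assms by (auto simp: l2_def intro: summable_on_add)
  show "norm (f e * g e) \<le> (f e)\<^sup>2 + (g e)\<^sup>2" for e
  proof -
    have "2 * \<bar>f e * g e\<bar> \<le> (f e)\<^sup>2 + (g e)\<^sup>2"
      using sum_squares_bound[of "\<bar>f e\<bar>" "\<bar>g e\<bar>"] by (simp add: abs_mult mult.assoc)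
    then show ?thesis unfolding real_norm_def by linarith
  qed
qed auto

lemma l2_add: "f \<in> l2 \<Longrightarrow> g \<in> l2 \<Longrightarrow> (\<lambda>e. f e + g e) \<in> l2"
proof -
  assume a: "f \<in> l2" "g \<in> l2"
  have "(\<lambda>e. (f e)\<^sup>2 + (g e)\<^sup>2 + 2 * (f e * g e)) summable_on UNIV"
    using a l2_prod_summable[OF a] by (auto simp: l2_def intro!: summable_on_add summable_on_cmult_right)
  then show ?thesis by (simp add: l2_def power2_sum mult.assoc)
qed

lemma l2_scale: "f \<in> l2 \<Longrightarrow> (\<lambda>e. a * f e) \<in> l2"
  by (auto simp: l2_def power_mult_distrib intro!: summable_on_cmult_right)

lemma l2_lincomb: "f \<in> l2 \<Longrightarrow> g \<in> l2 \<Longrightarrow> (\<lambda>e. a * f e + b * g e) \<in> l2"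
  by (intro l2_add l2_scale)

lemma l2_diff: "f \<in> l2 \<Longrightarrow> g \<in> l2 \<Longrightarrow> (\<lambda>e. f e - g e) \<in> l2"
  using l2_lincomb[of f g 1 "-1"] by simp

lemma l2_dominated:
  assumes "f \<in> l2" "\<And>e. \<bar>g e\<bar> \<le> K * \<bar>f e\<bar>"
  shows "g \<in> l2" "l2_sq g \<le> K\<^sup>2 * l2_sq f"
proof -
  have s: "(\<lambda>e. K\<^sup>2 * (f e)\<^sup>2) summable_on UNIV"
    using assms by (auto simp: l2_def intro!: summable_on_cmult_right)
  have le: "(g e)\<^sup>2 \<le> K\<^sup>2 * (f e)\<^sup>2" for e
  proof -
    have "\<bar>g e\<bar>\<^sup>2 \<le> (K * \<bar>f e\<bar>)\<^sup>2" using assms(2)[of e] by (intro power_mono) auto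
    then show ?thesis by (simp add: power_mult_distrib)
  qed
  show g: "g \<in> l2" unfolding l2_def
    using summable_on_comparison_test[OF s, of "\<lambda>e. (g e)\<^sup>2"] le by simp
  have "l2_sq g \<le> (\<Sum>\<^sub>\<infinity>e. K\<^sup>2 * (f e)\<^sup>2)" unfolding l2_sq_def
    using g s le by (intro infsum_mono) (auto simp: l2_def)
  also have "\<dots> = K\<^sup>2 * l2_sq f" unfolding l2_sq_def by (rule infsum_cmult_right')
  finally show "l2_sq g \<le> K\<^sup>2 * l2_sq f" .
qed

lemma l2_sq_nonneg: "l2_sq f \<ge> 0"
  unfolding l2_sq_def by (intro infsum_nonneg) auto

lemma l2_sq_ge_point:
  assumes "f \<in> l2" shows "(f e)\<^sup>2 \<le> l2_sq f"
proof -
  have "(\<Sum>\<^sub>\<infinity>d\<in>{e}. (f d)\<^sup>2) \<le> l2_sq f" unfolding l2_sq_def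
    using assms by (intro infsum_mono_neutral) (auto simp: l2_def)
  then show ?thesis by simp
qed

lemma l2_sq_lincomb:
  assumes "f \<in> l2" "g \<in> l2"
  shows "l2_sq (\<lambda>e. a * f e + b * g e) = a\<^sup>2 * l2_sq f + 2 * a * b * l2_ip f g + b\<^sup>2 * l2_sq g"
proof -
  have p: "(\<lambda>e. f e * g e) summable_on UNIV" using l2_prod_summable assms by blast
  have "l2_sq (\<lambda>e. a * f e + b * g e) = (\<Sum>\<^sub>\<infinity>e. (a\<^sup>2 * (f e)\<^sup>2 + b\<^sup>2 * (g e)\<^sup>2) + 2 * a * b * (f e * g e))"
    unfolding l2_sq_def by (rule infsum_cong) (simp add: power2_eq_square algebra_simps)
  also have "\<dots> = (\<Sum>\<^sub>\<infinity>e. a\<^sup>2 * (f e)\<^sup>2 + b\<^sup>2 * (g e)\<^sup>2) + (\<Sum>\<^sub>\<infinity>e. 2 * a * b * (f e * g e))"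
    using assms p by (intro infsum_add summable_on_add summable_on_cmult_right) (auto simp: l2_def)
  also have "(\<Sum>\<^sub>\<infinity>e. a\<^sup>2 * (f e)\<^sup>2 + b\<^sup>2 * (g e)\<^sup>2) = (\<Sum>\<^sub>\<infinity>e. a\<^sup>2 * (f e)\<^sup>2) + (\<Sum>\<^sub>\<infinity>e. b\<^sup>2 * (g e)\<^sup>2)"
    using assms by (intro infsum_add summable_on_cmult_right) (auto simp: l2_def)
  finally show ?thesis by (simp add: infsum_cmult_right' l2_sq_def l2_ip_def)
qed

lemma l2_ip_lincomb:
  assumes "f \<in> l2" "g \<in> l2" "h \<in> l2"
  shows "l2_ip (\<lambda>e. a * f e + b * g e) h = a * l2_ip f h + b * l2_ip g h"
proof -
  have "l2_ip (\<lambda>e. a * f e + b * g e) h = (\<Sum>\<^sub>\<infinity>e. a * (f e * h e) + b * (g e * h e))"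
    unfolding l2_ip_def by (rule infsum_cong) (simp add: algebra_simps)
  also have "\<dots> = (\<Sum>\<^sub>\<infinity>e. a * (f e * h e)) + (\<Sum>\<^sub>\<infinity>e. b * (g e * h e))"
    using assms l2_prod_summable by (intro infsum_add summable_on_cmult_right) auto
  finally show ?thesis by (simp add: infsum_cmult_right' l2_ip_def)
qed

lemma l2_ip_self: "l2_ip f f = l2_sq f"
  by (simp add: l2_ip_def l2_sq_def power2_eq_square)

lemma l2_sq_eq_0D:
  assumes "f \<in> l2" "l2_sq f = 0" shows "f e = 0"
  using l2_sq_ge_point[OF assms(1), of e] assms(2) by simp

text \<open>Fatou's lemma for counting measure: only finite partial sums are passed to the limit. It
  takes the place of completeness of \<open>l2\<close> below.\<close>

lemma l2_sq_limit_le: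
  fixes f :: "nat \<Rightarrow> 'e \<Rightarrow> real"
  assumes lim: "\<And>e. (\<lambda>n. f n e) \<longlonglongrightarrow> g e" and mem: "\<And>n. f n \<in> l2"
    and D: "(\<lambda>n. l2_sq (f n)) \<longlonglongrightarrow> D"
  shows "g \<in> l2" "l2_sq g \<le> D"
proof -
  have fin: "(\<Sum>e\<in>F. (g e)\<^sup>2) \<le> D" if "finite F" for F
  proof (rule LIMSEQ_le)
    show "(\<lambda>n. \<Sum>e\<in>F. (f n e)\<^sup>2) \<longlonglongrightarrow> (\<Sum>e\<in>F. (g e)\<^sup>2)"
      by (intro tendsto_intros lim)
    show "\<exists>N. \<forall>n\<ge>N. (\<Sum>e\<in>F. (f n e)\<^sup>2) \<le> l2_sq (f n)"
      unfolding l2_sq_def using mem that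
      by (intro exI allI impI finite_sum_le_infsum) (auto simp: l2_def)
  qed (rule D)
  show g: "g \<in> l2" unfolding l2_def
    using fin by (auto intro!: nonneg_bdd_above_summable_on bdd_aboveI)
  show "l2_sq g \<le> D" unfolding l2_sq_def
    using g fin by (intro infsum_le_finite_sums) (auto simp: l2_def)
qed

text \<open>Closedness refers to pointwise limits lying in \<open>l2\<close>, which is more than
  closedness in norm. Subspaces cut out by conditions on finitely many edges each have this
  property, and it is easily applied to a minimising sequence.\<close>

locale closed_subspace =
  fixes Z :: "('e \<Rightarrow> real) set"
  assumes sub: "Z \<subseteq> l2"
    and zero: "(\<lambda>_. 0) \<in> Z"
    and lincomb: "f \<in> Z \<Longrightarrow> g \<in> Z \<Longrightarrow> (\<lambda>e. a * f e + b * g e) \<in> Z"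
    and closed: "\<And>(f :: nat \<Rightarrow> 'e \<Rightarrow> real) g. (\<And>n. f n \<in> Z) \<Longrightarrow> (\<And>e. (\<lambda>n::nat. f n e) \<longlonglongrightarrow> g e) \<Longrightarrow> g \<in> l2 \<Longrightarrow> g \<in> Z"
begin

text \<open>By the parallelogram law a minimising sequence is Cauchy, since midpoints stay in
  \<open>Z\<close>. Its coordinatewise limit lies in \<open>Z\<close> by \<open>closed\<close> and
  attains the infimum by \<open>l2_sq_limit_le\<close>.\<close>

lemma minimizer_exists:
  assumes x: "x \<in> l2"
  shows "\<exists>z\<in>Z. \<forall>y\<in>Z. l2_sq (\<lambda>e. x e - z e) \<le> l2_sq (\<lambda>e. x e - y e)"
proof -
  let ?N = "\<lambda>z. l2_sq (\<lambda>e. x e - z e)"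
  define d where "d = (INF z\<in>Z. ?N z)"
  have bdd: "bdd_below (?N ` Z)" by (auto intro!: bdd_belowI2[where m=0] l2_sq_nonneg)
  have dle: "d \<le> ?N z" if "z \<in> Z" for z unfolding d_def using bdd that by (rule cINF_lower)
  have "\<exists>z\<in>Z. ?N z < d + 1 / real (Suc n)" for n
    using cINF_less_iff[OF _ bdd, of "d + 1 / real (Suc n)"] zero unfolding d_def[symmetric] by fastforce
  then obtain z where z: "\<And>n. z n \<in> Z" "\<And>n. ?N (z n) < d + 1 / real (Suc n)" by metis
  have zs: "z n \<in> l2" for n using z sub by auto
  have par: "l2_sq (\<lambda>e. z n e - z m e) \<le> 2 / real (Suc n) + 2 / real (Suc m)" for n m
  proof -
    let ?a = "\<lambda>e. x e - z n e" and ?b = "\<lambda>e. x e - z m e"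
    have ab: "?a \<in> l2" "?b \<in> l2" using x zs l2_diff by auto
    have "(\<lambda>e. (1/2) * z n e + (1/2) * z m e) \<in> Z" by (intro lincomb z)
    from dle[OF this] have "d \<le> l2_sq (\<lambda>e. (1/2) * ?a e + (1/2) * ?b e)"
      by (simp add: algebra_simps)
    also have "\<dots> = (1/4) * l2_sq ?a + (1/2) * l2_ip ?a ?b + (1/4) * l2_sq ?b"
      unfolding l2_sq_lincomb[OF ab] by (simp add: power2_eq_square)
    finally have 1: "4 * d \<le> l2_sq ?a + 2 * l2_ip ?a ?b + l2_sq ?b" by simp
    have "l2_sq (\<lambda>e. z n e - z m e) = l2_sq (\<lambda>e. (-1) * ?a e + 1 * ?b e)" by simp
    also have "\<dots> = l2_sq ?a - 2 * l2_ip ?a ?b + l2_sq ?b" unfolding l2_sq_lincomb[OF ab] by simp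
    finally show ?thesis using 1 z(2)[of n] z(2)[of m] by simp
  qed
  have "Cauchy (\<lambda>n. z n e)" for e
  proof (rule metric_CauchyI)
    fix \<epsilon> :: real assume "\<epsilon> > 0"
    then have "\<epsilon>\<^sup>2 > 0" by simp
    then obtain M where M: "4 / real (Suc M) < \<epsilon>\<^sup>2"
      using reals_Archimedean[of "\<epsilon>\<^sup>2/4"] by (auto simp: field_simps)
    have "dist (z m e) (z n e) < \<epsilon>" if "m \<ge> M" "n \<ge> M" for m n
    proof -
      have "(z m e - z n e)\<^sup>2 \<le> l2_sq (\<lambda>e. z m e - z n e)"
        using l2_sq_ge_point[OF l2_diff[OF zs zs]] .
      also have "\<dots> \<le> 2 / real (Suc m) + 2 / real (Suc n)" by (rule par)
      also have "\<dots> \<le> 2 / real (Suc M) + 2 / real (Suc M)"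
        using that by (intro add_mono divide_left_mono) auto
      also have "\<dots> < \<epsilon>\<^sup>2" using M by simp
      finally have "\<bar>z m e - z n e\<bar>\<^sup>2 < \<epsilon>\<^sup>2" by simp
      then show ?thesis using \<open>\<epsilon> > 0\<close> by (simp add: dist_real_def power2_less_imp_less)
    qed
    then show "\<exists>M. \<forall>m\<ge>M. \<forall>n\<ge>M. dist (z m e) (z n e) < \<epsilon>" by blast
  qed
  then have "\<exists>w. (\<lambda>n. z n e) \<longlonglongrightarrow> w" for e using Cauchy_convergent convergentD by blast
  then obtain w where w: "\<And>e. (\<lambda>n. z n e) \<longlonglongrightarrow> w e" by metis
  have up: "(\<lambda>n. d + 1 / real (Suc n)) \<longlonglongrightarrow> d"
    using tendsto_add[OF tendsto_const LIMSEQ_Suc[OF lim_1_over_n], of d] by simp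
  have Nlim: "(\<lambda>n. ?N (z n)) \<longlonglongrightarrow> d"
  proof (rule real_tendsto_sandwich[OF _ _ tendsto_const up])
    show "\<forall>\<^sub>F n in sequentially. d \<le> ?N (z n)" using dle[OF z(1)] by simp
    show "\<forall>\<^sub>F n in sequentially. ?N (z n) \<le> d + 1 / real (Suc n)"
      using less_imp_le[OF z(2)] by (intro always_eventually allI)
  qed
  have "(\<lambda>n. x e - z n e) \<longlonglongrightarrow> x e - w e" for e by (intro tendsto_intros w)
  note xw = l2_sq_limit_le[OF this l2_diff[OF x zs] Nlim]
  have "w \<in> l2" using l2_diff[OF x xw(1)] by simp
  then have "w \<in> Z" using closed[of z w] z w by auto
  then show ?thesis using xw(2) dle by (meson order_trans)
qed

definition is_proj :: "('e \<Rightarrow> real) \<Rightarrow> ('e \<Rightarrow> real) \<Rightarrow> bool" where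
  "is_proj x z \<longleftrightarrow> z \<in> Z \<and> (\<forall>y\<in>Z. l2_ip (\<lambda>e. x e - z e) y = 0)"

lemma projection_exists:
  assumes x: "x \<in> l2"
  shows "\<exists>!z. is_proj x z"
proof -
  obtain z where z: "z \<in> Z" and min: "\<And>y. y \<in> Z \<Longrightarrow> l2_sq (\<lambda>e. x e - z e) \<le> l2_sq (\<lambda>e. x e - y e)"
    using minimizer_exists[OF x] by blast
  have xz: "(\<lambda>e. x e - z e) \<in> l2" using x z sub l2_diff by blast
  have orth: "l2_ip (\<lambda>e. x e - z e) y = 0" if y: "y \<in> Z" for y
  proof (rule ccontr)
    let ?s = "l2_ip (\<lambda>e. x e - z e) y"
    assume "?s \<noteq> 0"
    have ys: "y \<in> l2" using y sub by auto
    \<comment> \<open>The optimal step would be \<open>?s / l2_sq y\<close>; the added 1 avoids a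
      division by zero and still shortens the distance.\<close>
    define t where "t = ?s / (l2_sq y + 1)"
    have "(\<lambda>e. 1 * z e + t * y e) \<in> Z" using lincomb z y by blast
    from min[OF this] have "l2_sq (\<lambda>e. x e - z e) \<le> l2_sq (\<lambda>e. 1 * (x e - z e) + (-t) * y e)"
      by (simp add: algebra_simps)
    also have "\<dots> = l2_sq (\<lambda>e. x e - z e) - 2 * t * ?s + t\<^sup>2 * l2_sq y"
      unfolding l2_sq_lincomb[OF xz ys] by simp
    finally have "2 * t * ?s \<le> t\<^sup>2 * l2_sq y" by simp
    moreover have pos: "l2_sq y + 1 > 0" using l2_sq_nonneg[of y] by simp
    have "?s = t * (l2_sq y + 1)" unfolding t_def using pos by simp
    ultimately have "2 * t\<^sup>2 * (l2_sq y + 1) \<le> t\<^sup>2 * l2_sq y" by (simp add: power2_eq_square mult.assoc)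
    then have "t\<^sup>2 * (l2_sq y + 2) \<le> 0" by (simp add: algebra_simps)
    moreover have "t \<noteq> 0" using \<open>?s \<noteq> 0\<close> pos by (simp add: t_def)
    then have "t\<^sup>2 * (l2_sq y + 2) > 0" using l2_sq_nonneg[of y] by (intro mult_pos_pos) auto
    ultimately show False by linarith
  qed
  have uniq: "z' = z" if z': "z' \<in> Z" "\<forall>y\<in>Z. l2_ip (\<lambda>e. x e - z' e) y = 0" for z'
  proof -
    define y where "y = (\<lambda>e. 1 * z e + (-1) * z' e)"
    have y: "y \<in> Z" unfolding y_def by (rule lincomb[OF z z'(1)])
    have xz': "(\<lambda>e. x e - z' e) \<in> l2" using x z' sub l2_diff by blast
    have "y = (\<lambda>e. 1 * (x e - z' e) + (-1) * (x e - z e))" by (auto simp: y_def)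
    then have "l2_sq y = l2_ip (\<lambda>e. 1 * (x e - z' e) + (-1) * (x e - z e)) y" by (simp add: l2_ip_self[symmetric])
    then have "l2_sq y = 0" using l2_ip_lincomb[OF xz' xz, of y 1 "-1"] y sub orth z' by auto
    then have "y e = 0" for e using l2_sq_eq_0D[of y e] y sub by blast
    then show "z' = z" by (simp add: y_def fun_eq_iff)
  qed
  show ?thesis
  proof (rule ex1I)
    show "is_proj x z" unfolding is_proj_def using z orth by simp
  qed (auto simp: is_proj_def intro: uniq)
qed

definition proj :: "('e \<Rightarrow> real) \<Rightarrow> ('e \<Rightarrow> real)" where
  "proj x = (THE z. is_proj x z)"

lemma is_proj_proj: "x \<in> l2 \<Longrightarrow> is_proj x (proj x)"
  unfolding proj_def by (rule theI'[OF projection_exists])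

lemma proj_in: "x \<in> l2 \<Longrightarrow> proj x \<in> Z"
  using is_proj_proj by (simp add: is_proj_def)

lemma proj_orth: "x \<in> l2 \<Longrightarrow> y \<in> Z \<Longrightarrow> l2_ip (\<lambda>e. x e - proj x e) y = 0"
  using is_proj_proj by (simp add: is_proj_def)

lemma proj_eqI:
  assumes "x \<in> l2" "z \<in> Z" "\<And>y. y \<in> Z \<Longrightarrow> l2_ip (\<lambda>e. x e - z e) y = 0"
  shows "proj x = z"
  unfolding proj_def
  by (rule the1_equality[OF projection_exists[OF assms(1)]]) (simp add: is_proj_def assms(2,3))

lemma proj_id: "z \<in> Z \<Longrightarrow> proj z = z"
  using sub by (intro proj_eqI) (auto simp: l2_ip_def)

lemma proj_lincomb:
  assumes "x \<in> l2" "y \<in> l2"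
  shows "proj (\<lambda>e. a * x e + b * y e) = (\<lambda>e. a * proj x e + b * proj y e)"
proof (rule proj_eqI)
  fix w assume w: "w \<in> Z"
  have 1: "(\<lambda>e. x e - proj x e) \<in> l2" "(\<lambda>e. y e - proj y e) \<in> l2"
    using assms proj_in sub l2_diff by blast+
  have "(\<lambda>e. a * x e + b * y e - (a * proj x e + b * proj y e)) =
        (\<lambda>e. a * (x e - proj x e) + b * (y e - proj y e))" by (auto simp: algebra_simps)
  then show "l2_ip (\<lambda>e. a * x e + b * y e - (a * proj x e + b * proj y e)) w = 0"
    using l2_ip_lincomb[OF 1, of w] w sub proj_orth assms by auto
qed (auto intro: l2_lincomb lincomb proj_in assms)

lemma proj_diff:
  assumes "x \<in> l2" "y \<in> l2"
  shows "proj (\<lambda>e. x e - y e) = (\<lambda>e. proj x e - proj y e)"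
  using proj_lincomb[OF assms, of 1 "-1"] by simp

lemma l2_sq_proj_le:
  assumes x: "x \<in> l2" shows "l2_sq (proj x) \<le> l2_sq x"
proof -
  have p: "proj x \<in> Z" "proj x \<in> l2" using proj_in[OF x] sub by auto
  have r: "(\<lambda>e. x e - proj x e) \<in> l2" using x p l2_diff by blast
  have "l2_sq x = l2_sq (\<lambda>e. 1 * (x e - proj x e) + 1 * proj x e)" by simp
  also have "\<dots> = l2_sq (\<lambda>e. x e - proj x e) + l2_sq (proj x)"
    unfolding l2_sq_lincomb[OF r p(2)] using proj_orth[OF x p(1)] by simp
  finally show ?thesis using l2_sq_nonneg[of "\<lambda>e. x e - proj x e"] by simp
qed

end

section \<open>Gluing continuous functions along the cells\<close>

text \<open>A continuous map from a compact space to a Hausdorff space is closed, hence a quotient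
  map onto its image; so continuity of \<open>g\<close> can be tested after composition with the
  parametrisation \<open>P\<close>.\<close>

lemma continuous_on_image_compact:
  fixes P :: "'a::topological_space \<Rightarrow> 'b::t2_space" and g :: "'b \<Rightarrow> 'c::topological_space"
  assumes S: "compact S" and P: "continuous_on S P"
    and g: "continuous_on {q\<in>S. P q \<in> Y} (\<lambda>q. g (P q))"
  shows "continuous_on (P ` S \<inter> Y) g"
  unfolding continuous_on_closed_invariant
proof (intro allI impI)
  fix B :: "'c set" assume "closed B"
  then obtain A where A: "closed A" "A \<inter> {q\<in>S. P q \<in> Y} = (\<lambda>q. g (P q)) -` B \<inter> {q\<in>S. P q \<in> Y}"
    using g unfolding continuous_on_closed_invariant by blast
  have "compact (S \<inter> A)" using S A(1) by (rule compact_Int_closed)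
  then have "compact (P ` (S \<inter> A))"
    using P by (intro compact_continuous_image) (auto intro: continuous_on_subset)
  then have "closed (P ` (S \<inter> A))" by (rule compact_imp_closed)
  moreover have "P ` (S \<inter> A) \<inter> (P ` S \<inter> Y) = g -` B \<inter> (P ` S \<inter> Y)"
    using A(2) by blast
  ultimately show "\<exists>C. closed C \<and> C \<inter> (P ` S \<inter> Y) = g -` B \<inter> (P ` S \<inter> Y)" by blast
qed

lemma continuous_on_locally_finite_closed_cover:
  fixes g :: "'a::topological_space \<Rightarrow> 'b::topological_space"
  assumes cont: "\<And>i. i \<in> I \<Longrightarrow> continuous_on (C i \<inter> Y) g" and cl: "\<And>i. i \<in> I \<Longrightarrow> closed (C i)"
    and cover: "Y \<subseteq> (\<Union>i\<in>I. C i)"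
    and lf: "\<And>y. y \<in> Y \<Longrightarrow> \<exists>U. open U \<and> y \<in> U \<and> finite {i\<in>I. C i \<inter> U \<inter> Y \<noteq> {}}"
  shows "continuous_on Y g"
proof -
  have "continuous_map (top_of_set Y) euclidean g"
  proof (rule pasting_lemma_locally_finite[where I=I and T="\<lambda>i. C i \<inter> Y" and f="\<lambda>_. g"])
    fix x assume "x \<in> topspace (top_of_set Y)"
    then obtain U where U: "open U" "x \<in> U" "finite {i\<in>I. C i \<inter> U \<inter> Y \<noteq> {}}" using lf by auto
    show "\<exists>V. openin (top_of_set Y) V \<and> x \<in> V \<and> finite {i \<in> I. C i \<inter> Y \<inter> V \<noteq> {}}"
    proof (intro exI conjI)
      show "openin (top_of_set Y) (Y \<inter> U)" using U(1) by (rule openin_open_Int)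
      show "x \<in> Y \<inter> U" using U(2) \<open>x \<in> topspace (top_of_set Y)\<close> by simp
      show "finite {i \<in> I. C i \<inter> Y \<inter> (Y \<inter> U) \<noteq> {}}"
        by (rule finite_subset[OF _ U(3)]) blast
    qed
  next
    fix i assume "i \<in> I"
    show "closedin (top_of_set Y) (C i \<inter> Y)"
      using cl[OF \<open>i \<in> I\<close>] closedin_closed_Int[of "C i" Y] by (simp add: Int_commute)
    have "top_of_set (Y \<inter> (C i \<inter> Y)) = top_of_set (C i \<inter> Y)" by (simp add: Int_absorb1)
    then show "continuous_map (subtopology (top_of_set Y) (C i \<inter> Y)) euclidean g"
      using cont[OF \<open>i \<in> I\<close>] by (simp add: subtopology_subtopology)
  qed (use cover in auto)
  then show ?thesis by simp
qed

text \<open>The parametrisation of the circle by an interval of length \<open>n\<close>, one unit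
  for each boundary edge, identifies only the two end points. So \<open>l\<close> descends to the
  circle, and Tietze's theorem extends it over the disk.\<close>

lemma disk_extension:
  fixes l :: "real \<Rightarrow> real" and n :: nat
  assumes n: "n > 0" and l: "continuous_on {0..real n} l" and per: "l 0 = l (real n)"
  shows "\<exists>g::complex \<Rightarrow> real. continuous_on (cball 0 1) g \<and>
     (\<forall>s\<in>{0..real n}. g (cis (2 * pi * s / real n)) = l s)"
proof -
  let ?P = "\<lambda>s. cis (2 * pi * s / real n)"
  have P: "continuous_on {0..real n} ?P" using n by (intro continuous_intros) auto
  have inj: "l s = l t" if s: "s \<in> {0..real n}" "t \<in> {0..real n}" "?P s = ?P t" for s t
  proof -
    have "sin (2 * pi * s / real n) = sin (2 * pi * t / real n) \<and> cos (2 * pi * s / real n) = cos (2 * pi * t / real n)"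
      using s(3) by (simp add: cis.ctr)
    then obtain k :: int where "2 * pi * s / real n = 2 * pi * t / real n + 2 * pi * of_int k"
      using sin_cos_eq_iff by blast
    then have "2 * pi * s = 2 * pi * (t + real n * of_int k)" using n by (simp add: field_simps)
    then have st: "s = t + real n * of_int k" by simp
    consider "k \<le> -2" | "k = -1" | "k = 0" | "k = 1" | "k \<ge> 2" by linarith
    then show ?thesis
    proof cases
      case 1
      then have "real n * of_int k \<le> real n * (-2)" by (intro mult_left_mono) auto
      then show ?thesis using st s n by auto
    next
      case 5
      then have "real n * of_int k \<ge> real n * 2" by (intro mult_left_mono) auto
      moreover have "s \<le> real n" "0 \<le> t" "real n > 0" using s n by auto
      ultimately show ?thesis using st by linarith
    next
      case 2
      then have "s = 0" "t = real n" using st s by auto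
      then show ?thesis using per by simp
    next
      case 4
      then have "t = 0" "s = real n" using st s by auto
      then show ?thesis using per by simp
    qed (use st in simp)
  qed
  define m where "m z = l (SOME s. s \<in> {0..real n} \<and> ?P s = z)" for z
  have m: "m (?P s) = l s" if "s \<in> {0..real n}" for s
  proof -
    let ?t = "SOME t. t \<in> {0..real n} \<and> ?P t = ?P s"
    have "?t \<in> {0..real n} \<and> ?P ?t = ?P s" by (rule someI[of _ s]) (use that in simp)
    then show ?thesis using inj that unfolding m_def by blast
  qed
  have "continuous_on (?P ` {0..real n} \<inter> UNIV) m"
  proof (rule continuous_on_image_compact[OF _ P])
    have "continuous_on {0..real n} (\<lambda>s. m (?P s))"
      using l by (rule continuous_on_eq) (simp add: m)
    moreover have "{q \<in> {0..real n}. ?P q \<in> UNIV} = {0..real n}" by auto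
    ultimately show "continuous_on {q \<in> {0..real n}. ?P q \<in> UNIV} (\<lambda>q. m (?P q))" by (simp only:)
  qed simp
  then have mc: "continuous_on (?P ` {0..real n}) m" by simp
  have "compact (?P ` {0..real n})" using P by (rule compact_continuous_image) simp
  then have "closedin (top_of_set (cball 0 1)) (?P ` {0..real n})"
    by (intro closed_subset) (auto simp: compact_imp_closed)
  from Tietze_unbounded[OF mc this] obtain g :: "complex \<Rightarrow> real"
    where g: "continuous_on (cball 0 1) g" "\<And>x. x \<in> ?P ` {0..real n} \<Longrightarrow> g x = m x" by metis
  show ?thesis using g m by (intro exI[of _ g]) auto
qed

section \<open>Boundary walks of the faces and incidences between the cells\<close>

locale disk_complex =
  fixes G :: "('v, 'e, 'f, 'p::topological_space) cell_complex"
  assumes disk: "disk_cell_decomposition G"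
begin

text \<open>Rotation about the initial vertex: the left face of \<open>rho e\<close> is the right
  face of \<open>e\<close>, so the rotation is clockwise.\<close>

abbreviation "rho e \<equiv> nxt G (rv G e)"

lemma rv_rv [simp]: "rv G (rv G e) = e" and rv_neq [simp]: "rv G e \<noteq> e"
  using disk by (auto simp: disk_cell_decomposition_def)

lemma src_nxt [simp]: "src G (nxt G e) = trg G e" and lface_nxt [simp]: "lface G (nxt G e) = lface G e"
  using disk by (auto simp: disk_cell_decomposition_def)

lemma src_rv [simp]: "src G (rv G e) = trg G e" and trg_rv [simp]: "trg G (rv G e) = src G e"
  by (simp_all add: trg_def)

lemma lface_rv [simp]: "lface G (rv G e) = rface G e" and rface_rv [simp]: "rface G (rv G e) = lface G e"
  by (simp_all add: rface_def)

lemma lface_nxt_pow [simp]: "lface G ((nxt G ^^ k) e) = lface G e"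
  by (induction k) auto

lemma face_walk:
  obtains e n where "n > 0" "lface G e = f" "(nxt G ^^ n) e = e"
    "\<And>d. lface G d = f \<Longrightarrow> \<exists>k<n. d = (nxt G ^^ k) e"
    "inj_on (\<lambda>k. (nxt G ^^ k) e) {..<n}"
    "\<And>k t. k < n \<Longrightarrow> t \<in> {0..1} \<Longrightarrow>
       face_map G f (cis (2 * pi * (real k + t) / real n)) = edge_map G ((nxt G ^^ k) e) t"
proof -
  have "face_attached G f" using disk by (auto simp: disk_cell_decomposition_def)
  then obtain e n where e: "n > 0" "(nxt G ^^ n) e = e"
    "bij_betw (\<lambda>k. (nxt G ^^ k) e) {..<n} {d. lface G d = f}"
    "\<forall>k<n. \<forall>t\<in>{0..1}.
       face_map G f (cis (2 * pi * (real k + t) / real n)) = edge_map G ((nxt G ^^ k) e) t"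
    unfolding face_attached_def by (elim conjE exE)
  have im: "(\<lambda>k. (nxt G ^^ k) e) ` {..<n} = {d. lface G d = f}" using e(3) by (rule bij_betw_imp_surj_on)
  have "(nxt G ^^ 0) e \<in> {d. lface G d = f}" unfolding im[symmetric] by (rule imageI) (use e(1) in simp)
  then have 1: "lface G e = f" by simp
  have 2: "\<exists>k<n. d = (nxt G ^^ k) e" if "lface G d = f" for d
  proof -
    have "d \<in> (\<lambda>k. (nxt G ^^ k) e) ` {..<n}" unfolding im using that by simp
    then show ?thesis by auto
  qed
  show thesis
    by (rule that[OF e(1) 1 e(2) 2 bij_betw_imp_inj_on[OF e(3)]]) (use e(4) in simp_all)
qed

lemma finite_lface: "finite {d. lface G d = f}"
proof -
  obtain e n where *: "\<And>d. lface G d = f \<Longrightarrow> \<exists>k<n::nat. d = (nxt G ^^ k) e" using face_walk[of f] by metis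
  have "{d. lface G d = f} \<subseteq> (\<lambda>k. (nxt G ^^ k) e) ` {..<n}" using * by auto
  then show ?thesis by (rule finite_subset) simp
qed

lemma face_has_edge: "\<exists>e. lface G e = f"
  using face_walk[of f] by metis

lemma nxt_transitive:
  assumes "lface G a = lface G b" shows "\<exists>m. (nxt G ^^ m) a = b"
proof -
  obtain e n where n: "(nxt G ^^ n) e = e"
    and w: "\<And>d. lface G d = lface G b \<Longrightarrow> \<exists>k<n. d = (nxt G ^^ k) e" using face_walk[of "lface G b"] by metis
  obtain i where i: "i < n" "a = (nxt G ^^ i) e" using w[OF assms] by blast
  obtain j where j: "j < n" "b = (nxt G ^^ j) e" using w[OF refl] by blast
  have "(nxt G ^^ (j + (n - i))) a = (nxt G ^^ (j + (n - i) + i)) e" by (simp add: i funpow_add)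
  also have "j + (n - i) + i = j + n" using i by simp
  also have "(nxt G ^^ (j + n)) e = b" by (simp add: funpow_add n j)
  finally show ?thesis by blast
qed

lemma nxt_periodic:
  obtains n where "n > 0" "\<And>d. lface G d = f \<Longrightarrow> (nxt G ^^ n) d = d"
proof -
  obtain e n where n: "n > 0" "(nxt G ^^ n) e = e"
    and w: "\<And>d. lface G d = f \<Longrightarrow> \<exists>k<n. d = (nxt G ^^ k) e" using face_walk[of f] by metis
  have "(nxt G ^^ n) d = d" if d: "lface G d = f" for d
  proof -
    obtain k where "d = (nxt G ^^ k) e" using w[OF d] by blast
    moreover have "(nxt G ^^ n) ((nxt G ^^ k) e) = (nxt G ^^ k) ((nxt G ^^ n) e)"
      by (simp add: funpow_add[symmetric, THEN fun_cong, unfolded o_def] add.commute)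
    ultimately show ?thesis using n by simp
  qed
  then show thesis using that n(1) by blast
qed

lemma bij_nxt_face: "bij_betw (nxt G) {d. lface G d = f} {d. lface G d = f}"
proof -
  obtain n where n: "n > 0" "\<And>d. lface G d = f \<Longrightarrow> (nxt G ^^ n) d = d" using nxt_periodic by blast
  then obtain m where m: "n = Suc m" by (cases n) auto
  have "d \<in> nxt G ` {d. lface G d = f}" if d: "lface G d = f" for d
  proof (rule image_eqI)
    show "d = nxt G ((nxt G ^^ m) d)" using n(2)[OF d] m by simp
  qed (use d in simp)
  then have "nxt G ` {d. lface G d = f} = {d. lface G d = f}" by auto
  then show ?thesis using finite_lface finite_surj_inj[of "{d. lface G d = f}" "nxt G"]
    by (simp add: bij_betw_def)
qed

lemma inj_nxt: "inj (nxt G)"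
proof (rule injI)
  fix a b assume h: "nxt G a = nxt G b"
  then have "lface G a = lface G b" by (metis lface_nxt)
  then show "a = b" using inj_onD[OF bij_betw_imp_inj_on[OF bij_nxt_face[of "lface G b"]] h] by simp
qed

lemma inj_rho: "inj (\<lambda>e. rho e)"
  by (rule injI) (metis inj_nxt injD rv_rv)

text \<open>One starting edge and boundary length is chosen for each face, so that functions on the
  closed disks can be prescribed along numbered boundary edges.\<close>

definition face_param :: "'f \<Rightarrow> 'e \<times> nat" where
  "face_param f = (SOME p. snd p > 0 \<and> lface G (fst p) = f \<and> (nxt G ^^ snd p) (fst p) = fst p \<and>
    inj_on (\<lambda>k. (nxt G ^^ k) (fst p)) {..<snd p} \<and>
    (\<forall>k<snd p. \<forall>t\<in>{0..1}.
       face_map G f (cis (2 * pi * (real k + t) / real (snd p))) = edge_map G ((nxt G ^^ k) (fst p)) t))"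

definition face_start :: "'f \<Rightarrow> 'e" where "face_start f = fst (face_param f)"
definition face_len :: "'f \<Rightarrow> nat" where "face_len f = snd (face_param f)"

lemma face_param:
  "face_len f > 0 \<and> lface G (face_start f) = f \<and> (nxt G ^^ face_len f) (face_start f) = face_start f \<and>
   inj_on (\<lambda>k. (nxt G ^^ k) (face_start f)) {..<face_len f} \<and> (\<forall>k<face_len f. \<forall>t\<in>{0..1}.
     face_map G f (cis (2 * pi * (real k + t) / real (face_len f))) = edge_map G ((nxt G ^^ k) (face_start f)) t)"
  unfolding face_param_def face_start_def face_len_def
proof (rule someI_ex)
  obtain e n where "n > 0" "lface G e = f" "(nxt G ^^ n) e = e" "inj_on (\<lambda>k. (nxt G ^^ k) e) {..<n}"
    "\<And>k t. k < n \<Longrightarrow> t \<in> {0..1} \<Longrightarrow>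
       face_map G f (cis (2 * pi * (real k + t) / real n)) = edge_map G ((nxt G ^^ k) e) t"
    using face_walk[of f] by metis
  then show "\<exists>p. snd p > 0 \<and> lface G (fst p) = f \<and> (nxt G ^^ snd p) (fst p) = fst p \<and>
    inj_on (\<lambda>k. (nxt G ^^ k) (fst p)) {..<snd p} \<and>
    (\<forall>k<snd p. \<forall>t\<in>{0..1}.
       face_map G f (cis (2 * pi * (real k + t) / real (snd p))) = edge_map G ((nxt G ^^ k) (fst p)) t)"
    by (intro exI[of _ "(e, n)"]) simp
qed

lemma face_len_pos: "face_len f > 0" and lface_face_start: "lface G (face_start f) = f" and nxt_face_len_start: "(nxt G ^^ face_len f) (face_start f) = face_start f"
  using face_param by simp_all

lemma face_map_boundary:
  "k < face_len f \<Longrightarrow> t \<in> {0..1} \<Longrightarrow>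
     face_map G f (cis (2 * pi * (real k + t) / real (face_len f))) = edge_map G ((nxt G ^^ k) (face_start f)) t"
  using face_param[of f] by simp

lemma bij_face_walk: "bij_betw (\<lambda>k. (nxt G ^^ k) (face_start f)) {..<face_len f} {d. lface G d = f}"
proof -
  have "d \<in> (\<lambda>k. (nxt G ^^ k) (face_start f)) ` {..<face_len f}" if d: "lface G d = f" for d
  proof -
    obtain m where "(nxt G ^^ m) (face_start f) = d" using nxt_transitive[of "face_start f" d] lface_face_start d by metis
    then have "(nxt G ^^ (m mod face_len f)) (face_start f) = d" using funpow_mod_eq[OF nxt_face_len_start[of f], of m] by simp
    then show ?thesis using face_len_pos[of f] by (intro image_eqI[of _ _ "m mod face_len f"]) auto
  qed
  then have "(\<lambda>k. (nxt G ^^ k) (face_start f)) ` {..<face_len f} = {d. lface G d = f}" by (auto simp: lface_face_start)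
  then show ?thesis using face_param[of f] by (simp add: bij_betw_def)
qed

lemma sum_face: "(\<Sum>e | lface G e = f. w e) = (\<Sum>k<face_len f. w ((nxt G ^^ k) (face_start f)))"
  by (rule sum.reindex_bij_betw[OF bij_face_walk, symmetric])

lemma sphere_param:
  assumes "norm z = 1" "n > 0"
  obtains k t where "k < n" "t \<in> {0..<1}" "z = cis (2 * pi * (real k + t) / real n)"
proof -
  define s where "s = Arg2pi z * real n / (2 * pi)"
  have "0 \<le> Arg2pi z" "Arg2pi z < 2 * pi" using Arg2pi by auto
  then have s: "0 \<le> s" "s < real n" using assms(2) by (auto simp: s_def field_simps)
  have "z \<noteq> 0" using assms(1) by auto
  then have z: "z = cis (Arg2pi z)"
    using Arg2pi[of z] assms(1) by (simp add: cis_conv_exp is_Arg_def)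
  have eq: "real (nat \<lfloor>s\<rfloor>) + frac s = s" using s by (simp add: frac_def)
  show thesis
  proof (rule that[of "nat \<lfloor>s\<rfloor>" "frac s"])
    show "nat \<lfloor>s\<rfloor> < n" using s by linarith
    show "frac s \<in> {0..<1}" by (simp add: frac_lt_1)
    have "2 * pi * s / real n = Arg2pi z" using assms(2) by (simp add: s_def)
    then show "z = cis (2 * pi * (real (nat \<lfloor>s\<rfloor>) + frac s) / real n)" unfolding eq using z by simp
  qed
qed

lemma edge_map_0: "edge_map G e 0 = vpos G (src G e)"
  and edge_map_rv: "t \<in> {0..1} \<Longrightarrow> edge_map G (rv G e) t = edge_map G e (1 - t)"
  and edge_map_continuous: "continuous_on {0..1} (edge_map G e)"
  and edge_map_inj: "inj_on (edge_map G e) {0<..<1}"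
  using disk by (auto simp: disk_cell_decomposition_def edge_attached_def)

lemma edge_map_1: "edge_map G e 1 = vpos G (trg G e)"
  using edge_map_rv[of 0 e] edge_map_0[of "rv G e"] by simp

lemma face_map_continuous: "continuous_on (cball 0 1) (face_map G f)"
  and face_map_inj: "inj_on (face_map G f) (ball 0 1)"
  using disk by (auto simp: disk_cell_decomposition_def face_attached_def)

lemma surface_cells: "range (vpos G) \<union> (\<Union>e. open_edge G e) \<union> (\<Union>f. open_face G f) = surface G"
  using disk unfolding disk_cell_decomposition_def by (elim conjE)

lemma vpos_inj: "inj (vpos G)"
  using disk unfolding disk_cell_decomposition_def by (elim conjE)

lemma vpos_surface: "vpos G v \<in> surface G"
  using surface_cells by blast

lemma edge_map_surface: "t \<in> {0..1} \<Longrightarrow> edge_map G e t \<in> surface G"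
proof -
  assume t: "t \<in> {0..1}"
  consider "t = 0" | "t = 1" | "t \<in> {0<..<1}" using t by fastforce
  then show ?thesis
  proof cases
    case 3
    then have "edge_map G e t \<in> open_edge G e" unfolding open_edge_def by blast
    then show ?thesis using surface_cells by blast
  qed (use edge_map_0 edge_map_1 vpos_surface in simp_all)
qed

lemma face_map_sphere_cases:
  assumes "norm q = 1"
  obtains k t where "k < face_len f" "t \<in> {0..<1}" "q = cis (2 * pi * (real k + t) / real (face_len f))"
    "face_map G f q = edge_map G ((nxt G ^^ k) (face_start f)) t"
proof -
  obtain k t where kt: "k < face_len f" "t \<in> {0..<1}" "q = cis (2 * pi * (real k + t) / real (face_len f))"
    using sphere_param[OF assms face_len_pos[of f]] by blast
  then have "face_map G f q = edge_map G ((nxt G ^^ k) (face_start f)) t"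
    using face_map_boundary[of k f t] by simp
  then show thesis using that kt by blast
qed

lemma face_map_surface: "q \<in> cball 0 1 \<Longrightarrow> face_map G f q \<in> surface G"
proof (cases "norm q = 1")
  case True
  then obtain k t where "t \<in> {0..<1}" "face_map G f q = edge_map G ((nxt G ^^ k) (face_start f)) t"
    using face_map_sphere_cases by metis
  then show ?thesis using edge_map_surface[of t] by simp
next
  case False
  assume "q \<in> cball 0 1"
  then have "q \<in> ball 0 1" using False by simp
  then have "face_map G f q \<in> open_face G f" unfolding open_face_def by blast
  then show ?thesis using surface_cells by blast
qed

lemma vpos_ne_edge: "t \<in> {0<..<1} \<Longrightarrow> vpos G v \<noteq> edge_map G e t"
proof
  assume t: "t \<in> {0<..<1}" and h: "vpos G v = edge_map G e t"
  have "range (vpos G) \<inter> (\<Union>e. open_edge G e) = {}"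
    using disk unfolding disk_cell_decomposition_def by (elim conjE)
  moreover have "edge_map G e t \<in> open_edge G e" using t unfolding open_edge_def by blast
  ultimately show False using h[symmetric] by blast
qed

lemma vpos_ne_face: "q \<in> ball 0 1 \<Longrightarrow> vpos G v \<noteq> face_map G f q"
proof
  assume t: "q \<in> ball 0 1" and h: "vpos G v = face_map G f q"
  have "range (vpos G) \<inter> (\<Union>f. open_face G f) = {}"
    using disk unfolding disk_cell_decomposition_def by (elim conjE)
  moreover have "face_map G f q \<in> open_face G f" using t unfolding open_face_def by blast
  ultimately show False using h[symmetric] by blast
qed

lemma edge_ne_face: "t \<in> {0<..<1} \<Longrightarrow> q \<in> ball 0 1 \<Longrightarrow> edge_map G e t \<noteq> face_map G f q"
proof
  assume t: "t \<in> {0<..<1}" "q \<in> ball 0 1" and h: "edge_map G e t = face_map G f q"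
  have "(\<Union>e. open_edge G e) \<inter> (\<Union>f. open_face G f) = {}"
    using disk unfolding disk_cell_decomposition_def by (elim conjE)
  moreover have "face_map G f q \<in> open_face G f" using t unfolding open_face_def by blast
  moreover have "edge_map G e t \<in> open_edge G e" using t unfolding open_edge_def by blast
  ultimately show False using h by (metis IntI UN_I UNIV_I empty_iff)
qed

lemma edge_map_eq_cases:
  assumes t: "t \<in> {0<..<1}" "t' \<in> {0<..<1}" and h: "edge_map G e t = edge_map G e' t'"
  shows "(e' = e \<and> t' = t) \<or> (e' = rv G e \<and> t' = 1 - t)"
proof -
  have "\<forall>e e'. e' \<noteq> e \<and> e' \<noteq> rv G e \<longrightarrow> open_edge G e \<inter> open_edge G e' = {}"
    using disk unfolding disk_cell_decomposition_def by (elim conjE)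
  moreover have "edge_map G e t \<in> open_edge G e" "edge_map G e' t' \<in> open_edge G e'"
    using t unfolding open_edge_def by blast+
  ultimately consider "e' = e" | "e' = rv G e" using h by (metis IntI empty_iff)
  then show ?thesis
  proof cases
    case 1
    then show ?thesis using inj_onD[OF edge_map_inj, of e t t'] h t by simp
  next
    case 2
    then have "edge_map G e t = edge_map G e (1 - t')" using h edge_map_rv[of t' e] t by simp
    then have "t = 1 - t'" using inj_onD[OF edge_map_inj, of e t "1 - t'"] t by simp
    then show ?thesis using 2 by simp
  qed
qed

lemma face_map_eqD:
  assumes q: "q \<in> ball 0 1" "q' \<in> ball 0 1" and h: "face_map G f q = face_map G f' q'"
  shows "f' = f \<and> q' = q"
proof -
  have "\<forall>f f'. f \<noteq> f' \<longrightarrow> open_face G f \<inter> open_face G f' = {}"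
    using disk unfolding disk_cell_decomposition_def by (elim conjE)
  moreover have "face_map G f q \<in> open_face G f" "face_map G f' q' \<in> open_face G f'"
    using q unfolding open_face_def by blast+
  ultimately have "f = f'" using h by (metis IntI empty_iff)
  then show ?thesis using inj_onD[OF face_map_inj, of f q q'] q h by simp
qed

lemma surface_homeo: obtains h k where "homeomorphism (surface G) (ball (0::complex) 1) h k"
  using disk that unfolding disk_cell_decomposition_def homeomorphic_def by (elim conjE exE)

lemma locally_finite_cells:
  assumes "x \<in> surface G"
  obtains U where "open U" "x \<in> U" "finite {v. vpos G v \<in> U}"
    "finite {e. edge_map G e ` {0..1} \<inter> U \<noteq> {}}" "finite {f. face_map G f ` cball 0 1 \<inter> U \<noteq> {}}"
proof -
  have "locally_finite G" using disk unfolding disk_cell_decomposition_def by (elim conjE)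
  then show thesis using assms that unfolding locally_finite_def by blast
qed

lemma edge_map_in_face:
  assumes "t \<in> {0..1}"
  obtains q where "q \<in> cball 0 1" "edge_map G e t = face_map G (lface G e) q"
proof -
  let ?f = "lface G e"
  obtain m where m: "(nxt G ^^ m) (face_start ?f) = e" using nxt_transitive[of "face_start ?f" e] lface_face_start by metis
  obtain j where j: "j < face_len ?f" "(nxt G ^^ j) (face_start ?f) = e"
    using m funpow_mod_eq[OF nxt_face_len_start[of ?f], of m] face_len_pos[of ?f] by (metis mod_less_divisor)
  from face_map_boundary[OF j(1) assms] j(2)
  show thesis by (intro that[of "cis (2 * pi * (real j + t) / real (face_len ?f))"]) auto
qed

lemma surface_cover:
  assumes "p \<in> surface G"
  obtains v where "p = vpos G v" | f q where "q \<in> cball 0 1" "p = face_map G f q"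
proof -
  consider v where "p = vpos G v" | e where "p \<in> open_edge G e" | f where "p \<in> open_face G f"
    using assms surface_cells by blast
  then show thesis
  proof cases
    case 2
    then obtain t where t: "t \<in> {0<..<1}" "p = edge_map G e t" unfolding open_edge_def by blast
    then have "t \<in> {0..1}" by simp
    then obtain q where "q \<in> cball 0 1" "edge_map G e t = face_map G (lface G e) q" by (rule edge_map_in_face)
    then show thesis using t that by metis
  next
    case 3
    then obtain q where "q \<in> ball 0 1" "p = face_map G f q" unfolding open_face_def by blast
    then show thesis using that(2)[of q f] by simp
  qed (use that in blast)
qed

text \<open>Compatibility where the characteristic maps meet makes the prescribed values a single
  function, and continuity is inherited from the closed face disks, which are locally finite. Only
  cells meeting \<open>X\<close> have to be compatible. \<open>W\<close> consists of vertices
  removed from the domain, at which the functions on the edges need not agree.\<close>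

lemma glue:
  fixes a :: "'v \<Rightarrow> 'b::topological_space" and b :: "'e \<Rightarrow> real \<Rightarrow> 'b" and c :: "'f \<Rightarrow> complex \<Rightarrow> 'b"
  assumes X: "X \<subseteq> surface G - vpos G ` W"
    and brv: "\<And>e t. edge_map G e ` {0..1} \<inter> X \<noteq> {} \<Longrightarrow> t \<in> {0<..<1} \<Longrightarrow> b (rv G e) t = b e (1 - t)"
    and bsrc: "\<And>e. edge_map G e ` {0..1} \<inter> X \<noteq> {} \<Longrightarrow> src G e \<notin> W \<Longrightarrow> b e 0 = a (src G e)"
    and cont: "\<And>f. face_map G f ` cball 0 1 \<inter> X \<noteq> {} \<Longrightarrow> continuous_on (cball 0 1) (c f)"
    and bd: "\<And>f k t. face_map G f ` cball 0 1 \<inter> X \<noteq> {} \<Longrightarrow> k < face_len f \<Longrightarrow> t \<in> {0..1} \<Longrightarrow>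
        c f (cis (2 * pi * (real k + t) / real (face_len f))) = b ((nxt G ^^ k) (face_start f)) t"
  shows "\<exists>g. continuous_on X g \<and> (\<forall>v. vpos G v \<in> X \<longrightarrow> g (vpos G v) = a v) \<and>
    (\<forall>e. \<forall>t\<in>{0<..<1}. edge_map G e t \<in> X \<longrightarrow> g (edge_map G e t) = b e t) \<and>
    (\<forall>f. \<forall>q\<in>cball 0 1. face_map G f q \<in> X \<longrightarrow> g (face_map G f q) = c f q)"
proof -
  define val where "val p y \<longleftrightarrow> (\<exists>v. p = vpos G v \<and> y = a v) \<or>
     (\<exists>e. \<exists>t\<in>{0<..<1}. p = edge_map G e t \<and> y = b e t) \<or>
     (\<exists>f. \<exists>q\<in>ball 0 1. p = face_map G f q \<and> y = c f q)" for p y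
  have uniq: "y = y'" if p: "p \<in> X" and v: "val p y" "val p y'" for p y y'
  proof -
    consider (V) v where "p = vpos G v" "y = a v"
      | (E) e t where "t \<in> {0<..<1}" "p = edge_map G e t" "y = b e t"
      | (F) f q where "q \<in> ball 0 1" "p = face_map G f q" "y = c f q"
      using v(1) unfolding val_def by blast
    then show ?thesis
    proof cases
      case V
      then obtain v' where "p = vpos G v'" "y' = a v'"
        using v(2) vpos_ne_edge vpos_ne_face unfolding val_def by metis
      then show ?thesis using V injD[OF vpos_inj] by metis
    next
      case E
      then obtain e' t' where e': "t' \<in> {0<..<1}" "p = edge_map G e' t'" "y' = b e' t'"
        using v(2) vpos_ne_edge edge_ne_face unfolding val_def by metis
      have "t \<in> {0..1}" using E(1) by simp
      then have "edge_map G e ` {0..1} \<inter> X \<noteq> {}" using E(2) p by blast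
      then have "b (rv G e) (1 - t) = b e t" using brv[of e "1 - t"] E(1) by simp
      moreover have "(e' = e \<and> t' = t) \<or> (e' = rv G e \<and> t' = 1 - t)"
        using edge_map_eq_cases[OF E(1) e'(1)] E(2) e'(2) by metis
      ultimately show ?thesis using E(3) e'(3) by metis
    next
      case F
      then obtain f' q' where "q' \<in> ball 0 1" "p = face_map G f' q'" "y' = c f' q'"
        using v(2) vpos_ne_face edge_ne_face unfolding val_def by metis
      then show ?thesis using F face_map_eqD by metis
    qed
  qed
  have valf: "val (face_map G f q) (c f q)" if q: "q \<in> cball 0 1" and p: "face_map G f q \<in> X" for f q
  proof (cases "norm q = 1")
    case False
    then have "q \<in> ball 0 1" using q by simp
    then show ?thesis unfolding val_def by blast
  next
    case True
    have fX: "face_map G f ` cball 0 1 \<inter> X \<noteq> {}" using p q by blast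
    obtain k t where kt: "k < face_len f" "t \<in> {0..<1}" "q = cis (2 * pi * (real k + t) / real (face_len f))"
      and im: "face_map G f q = edge_map G ((nxt G ^^ k) (face_start f)) t"
      using face_map_sphere_cases[OF True, of f] by metis
    have ct: "c f q = b ((nxt G ^^ k) (face_start f)) t" using bd[OF fX kt(1), of t] kt(2,3) by simp
    show ?thesis
    proof (cases "t = 0")
      case False
      then have "t \<in> {0<..<1}" using kt(2) by simp
      then show ?thesis unfolding val_def im ct by blast
    next
      case t0: True
      let ?e = "(nxt G ^^ k) (face_start f)"
      have im': "face_map G f q = vpos G (src G ?e)" using im t0 edge_map_0 by simp
      have "edge_map G ?e 0 \<in> X" using im t0 p by simp
      then have eX: "edge_map G ?e ` {0..1} \<inter> X \<noteq> {}" by force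
      have "src G ?e \<notin> W" using p X im' by auto
      from bsrc[OF eX this] have "c f q = a (src G ?e)" using ct t0 by simp
      then show ?thesis unfolding val_def using im' by blast
    qed
  qed
  have tot: "\<exists>y. val p y" if "p \<in> X" for p
  proof -
    have "p \<in> surface G" using X that by blast
    then consider v where "p = vpos G v" | e where "p \<in> open_edge G e" | f where "p \<in> open_face G f"
      using surface_cells by blast
    then show ?thesis unfolding val_def open_edge_def open_face_def by cases blast+
  qed
  define g where "g p = (THE y. val p y)" for p
  have g: "g p = y" if "p \<in> X" "val p y" for p y
    unfolding g_def using that uniq by (intro the_equality) blast+
  obtain h k where hk: "homeomorphism (surface G) (ball (0::complex) 1) h k" by (rule surface_homeo)
  have hk': "continuous_on (surface G) h" "continuous_on (ball 0 1) k" "h ` surface G = ball 0 1"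
    "k ` ball 0 1 = surface G" "\<And>x. x \<in> surface G \<Longrightarrow> k (h x) = x" "\<And>y. y \<in> ball 0 1 \<Longrightarrow> h (k y) = y"
    using hk unfolding homeomorphism_def by auto
  \<comment> \<open>The ambient type carries no separation axiom. Compact images of the face disks
    are closed in the plane, so continuity is checked there, through the homeomorphism
    \<open>h\<close>.\<close>
  define Y where "Y = h ` X"
  have Yb: "Y \<subseteq> ball 0 1" unfolding Y_def using X hk'(3) by blast
  have kY: "k y \<in> X" if "y \<in> Y" for y
    using that X hk'(5) unfolding Y_def by auto
  \<comment> \<open>The singletons cover the vertices, which at this stage are not known to lie on
    the boundary of a face.\<close>
  define C where "C i = (case i of Inl f \<Rightarrow> (\<lambda>q. h (face_map G f q)) ` cball 0 1 | Inr v \<Rightarrow> {h (vpos G v)})" for i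
  have hF: "continuous_on (cball 0 1) (\<lambda>q. h (face_map G f q))" for f
    by (rule continuous_on_compose2[OF hk'(1) face_map_continuous]) (use face_map_surface in blast)
  have "continuous_on Y (\<lambda>y. g (k y))"
  proof (rule continuous_on_locally_finite_closed_cover[where I=UNIV and C=C])
    fix i :: "'f + 'v"
    show "closed (C i)"
    proof (cases i)
      case (Inl f)
      have "compact ((\<lambda>q. h (face_map G f q)) ` cball 0 1)"
        using hF by (rule compact_continuous_image) simp
      then show ?thesis using Inl by (simp add: C_def compact_imp_closed)
    qed (simp add: C_def)
    show "continuous_on (C i \<inter> Y) (\<lambda>y. g (k y))"
    proof (cases i)
      case (Inl f)
      have "continuous_on ((\<lambda>q. h (face_map G f q)) ` cball 0 1 \<inter> Y) (\<lambda>y. g (k y))"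
      proof (rule continuous_on_image_compact[OF _ hF])
        let ?Q = "{q \<in> cball 0 1. h (face_map G f q) \<in> Y}"
        have in_X: "face_map G f q \<in> X" if "q \<in> ?Q" for q
          using kY[of "h (face_map G f q)"] that hk'(5)[OF face_map_surface, of q f] by auto
        have "continuous_on ?Q (c f)"
        proof (cases "?Q = {}")
          case False
          then have "face_map G f ` cball 0 1 \<inter> X \<noteq> {}" using in_X by blast
          from cont[OF this] show ?thesis by (rule continuous_on_subset) auto
        qed (simp only: continuous_on_empty)
        moreover have "c f q = g (k (h (face_map G f q)))" if "q \<in> ?Q" for q
          using g[OF in_X[OF that] valf] in_X[OF that] that hk'(5)[OF face_map_surface, of q f] by simp
        ultimately show "continuous_on ?Q (\<lambda>q. g (k (h (face_map G f q))))"
          by (rule continuous_on_eq)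
      qed simp
      then show ?thesis using Inl by (simp add: C_def)
    next
      case (Inr v)
      have "C i \<inter> Y = {} \<or> C i \<inter> Y = {h (vpos G v)}" using Inr by (auto simp: C_def)
      then show ?thesis by auto
    qed
  next
    show "Y \<subseteq> (\<Union>i\<in>UNIV. C i)"
    proof
      fix y assume "y \<in> Y"
      then obtain x where x: "x \<in> X" "y = h x" unfolding Y_def by blast
      have "x \<in> surface G" using x X by blast
      then have "\<exists>i. y \<in> C i"
      proof (cases rule: surface_cover)
        case (1 v)
        then show ?thesis using x by (intro exI[of _ "Inr v"]) (simp add: C_def)
      next
        case (2 f q)
        then show ?thesis using x by (intro exI[of _ "Inl f"]) (auto simp: C_def)
      qed
      then show "y \<in> (\<Union>i\<in>UNIV. C i)" by blast
    qed
  next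
    fix y assume y: "y \<in> Y"
    have ky: "k y \<in> surface G" using kY[OF y] X by blast
    then obtain U where U: "open U" "k y \<in> U" "finite {v. vpos G v \<in> U}"
      "finite {f. face_map G f ` cball 0 1 \<inter> U \<noteq> {}}" using locally_finite_cells by metis
    have "open (ball 0 1 \<inter> k -` U)" using hk'(2) U(1) by (rule continuous_open_preimage[OF _ open_ball])
    moreover have "y \<in> ball 0 1 \<inter> k -` U" using y Yb U(2) by auto
    moreover have "{i \<in> UNIV. C i \<inter> (ball 0 1 \<inter> k -` U) \<inter> Y \<noteq> {}} \<subseteq>
        Inl ` {f. face_map G f ` cball 0 1 \<inter> U \<noteq> {}} \<union> Inr ` {v. vpos G v \<in> U}"
    proof
      fix i assume "i \<in> {i \<in> UNIV. C i \<inter> (ball 0 1 \<inter> k -` U) \<inter> Y \<noteq> {}}"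
      then obtain z where z: "z \<in> C i" "k z \<in> U" by auto
      show "i \<in> Inl ` {f. face_map G f ` cball 0 1 \<inter> U \<noteq> {}} \<union> Inr ` {v. vpos G v \<in> U}"
      proof (cases i)
        case (Inl f)
        then obtain q where q: "q \<in> cball 0 1" "z = h (face_map G f q)" using z by (auto simp: C_def)
        then have "face_map G f q \<in> U" using z hk'(5)[OF face_map_surface[OF q(1)]] by simp
        then show ?thesis using Inl q by blast
      next
        case (Inr v)
        then have "vpos G v \<in> U" using z hk'(5)[OF vpos_surface] by (simp add: C_def)
        then show ?thesis using Inr by blast
      qed
    qed
    ultimately show "\<exists>U. open U \<and> y \<in> U \<and> finite {i \<in> UNIV. C i \<inter> U \<inter> Y \<noteq> {}}"
      using U(3,4) by (intro exI[of _ "ball 0 1 \<inter> k -` U"]) (auto intro: finite_subset)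
  qed
  then have "continuous_on X (\<lambda>x. g (k (h x)))"
    by (rule continuous_on_compose2[OF _ continuous_on_subset[OF hk'(1)]]) (use X in \<open>auto simp: Y_def\<close>)
  then have "continuous_on X g"
    by (rule continuous_on_eq) (use X hk'(5) in auto)
  moreover have "\<forall>v. vpos G v \<in> X \<longrightarrow> g (vpos G v) = a v"
    by (intro allI impI g) (auto simp: val_def)
  moreover have "\<forall>e. \<forall>t\<in>{0<..<1}. edge_map G e t \<in> X \<longrightarrow> g (edge_map G e t) = b e t"
    by (intro allI ballI impI g) (unfold val_def, blast+)
  moreover have "\<forall>f. \<forall>q\<in>cball 0 1. face_map G f q \<in> X \<longrightarrow> g (face_map G f q) = c f q"
    by (intro allI ballI impI g valf)
  ultimately show ?thesis by blast
qed

end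

section \<open>Connectivity and vertex rotations\<close>

context disk_complex
begin

text \<open>The indicator of a graph component is constant along edges and along face boundaries. It
  therefore glues to a continuous function with values 0 and 1 on the connected surface.\<close>

lemma graph_connected: "(x, y) \<in> {(src G e, trg G e) | e. True}\<^sup>*"
proof -
  let ?E = "{(src G e, trg G e) | e. True}"
  define ind :: "'v \<Rightarrow> real" where "ind v = (if (x, v) \<in> ?E\<^sup>* then 1 else 0)" for v
  have step: "(x, src G e) \<in> ?E\<^sup>* \<Longrightarrow> (x, trg G e) \<in> ?E\<^sup>*" for e
    by (rule rtrancl_into_rtrancl) auto
  have ind: "ind (trg G e) = ind (src G e)" for e
    using step[of e] step[of "rv G e"] by (auto simp: ind_def)
  have indn: "ind (src G ((nxt G ^^ k) e)) = ind (src G e)" for k e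
    by (induction k) (simp_all add: ind)
  have "\<exists>g. continuous_on (surface G) g \<and> (\<forall>v. vpos G v \<in> surface G \<longrightarrow> g (vpos G v) = ind v) \<and>
    (\<forall>e. \<forall>t\<in>{0<..<1}. edge_map G e t \<in> surface G \<longrightarrow> g (edge_map G e t) = (\<lambda>e t. ind (src G e)) e t) \<and>
    (\<forall>f. \<forall>q\<in>cball 0 1. face_map G f q \<in> surface G \<longrightarrow> g (face_map G f q) = (\<lambda>f q. ind (src G (face_start f))) f q)"
    by (rule glue[where W = "{}"]) (simp_all add: ind indn)
  then obtain g where g: "continuous_on (surface G) g" "\<And>v. g (vpos G v) = ind v"
    "\<And>f q. q \<in> cball 0 1 \<Longrightarrow> g (face_map G f q) = ind (src G (face_start f))"
    using vpos_surface face_map_surface by metis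
  obtain h k where hk: "homeomorphism (surface G) (ball (0::complex) 1) h k" by (rule surface_homeo)
  have "connected (k ` ball 0 1)"
    by (rule connected_continuous_image) (use hk in \<open>auto simp: homeomorphism_def\<close>)
  then have "connected (surface G)" using hk by (simp add: homeomorphism_def)
  then have "connected (g ` surface G)" by (rule connected_continuous_image[OF g(1)])
  moreover have "g ` surface G \<subseteq> {0, 1}"
  proof
    fix z assume "z \<in> g ` surface G"
    then obtain p where p: "p \<in> surface G" "z = g p" by blast
    from p(1) show "z \<in> {0, 1}"
      by (cases rule: surface_cover) (simp_all add: p(2) g(2,3) ind_def)
  qed
  then have "finite (g ` surface G)" by (rule finite_subset) simp
  ultimately obtain c where "g ` surface G \<subseteq> {c}" using connected_finite_iff_sing by (metis empty_subsetI order_refl)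
  then have "g (vpos G x) = g (vpos G y)" using vpos_surface by (metis image_subset_iff singletonD)
  then have "ind y = 1" by (simp add: g ind_def)
  then show ?thesis by (auto simp: ind_def split: if_splits)
qed

text \<open>If the rotation at \<open>i\<close> had several orbits, small punctured disks around
  \<open>i\<close> would be disconnected. Indeed the indicator \<open>\<kappa>\<close> of one orbit
  extends continuously over the surface without \<open>i\<close> and tends to 0 or 1 at each corner
  of a face at \<open>i\<close>. Close to \<open>i\<close> it avoids 1/2, although it lies on
  different sides of 1/2 along edges from different orbits.\<close>

lemma rho_transitive:
  assumes fin: "finite {e. src G e = i}" and e: "src G e = i" and e': "src G e' = i"
  shows "\<exists>m. ((\<lambda>d. rho d) ^^ m) e = e'"
proof (rule ccontr)
  assume nex: "\<nexists>m. ((\<lambda>d. rho d) ^^ m) e = e'"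
  let ?\<rho> = "\<lambda>d. rho d"
  define \<kappa> :: "'e \<Rightarrow> real" where "\<kappa> d = (if \<exists>m. (?\<rho> ^^ m) e = d then 1 else 0)" for d
  have src_pow: "src G ((?\<rho> ^^ m) e) = i" for m by (induction m) (simp_all add: e)
  have \<kappa>0: "\<kappa> d = 0" if "src G d \<noteq> i" for d
    using that src_pow by (auto simp: \<kappa>_def)
  have \<kappa>01: "\<kappa> d = 0 \<or> \<kappa> d = 1" for d by (simp add: \<kappa>_def)
  have "finite {y. \<exists>m. y = (?\<rho> ^^ m) e}"
    by (rule finite_subset[OF _ fin]) (use src_pow in auto)
  then obtain p where p: "p > 0" "(?\<rho> ^^ p) e = e" using funpow_inj_finite[OF inj_rho] by metis
  have \<kappa>\<rho>: "\<kappa> (rho d) = \<kappa> d" for d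
  proof -
    have "\<exists>m. (?\<rho> ^^ m) e = d" if m: "(?\<rho> ^^ m) e = rho d" for m
    proof (cases m)
      case 0
      obtain p' where "p = Suc p'" using p(1) by (cases p) auto
      then have "?\<rho> ((?\<rho> ^^ p') e) = rho d" using p(2) m 0 by simp
      then show ?thesis using injD[OF inj_rho] by blast
    next
      case (Suc m')
      then have "?\<rho> ((?\<rho> ^^ m') e) = rho d" using m by simp
      then show ?thesis using injD[OF inj_rho] by blast
    qed
    moreover have "\<exists>m. (?\<rho> ^^ m) e = rho d" if "(?\<rho> ^^ m) e = d" for m
      using that by (intro exI[of _ "Suc m"]) simp
    ultimately show ?thesis unfolding \<kappa>_def by (metis (no_types))
  qed
  have \<kappa>nxt: "\<kappa> (nxt G d) = \<kappa> (rv G d)" for d using \<kappa>\<rho>[of "rv G d"] by simp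
  \<comment> \<open>Along an edge the function decreases from \<open>\<kappa> d\<close> to 0 at the
    midpoint and then increases to \<open>\<kappa> (rv G d)\<close>.\<close>
  define b where "b d t = \<kappa> d * max 0 (1 - 2 * t) + \<kappa> (rv G d) * max 0 (2 * t - 1)" for d t
  \<comment> \<open>Tents of half-width 1/2 around the corners of the face. The index
    \<open>face_len f\<close> repeats the corner 0, which closes the function up.\<close>
  define l where "l f s = (\<Sum>j\<le>face_len f. \<kappa> ((nxt G ^^ j) (face_start f)) * max 0 (1 - 2 * \<bar>s - real j\<bar>))" for f s
  have l_eq: "l f (real k + t) = b ((nxt G ^^ k) (face_start f)) t" if k: "k < face_len f" and t: "t \<in> {0..1}" for f k t
  proof -
    let ?F = "\<lambda>j. \<kappa> ((nxt G ^^ j) (face_start f)) * max 0 (1 - 2 * \<bar>real k + t - real j\<bar>)"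
    have "l f (real k + t) = (\<Sum>j\<in>{k, Suc k}. ?F j)" unfolding l_def
    proof (rule sum.mono_neutral_right)
      show "\<forall>j\<in>{..face_len f} - {k, Suc k}. ?F j = 0"
      proof
        fix j assume "j \<in> {..face_len f} - {k, Suc k}"
        then have "real j \<le> real k - 1 \<or> real j \<ge> real k + 2" by auto
        then have "1 - 2 * \<bar>real k + t - real j\<bar> \<le> 0" using t by auto
        then show "?F j = 0" by simp
      qed
    qed (use k in auto)
    also have "\<dots> = ?F k + ?F (Suc k)" by simp
    also have "?F (Suc k) = \<kappa> (rv G ((nxt G ^^ k) (face_start f))) * max 0 (2 * t - 1)"
      using t by (simp add: \<kappa>nxt)
    also have "?F k = \<kappa> ((nxt G ^^ k) (face_start f)) * max 0 (1 - 2 * t)" using t by simp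
    finally show ?thesis by (simp add: b_def)
  qed
  have "\<exists>g::complex \<Rightarrow> real. continuous_on (cball 0 1) g \<and>
     (\<forall>s\<in>{0..real (face_len f)}. g (cis (2 * pi * s / real (face_len f))) = l f s)" for f
  proof (rule disk_extension[OF face_len_pos])
    show "continuous_on {0..real (face_len f)} (l f)" unfolding l_def by (intro continuous_intros)
    obtain n where n: "face_len f = Suc n" using face_len_pos[of f] by (cases "face_len f") auto
    have "l f 0 = b (face_start f) 0" using l_eq[of 0 f 0] face_len_pos[of f] by simp
    also have "\<dots> = \<kappa> ((nxt G ^^ Suc n) (face_start f))" using nxt_face_len_start[of f] n by (simp add: b_def)
    also have "\<dots> = b ((nxt G ^^ n) (face_start f)) 1" by (simp add: b_def \<kappa>nxt)
    also have "\<dots> = l f (real (face_len f))" using l_eq[of n f 1] n by (simp add: add.commute)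
    finally show "l f 0 = l f (real (face_len f))" .
  qed
  then obtain c :: "'f \<Rightarrow> complex \<Rightarrow> real" where c: "\<And>f. continuous_on (cball 0 1) (c f)"
    "\<And>f s. s \<in> {0..real (face_len f)} \<Longrightarrow> c f (cis (2 * pi * s / real (face_len f))) = l f s" by metis
  have cb: "c f (cis (2 * pi * (real k + t) / real (face_len f))) = b ((nxt G ^^ k) (face_start f)) t"
    if "k < face_len f" "t \<in> {0..1}" for f k t
  proof -
    have "real k + t \<in> {0..real (face_len f)}" using that by auto
    then show ?thesis using c(2) l_eq[OF that] by simp
  qed
  let ?X = "surface G - {vpos G i}"
  have "\<exists>g. continuous_on ?X g \<and> (\<forall>v. vpos G v \<in> ?X \<longrightarrow> g (vpos G v) = (\<lambda>_. 0) v) \<and>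
    (\<forall>e. \<forall>t\<in>{0<..<1}. edge_map G e t \<in> ?X \<longrightarrow> g (edge_map G e t) = b e t) \<and>
    (\<forall>f. \<forall>q\<in>cball 0 1. face_map G f q \<in> ?X \<longrightarrow> g (face_map G f q) = c f q)"
  proof (rule glue[where W = "{i}"])
    fix d :: 'e and t :: real
    show "b (rv G d) t = b d (1 - t)" by (simp add: b_def algebra_simps)
  next
    fix d assume "src G d \<notin> {i}"
    then show "b d 0 = 0" using \<kappa>0 by (simp add: b_def)
  qed (use c(1) cb in auto)
  then obtain g where g: "continuous_on ?X g" "\<And>v. vpos G v \<in> ?X \<Longrightarrow> g (vpos G v) = 0"
    "\<And>e t. t\<in>{0<..<1} \<Longrightarrow> edge_map G e t \<in> ?X \<Longrightarrow> g (edge_map G e t) = b e t"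
    "\<And>f q. q\<in>cball 0 1 \<Longrightarrow> face_map G f q \<in> ?X \<Longrightarrow> g (face_map G f q) = c f q"
    by blast
  have corner: "c f q = 0 \<or> c f q = 1" if q: "q \<in> cball 0 1" "face_map G f q = vpos G i" for f q
  proof -
    have "q \<notin> ball 0 1" using vpos_ne_face q(2) by metis
    then have "norm q = 1" using q(1) by simp
    then obtain k t where kt: "k < face_len f" "t \<in> {0..<1}" "q = cis (2 * pi * (real k + t) / real (face_len f))"
      "face_map G f q = edge_map G ((nxt G ^^ k) (face_start f)) t"
      using face_map_sphere_cases by metis
    have "t \<notin> {0<..<1}" using kt(4) q(2) vpos_ne_edge by metis
    then have "t = 0" using kt(2) by simp
    then have "c f q = b ((nxt G ^^ k) (face_start f)) 0" using cb[OF kt(1), of 0] kt(3) by simp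
    then show ?thesis using \<kappa>01 by (simp add: b_def)
  qed
  obtain h k where hk: "homeomorphism (surface G) (ball (0::complex) 1) h k" by (rule surface_homeo)
  have hk': "continuous_on (surface G) h" "continuous_on (ball 0 1) k" "h ` surface G = ball 0 1"
    "k ` ball 0 1 = surface G" "\<And>x. x \<in> surface G \<Longrightarrow> k (h x) = x" "\<And>y. y \<in> ball 0 1 \<Longrightarrow> h (k y) = y"
    using hk unfolding homeomorphism_def by auto
  define y0 where "y0 = h (vpos G i)"
  have y0: "y0 \<in> ball 0 1" "k y0 = vpos G i" using hk' vpos_surface unfolding y0_def by auto
  obtain U where U: "open U" "vpos G i \<in> U" "finite {f. face_map G f ` cball 0 1 \<inter> U \<noteq> {}}"
    using locally_finite_cells[OF vpos_surface] by metis
  let ?FF = "{f. face_map G f ` cball 0 1 \<inter> U \<noteq> {}}"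
  \<comment> \<open>The points of a face with intermediate values form a compact set missing
    \<open>i\<close>. Only finitely many faces come close to \<open>i\<close>, so a whole disk
    around it avoids these sets.\<close>
  define K where "K f = (\<lambda>q. h (face_map G f q)) ` {q \<in> cball 0 1. c f q \<in> {1/4..3/4}}" for f
  have "closed (K f)" for f
  proof -
    have "compact {q \<in> cball 0 1. c f q \<in> {1/4..3/4}}"
    proof -
      have "closed (cball 0 1 \<inter> c f -` {1/4..3/4})"
        by (rule continuous_closed_preimage[OF c(1) closed_cball closed_atLeastAtMost])
      then have "compact (cball 0 1 \<inter> (cball 0 1 \<inter> c f -` {1/4..3/4}))" by (intro compact_Int_closed) auto
      moreover have "{q \<in> cball 0 1. c f q \<in> {1/4..3/4}} = cball 0 1 \<inter> (cball 0 1 \<inter> c f -` {1/4..3/4})" by auto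
      ultimately show ?thesis by simp
    qed
    moreover have "continuous_on {q \<in> cball 0 1. c f q \<in> {1/4..3/4}} (\<lambda>q. h (face_map G f q))"
      by (rule continuous_on_compose2[OF hk'(1) continuous_on_subset[OF face_map_continuous]])
        (use face_map_surface in auto)
    ultimately show ?thesis unfolding K_def by (intro compact_imp_closed compact_continuous_image)
  qed
  then have "closed (\<Union>f\<in>?FF. K f)" using U(3) by (intro closed_UN) auto
  moreover have "open (ball 0 1 \<inter> k -` U)" using hk'(2) U(1) by (rule continuous_open_preimage[OF _ open_ball])
  ultimately have "open (ball 0 1 \<inter> k -` U - (\<Union>f\<in>?FF. K f))" by (intro open_Diff)
  moreover have "y0 \<notin> K f" for f
  proof
    assume "y0 \<in> K f"
    then obtain q where q: "q \<in> cball 0 1" "c f q \<in> {1/4..3/4}" "y0 = h (face_map G f q)"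
      unfolding K_def by blast
    then have "face_map G f q = vpos G i" using hk'(5)[OF face_map_surface[OF q(1)]] y0(2) by simp
    from corner[OF q(1) this] show False using q(2) by auto
  qed
  then have "y0 \<in> ball 0 1 \<inter> k -` U - (\<Union>f\<in>?FF. K f)" using y0 U(2) by simp
  ultimately obtain r where r: "r > 0" "ball y0 r \<subseteq> ball 0 1 \<inter> k -` U - (\<Union>f\<in>?FF. K f)"
    using open_contains_ball by metis
  let ?B = "ball y0 r - {y0}"
  have "aff_dim (ball y0 r) = 2" using aff_dim_open[of "ball y0 r"] r(1) by simp
  then have "connected ?B" by (intro connected_punctured_convex) auto
  moreover have kB: "k z \<in> ?X" if "z \<in> ?B" for z
  proof -
    have z: "z \<in> ball 0 1" using that r(2) by blast
    then have "k z \<in> surface G" using hk'(4) by blast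
    moreover have "k z \<noteq> vpos G i" using hk'(6)[OF z] that y0_def by auto
    ultimately show ?thesis by blast
  qed
  have "continuous_on ?B (\<lambda>z. g (k z))"
    by (rule continuous_on_compose2[OF g(1) continuous_on_subset[OF hk'(2)]]) (use kB r(2) in auto)
  ultimately have con: "connected ((\<lambda>z. g (k z)) ` ?B)" by (intro connected_continuous_image)
  have avoid: "g (k z) \<noteq> 1/2" if z: "z \<in> ?B" for z
  proof -
    have kz: "k z \<in> ?X" by (rule kB[OF z])
    then have "k z \<in> surface G" by blast
    then show ?thesis
    proof (cases rule: surface_cover)
      case (1 v)
      then show ?thesis using g(2)[of v] kz by simp
    next
      case (2 f q)
      have "z \<in> ball 0 1 \<inter> k -` U - (\<Union>f\<in>?FF. K f)" using z r(2) by blast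
      then have zz: "z \<in> ball 0 1" "k z \<in> U" "z \<notin> (\<Union>f\<in>?FF. K f)" by blast+
      have "face_map G f q \<in> face_map G f ` cball 0 1 \<inter> U" using 2 zz(2) by simp
      then have "f \<in> ?FF" by blast
      then have "z \<notin> K f" using zz(3) by blast
      moreover have "h (face_map G f q) = z" using 2 hk'(6)[OF zz(1)] by simp
      ultimately have "c f q \<notin> {1/4..3/4}" using 2(1) unfolding K_def by blast
      then show ?thesis using g(4)[OF 2(1)] 2(2) kz by auto
    qed
  qed
  have near: "\<exists>z\<in>?B. \<exists>t\<in>{0<..<1/4}. k z = edge_map G d t" if d: "src G d = i" for d
  proof -
    have "continuous_on {0..1} (\<lambda>t. h (edge_map G d t))"
      by (rule continuous_on_compose2[OF hk'(1) edge_map_continuous]) (use edge_map_surface in auto)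
    then obtain \<delta> where \<delta>: "\<delta> > 0" "\<And>t. t \<in> {0..1} \<Longrightarrow> dist t 0 < \<delta> \<Longrightarrow>
        dist (h (edge_map G d t)) (h (edge_map G d 0)) < r"
      using r(1) unfolding continuous_on_iff by (metis atLeastAtMost_iff order_refl zero_le_one)
    define t where "t = min (\<delta>/2) (1/8)"
    have t: "t \<in> {0<..<1/4}" "t \<in> {0<..<1}" "t \<in> {0..1}" "dist t 0 < \<delta>" using \<delta>(1) by (auto simp: t_def)
    have "h (edge_map G d 0) = y0" using edge_map_0 d by (simp add: y0_def)
    then have "h (edge_map G d t) \<in> ball y0 r" using \<delta>(2)[OF t(3,4)] by (simp add: dist_commute)
    moreover have "k (h (edge_map G d t)) = edge_map G d t" using hk'(5)[OF edge_map_surface[OF t(3)]] .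
    moreover have "edge_map G d t \<noteq> vpos G i" using vpos_ne_edge[OF t(2)] by metis
    ultimately show ?thesis using t(1) y0(2) by (intro bexI[of _ "h (edge_map G d t)"] bexI[of _ t]) auto
  qed
  obtain z1 t1 where z1: "z1 \<in> ?B" "t1 \<in> {0<..<1/4}" "k z1 = edge_map G e t1" using near[OF e] by blast
  obtain z2 t2 where z2: "z2 \<in> ?B" "t2 \<in> {0<..<1/4}" "k z2 = edge_map G e' t2" using near[OF e'] by blast
  have "\<kappa> e = 1" unfolding \<kappa>_def by (auto intro: exI[of _ 0])
  moreover have "g (k z1) = b e t1" using g(3)[of t1 e] z1 kB[OF z1(1)] by simp
  ultimately have v1: "g (k z1) \<ge> 1/2" using z1(2) by (simp add: b_def)
  have "\<kappa> e' = 0" unfolding \<kappa>_def using nex by simp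
  moreover have "g (k z2) = b e' t2" using g(3)[of t2 e'] z2 kB[OF z2(1)] by simp
  ultimately have v2: "g (k z2) \<le> 1/2" using z2(2) by (simp add: b_def)
  have "{g (k z2)..g (k z1)} \<subseteq> (\<lambda>z. g (k z)) ` ?B"
    by (rule connected_contains_Icc[OF con]) (use z1(1) z2(1) in auto)
  then have "1/2 \<in> (\<lambda>z. g (k z)) ` ?B" using v1 v2 by auto
  then show False using avoid by force
qed

end

section \<open>Closed cochains are exact\<close>

context disk_complex
begin

primrec walk :: "'v \<Rightarrow> 'e list \<Rightarrow> 'v \<Rightarrow> bool" where
  "walk x [] y \<longleftrightarrow> x = y"
| "walk x (e # es) y \<longleftrightarrow> src G e = x \<and> walk (trg G e) es y"

lemma walk_append: "walk x (es @ es') z \<longleftrightarrow> (\<exists>y. walk x es y \<and> walk y es' z)"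
  by (induction es arbitrary: x) auto

lemma walk_rev: "walk x es y \<Longrightarrow> walk y (map (rv G) (rev es)) x"
  by (induction es arbitrary: x) (auto simp: walk_append)

lemma walk_exists: "\<exists>es. walk x es y"
  using graph_connected[of x y]
proof (induction rule: rtrancl_induct)
  case base
  show ?case by (rule exI[of _ "[]"]) simp
next
  case (step y z)
  then obtain es e where "walk x es y" "y = src G e" "z = trg G e" by blast
  then have "walk x (es @ [e]) z" by (simp add: walk_append)
  then show ?case by blast
qed

lemma walk_sum_gradient:
  fixes v :: "'v \<Rightarrow> real"
  assumes "walk x es y" "\<And>e. e \<in> set es \<Longrightarrow> w e = v (trg G e) - v (src G e)"
  shows "sum_list (map w es) = v y - v x"
  using assms by (induction es arbitrary: x) auto

lemma finite_cells_compact: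
  assumes X: "compact X" "X \<subseteq> surface G"
  shows "finite {e. edge_map G e ` {0..1} \<inter> X \<noteq> {}}" "finite {f. face_map G f ` cball 0 1 \<inter> X \<noteq> {}}"
proof -
  have "\<forall>x\<in>X. \<exists>U. open U \<and> x \<in> U \<and> finite {e. edge_map G e ` {0..1} \<inter> U \<noteq> {}} \<and>
    finite {f. face_map G f ` cball 0 1 \<inter> U \<noteq> {}}"
  proof
    fix x assume "x \<in> X"
    then have "x \<in> surface G" using X(2) by blast
    then obtain U where "open U" "x \<in> U" "finite {e. edge_map G e ` {0..1} \<inter> U \<noteq> {}}"
      "finite {f. face_map G f ` cball 0 1 \<inter> U \<noteq> {}}" by (rule locally_finite_cells)
    then show "\<exists>U. open U \<and> x \<in> U \<and> finite {e. edge_map G e ` {0..1} \<inter> U \<noteq> {}} \<and>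
      finite {f. face_map G f ` cball 0 1 \<inter> U \<noteq> {}}" by blast
  qed
  from bchoice[OF this] obtain U where U: "\<And>x. x \<in> X \<Longrightarrow> open (U x)" "\<And>x. x \<in> X \<Longrightarrow> x \<in> U x"
    "\<And>x. x \<in> X \<Longrightarrow> finite {e. edge_map G e ` {0..1} \<inter> U x \<noteq> {}}"
    "\<And>x. x \<in> X \<Longrightarrow> finite {f. face_map G f ` cball 0 1 \<inter> U x \<noteq> {}}" by blast
  have "X \<subseteq> (\<Union>x\<in>X. U x)" using U(2) by blast
  from compactE_image[OF X(1) U(1) this] obtain C where C: "C \<subseteq> X" "finite C" "X \<subseteq> (\<Union>x\<in>C. U x)" by metis
  have "{e. edge_map G e ` {0..1} \<inter> X \<noteq> {}} \<subseteq> (\<Union>x\<in>C. {e. edge_map G e ` {0..1} \<inter> U x \<noteq> {}})"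
    using C(3) by blast
  then show "finite {e. edge_map G e ` {0..1} \<inter> X \<noteq> {}}"
    by (rule finite_subset) (use C U(3) in blast)
  have "{f. face_map G f ` cball 0 1 \<inter> X \<noteq> {}} \<subseteq> (\<Union>x\<in>C. {f. face_map G f ` cball 0 1 \<inter> U x \<noteq> {}})"
    using C(3) by blast
  then show "finite {f. face_map G f ` cball 0 1 \<inter> X \<noteq> {}}"
    by (rule finite_subset) (use C U(4) in blast)
qed

text \<open>An integral cocycle defines a map to the circle, sending the vertices to \<open>1\<close>; a logarithm
  of this map over a disk is a primitive of the cocycle.\<close>

lemma integral_cocycle_exact:
  fixes n :: "'e \<Rightarrow> int" and r :: real
  assumes hk: "homeomorphism (surface G) (ball (0::complex) 1) h k" and r: "r < 1"
    and X: "X = k ` cball 0 r"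
    and anti: "\<And>e. edge_map G e ` {0..1} \<inter> X \<noteq> {} \<Longrightarrow> n (rv G e) = - n e"
    and face0: "\<And>f. face_map G f ` cball 0 1 \<inter> X \<noteq> {} \<Longrightarrow> (\<Sum>e | lface G e = f. n e) = 0"
  shows "\<exists>v::'v \<Rightarrow> real. \<forall>e. edge_map G e ` {0..1} \<subseteq> X \<longrightarrow> real_of_int (n e) = v (trg G e) - v (src G e)"
proof -
  have hk': "continuous_on (surface G) h" "continuous_on (ball 0 1) k" "h ` surface G = ball 0 1"
    "k ` ball 0 1 = surface G" "\<And>x. x \<in> surface G \<Longrightarrow> k (h x) = x" "\<And>y. y \<in> ball 0 1 \<Longrightarrow> h (k y) = y"
    using hk unfolding homeomorphism_def by auto
  have rb: "cball (0::complex) r \<subseteq> ball 0 1" using r by auto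
  have Xs: "X \<subseteq> surface G" using X rb hk'(4) by blast
  have hX: "h x \<in> cball 0 r" if "x \<in> X" for x
    using that X rb hk'(6) by auto
  define b where "b e t = cis (2 * pi * real_of_int (n e) * t)" for e t
  have cis_int: "cis (2 * pi * real_of_int m + x) = cis x" for m x
  proof -
    have "cis (2 * pi * real_of_int m) = 1" by (rule cis_multiple_2pi) simp
    then show ?thesis by (simp add: cis_mult[symmetric])
  qed
  \<comment> \<open>A lift of the circle-valued map along the face boundary: the partial sums of
    \<open>n\<close> at the corners, interpolated linearly. It closes up because the sum over the
    face vanishes, and so the circle-valued map extends over the face.\<close>
  define l where "l f s = (\<Sum>j<face_len f. real_of_int (n ((nxt G ^^ j) (face_start f))) * max 0 (min 1 (s - real j)))" for f s
  have l_eq: "l f (real k + t) = real_of_int (\<Sum>j<k. n ((nxt G ^^ j) (face_start f))) + real_of_int (n ((nxt G ^^ k) (face_start f))) * t"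
    if k: "k < face_len f" and t: "t \<in> {0..1}" for f k t
  proof -
    let ?F = "\<lambda>j. real_of_int (n ((nxt G ^^ j) (face_start f))) * max 0 (min 1 (real k + t - real j))"
    have "l f (real k + t) = (\<Sum>j<Suc k. ?F j)" unfolding l_def
    proof (rule sum.mono_neutral_right)
      show "\<forall>j\<in>{..<face_len f} - {..<Suc k}. ?F j = 0"
      proof
        fix j assume "j \<in> {..<face_len f} - {..<Suc k}"
        then have "real j \<ge> real k + 1" by auto
        then have "min 1 (real k + t - real j) \<le> 0" using t by auto
        then show "?F j = 0" by simp
      qed
    qed (use k in auto)
    also have "\<dots> = (\<Sum>j<k. ?F j) + ?F k" by simp
    also have "(\<Sum>j<k. ?F j) = (\<Sum>j<k. real_of_int (n ((nxt G ^^ j) (face_start f))))"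
    proof (rule sum.cong[OF refl])
      fix j assume "j \<in> {..<k}"
      then have "real j + 1 \<le> real k" by auto
      then have "min 1 (real k + t - real j) = 1" using t by auto
      then show "?F j = real_of_int (n ((nxt G ^^ j) (face_start f)))" by simp
    qed
    also have "?F k = real_of_int (n ((nxt G ^^ k) (face_start f))) * t" using t by simp
    finally show ?thesis by simp
  qed
  have "\<exists>g::complex \<Rightarrow> real. continuous_on (cball 0 1) g \<and>
     (face_map G f ` cball 0 1 \<inter> X \<noteq> {} \<longrightarrow> (\<forall>s\<in>{0..real (face_len f)}. g (cis (2 * pi * s / real (face_len f))) = l f s))" for f
  proof (cases "face_map G f ` cball 0 1 \<inter> X \<noteq> {}")
    case True
    have "\<exists>g::complex \<Rightarrow> real. continuous_on (cball 0 1) g \<and>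
       (\<forall>s\<in>{0..real (face_len f)}. g (cis (2 * pi * s / real (face_len f))) = l f s)"
    proof (rule disk_extension[OF face_len_pos])
      show "continuous_on {0..real (face_len f)} (l f)" unfolding l_def by (intro continuous_intros)
      have "l f 0 = 0" using l_eq[of 0 f 0] face_len_pos[of f] by simp
      moreover obtain m where m: "face_len f = Suc m" using face_len_pos[of f] by (cases "face_len f") auto
      have "l f (real (face_len f)) = real_of_int (\<Sum>j<face_len f. n ((nxt G ^^ j) (face_start f)))"
        using l_eq[of m f 1] m by (simp add: add.commute)
      moreover have "(\<Sum>j<face_len f. n ((nxt G ^^ j) (face_start f))) = 0" using face0[OF True] unfolding sum_face .
      ultimately show "l f 0 = l f (real (face_len f))" by simp
    qed
    then show ?thesis by blast
  qed (intro exI[of _ "\<lambda>_. 0"], simp)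
  then obtain c0 :: "'f \<Rightarrow> complex \<Rightarrow> real" where c0: "\<And>f. continuous_on (cball 0 1) (c0 f)"
    "\<And>f s. face_map G f ` cball 0 1 \<inter> X \<noteq> {} \<Longrightarrow> s \<in> {0..real (face_len f)} \<Longrightarrow> c0 f (cis (2 * pi * s / real (face_len f))) = l f s"
    by metis
  have "\<exists>g. continuous_on X g \<and> (\<forall>v. vpos G v \<in> X \<longrightarrow> g (vpos G v) = (\<lambda>_. 1) v) \<and>
    (\<forall>e. \<forall>t\<in>{0<..<1}. edge_map G e t \<in> X \<longrightarrow> g (edge_map G e t) = b e t) \<and>
    (\<forall>f. \<forall>q\<in>cball 0 1. face_map G f q \<in> X \<longrightarrow> g (face_map G f q) = (\<lambda>f q. cis (2 * pi * c0 f q)) f q)"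
  proof (rule glue[where W = "{}"])
    fix e t assume "edge_map G e ` {0..1} \<inter> X \<noteq> {}"
    then have "b (rv G e) t = cis (- (2 * pi * real_of_int (n e) * t))" using anti by (simp add: b_def)
    also have "\<dots> = cis (2 * pi * real_of_int (n e) + (- (2 * pi * real_of_int (n e) * t)))" by (simp only: cis_int)
    also have "2 * pi * real_of_int (n e) + (- (2 * pi * real_of_int (n e) * t)) = 2 * pi * real_of_int (n e) * (1 - t)"
      by (simp add: algebra_simps)
    finally show "b (rv G e) t = b e (1 - t)" by (simp only: b_def)
  next
    fix f show "continuous_on (cball 0 1) (\<lambda>q. cis (2 * pi * c0 f q))" by (intro continuous_intros c0)
  next
    fix f k t assume f: "face_map G f ` cball 0 1 \<inter> X \<noteq> {}" and k: "k < face_len f" and t: "t \<in> {0..1::real}"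
    have "real k + t \<in> {0..real (face_len f)}" using k t by auto
    then have "c0 f (cis (2 * pi * (real k + t) / real (face_len f))) =
       real_of_int (\<Sum>j<k. n ((nxt G ^^ j) (face_start f))) + real_of_int (n ((nxt G ^^ k) (face_start f))) * t"
      using c0(2)[OF f] l_eq[OF k t] by simp
    then have "cis (2 * pi * c0 f (cis (2 * pi * (real k + t) / real (face_len f)))) =
      cis (2 * pi * real_of_int (\<Sum>j<k. n ((nxt G ^^ j) (face_start f))) + 2 * pi * real_of_int (n ((nxt G ^^ k) (face_start f))) * t)"
      by (simp add: distrib_left mult.assoc)
    then show "cis (2 * pi * c0 f (cis (2 * pi * (real k + t) / real (face_len f)))) = b ((nxt G ^^ k) (face_start f)) t"
      by (simp only: cis_int b_def)
  qed (use Xs in \<open>auto simp: b_def\<close>)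
  then obtain g where g: "continuous_on X g" "\<And>v. vpos G v \<in> X \<Longrightarrow> g (vpos G v) = 1"
    "\<And>e t. t\<in>{0<..<1} \<Longrightarrow> edge_map G e t \<in> X \<Longrightarrow> g (edge_map G e t) = b e t"
    "\<And>f q. q\<in>cball 0 1 \<Longrightarrow> face_map G f q \<in> X \<Longrightarrow> g (face_map G f q) = cis (2 * pi * c0 f q)"
    by blast
  have gk: "continuous_on (cball 0 r) (\<lambda>z. g (k z))"
    by (rule continuous_on_compose2[OF g(1) continuous_on_subset[OF hk'(2) rb]]) (use X in blast)
  have gnz: "g (k z) \<noteq> 0" if "z \<in> cball 0 r" for z
  proof -
    have kz: "k z \<in> X" using that X by blast
    then have "k z \<in> surface G" using Xs by blast
    then show ?thesis by (cases rule: surface_cover) (use g(2,4) kz in auto)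
  qed
  obtain L where L: "continuous_on (cball 0 r) L" "\<And>z. z \<in> cball 0 r \<Longrightarrow> g (k z) = exp (L z)"
    using continuous_logarithm_on_cball[OF gk gnz] by blast
  have "real_of_int (n e) = Im (L (h (vpos G (trg G e)))) / (2 * pi) - Im (L (h (vpos G (src G e)))) / (2 * pi)"
    if e: "edge_map G e ` {0..1} \<subseteq> X" for e
  proof -
    \<comment> \<open>The difference of two logarithms of the circle-valued map along the edge. Its
      values are integral multiples of \<open>2 * pi * \<i>\<close>, hence it is constant, and
      comparing the end points gives \<open>n e\<close>.\<close>
    define m where "m t = L (h (edge_map G e t)) - \<i> * of_real (2 * pi * real_of_int (n e) * t)" for t
    have in_X: "edge_map G e t \<in> X" if "t \<in> {0..1}" for t using e that by blast
    have "continuous_on {0..1} (\<lambda>t. h (edge_map G e t))"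
      by (rule continuous_on_compose2[OF hk'(1) edge_map_continuous]) (use edge_map_surface in auto)
    then have "continuous_on {0..1} (\<lambda>t. L (h (edge_map G e t)))"
      by (rule continuous_on_compose2[OF L(1)]) (use hX in_X in blast)
    then have mc: "continuous_on {0..1} m" unfolding m_def by (intro continuous_intros)
    have ge: "g (edge_map G e t) = b e t" if t: "t \<in> {0..1}" for t
    proof -
      consider "t = 0" | "t = 1" | "t \<in> {0<..<1}" using t by fastforce
      then show ?thesis
      proof cases
        case 1
        then show ?thesis using g(2)[of "src G e"] in_X[of 0] edge_map_0[of e] by (simp add: b_def)
      next
        case 2
        then show ?thesis using g(2)[of "trg G e"] in_X[of 1] edge_map_1[of e] cis_int[of "n e" 0] by (simp add: b_def)
      next
        case 3
        then show ?thesis using g(3)[OF 3 in_X[OF t]] by simp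
      qed
    qed
    have em: "exp (m t) = 1" if t: "t \<in> {0..1}" for t
    proof -
      have "exp (L (h (edge_map G e t))) = g (k (h (edge_map G e t)))" using L(2)[OF hX[OF in_X[OF t]]] by simp
      also have "\<dots> = b e t" using hk'(5)[OF edge_map_surface[OF t]] ge[OF t] by simp
      finally show ?thesis by (simp add: m_def exp_diff b_def cis_conv_exp)
    qed
    have "m constant_on {0..1}"
    proof (rule continuous_discrete_range_constant[OF connected_Icc mc])
      fix t :: real assume t: "t \<in> {0..1}"
      show "\<exists>e>0. \<forall>y. y \<in> {0..1} \<and> m y \<noteq> m t \<longrightarrow> e \<le> norm (m y - m t)"
      proof (intro exI[of _ "1::real"] conjI allI impI)
        fix y assume y: "y \<in> {0..1} \<and> m y \<noteq> m t"
        have "exp (m y - m t) = 1" using em t y by (simp add: exp_diff)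
        then obtain j :: int where j: "Re (m y - m t) = 0" "Im (m y - m t) = of_int (2 * j) * pi"
          using exp_eq_1 by metis
        have "j \<noteq> 0"
        proof
          assume "j = 0"
          then have "m y - m t = 0" using j by (intro complex_eqI) auto
          then show False using y by simp
        qed
        then have "\<bar>real_of_int j\<bar> \<ge> 1" by linarith
        have "1 \<le> 2 * pi * 1" using pi_ge_two by simp
        also have "\<dots> \<le> 2 * pi * \<bar>real_of_int j\<bar>" using \<open>\<bar>real_of_int j\<bar> \<ge> 1\<close> by (intro mult_left_mono) auto
        also have "\<dots> = \<bar>Im (m y - m t)\<bar>" by (simp only: j(2)) (simp add: abs_mult)
        also have "\<dots> \<le> norm (m y - m t)" by (rule abs_Im_le_cmod)
        finally show "1 \<le> norm (m y - m t)" .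
      qed simp
    qed
    then have "m 1 = m 0" unfolding constant_on_def by (metis atLeastAtMost_iff order_refl zero_le_one)
    then have "Im (m 1) = Im (m 0)" by simp
    then have "Im (L (h (vpos G (trg G e)))) - Im (L (h (vpos G (src G e)))) = 2 * pi * real_of_int (n e)"
      by (simp add: m_def edge_map_0 edge_map_1)
    then show ?thesis by (simp add: diff_divide_distrib[symmetric])
  qed
  then show ?thesis by (intro exI[of _ "\<lambda>x. Im (L (h (vpos G x))) / (2 * pi)"]) blast
qed

text \<open>Only the finitely many edges and faces meeting a compact disk around the walk matter, and on these
  a multiple of the real cocycle is within \<open>1/N\<close> of an integral cochain, which is a cocycle
  for large \<open>N\<close> since the face degrees are finite.\<close>

lemma closed_walk_sum:
  fixes w :: "'e \<Rightarrow> real"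
  assumes anti: "\<And>e. w (rv G e) = - w e" and face0: "\<And>f. (\<Sum>e | lface G e = f. w e) = 0"
    and walk: "walk x es x"
  shows "sum_list (map w es) = 0"
proof (rule ccontr)
  let ?S = "sum_list (map w es)"
  assume S: "?S \<noteq> 0"
  obtain h k where hk: "homeomorphism (surface G) (ball (0::complex) 1) h k" by (rule surface_homeo)
  have hk': "continuous_on (surface G) h" "continuous_on (ball 0 1) k" "h ` surface G = ball 0 1"
    "k ` ball 0 1 = surface G" "\<And>x. x \<in> surface G \<Longrightarrow> k (h x) = x"
    using hk unfolding homeomorphism_def by auto
  define C where "C = insert 0 (\<Union>e\<in>set es. (\<lambda>t. h (edge_map G e t)) ` {0..1})"
  have "compact C" unfolding C_def
  proof (intro compact_insert compact_UN ballI)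
    fix e
    have "continuous_on {0..1} (\<lambda>t. h (edge_map G e t))"
      by (rule continuous_on_compose2[OF hk'(1) edge_map_continuous]) (use edge_map_surface in auto)
    then show "compact ((\<lambda>t. h (edge_map G e t)) ` {0..1})" by (rule compact_continuous_image) simp
  qed simp
  moreover have Cb: "C \<subseteq> ball 0 1" unfolding C_def using hk'(3) edge_map_surface by auto
  moreover have "C \<noteq> {}" by (auto simp: C_def)
  ultimately obtain z0 where z0: "z0 \<in> C" "\<And>z. z \<in> C \<Longrightarrow> norm z \<le> norm z0"
    using continuous_attains_sup[of C norm] by (auto intro: continuous_intros)
  define r where "r = norm z0"
  have r: "r < 1" using z0(1) Cb by (auto simp: r_def)
  have Cr: "C \<subseteq> cball 0 r" using z0(2) by (auto simp: r_def)
  define X where "X = k ` cball 0 r"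
  have rb: "cball (0::complex) r \<subseteq> ball 0 1" using r by auto
  have Xs: "X \<subseteq> surface G" unfolding X_def using rb hk'(4) by blast
  have "compact X" unfolding X_def
    by (rule compact_continuous_image[OF continuous_on_subset[OF hk'(2) rb]]) simp
  note fin = finite_cells_compact[OF this Xs]
  have esX: "edge_map G e ` {0..1} \<subseteq> X" if e: "e \<in> set es" for e
  proof
    fix p assume "p \<in> edge_map G e ` {0..1}"
    then obtain t where t: "t \<in> {0..1}" "p = edge_map G e t" by blast
    then have "h p \<in> C" unfolding C_def using e by blast
    then have "k (h p) \<in> X" unfolding X_def using Cr by blast
    then show "p \<in> X" using hk'(5) edge_map_surface[OF t(1)] t(2) by simp
  qed
  define FF where "FF = {f. face_map G f ` cball 0 1 \<inter> X \<noteq> {}}"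
  \<comment> \<open>Edges of a face meeting \<open>X\<close> are included even if they miss
    \<open>X\<close> themselves, because the sum over the whole face has to be approximated.\<close>
  define EE where "EE = {e. edge_map G e ` {0..1} \<inter> X \<noteq> {}} \<union> (\<Union>f\<in>FF. {e. lface G e = f}) \<union> set es"
  define E where "E = EE \<union> rv G ` EE"
  have finE: "finite E" unfolding E_def EE_def FF_def using fin finite_lface by auto
  define m where "m = card E"
  obtain \<beta> where \<beta>: "bij_betw \<beta> {0..<m} E" using ex_bij_betw_nat_finite[OF finE] by (auto simp: m_def)
  obtain N0 :: nat where N0: "real (length es) / \<bar>?S\<bar> < real N0" using reals_Archimedean2 by blast
  \<comment> \<open>\<open>N0\<close> makes the total error along the walk smaller than
    \<open>\<bar>?S\<bar>\<close>, \<open>m\<close> bounds the number of edges of each face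
    concerned, and 3 keeps the sum of the errors on an edge and its reversal below 1.\<close>
  define N where "N = N0 + m + 3"
  have N: "N > 0" by (simp add: N_def)
  obtain q p where q: "0 < q" and qp: "\<And>i. i < m \<Longrightarrow> \<bar>of_int q * w (\<beta> i) - of_int (p i)\<bar> < 1 / real N"
    using Dirichlet_approx_simult[OF N, of m "\<lambda>i. w (\<beta> i)"] by metis
  define n where "n e = p (the_inv_into {0..<m} \<beta> e)" for e
  have n: "\<bar>of_int q * w e - of_int (n e)\<bar> < 1 / real N" if e: "e \<in> E" for e
  proof -
    have "the_inv_into {0..<m} \<beta> e < m"
      using the_inv_into_into[of \<beta> "{0..<m}" e "{0..<m}"] \<beta> e by (auto simp: bij_betw_def)
    moreover have "\<beta> (the_inv_into {0..<m} \<beta> e) = e" using \<beta> e by (rule f_the_inv_into_f_bij_betw)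
    ultimately show ?thesis using qp[of "the_inv_into {0..<m} \<beta> e"] by (simp add: n_def)
  qed
  have rvE: "rv G e \<in> E" if "e \<in> E" for e using that by (auto simp: E_def)
  have approx0: "a = 0" if "\<bar>real_of_int a\<bar> < 1" for a :: int using that by linarith
  have sum_bound: "\<bar>of_int q * (\<Sum>e\<in>A. w e) - of_int (\<Sum>e\<in>A. n e)\<bar> \<le> real (card A) / real N"
    if "A \<subseteq> E" for A
  proof -
    have "\<bar>\<Sum>e\<in>A. of_int q * w e - of_int (n e)\<bar> \<le> (\<Sum>e\<in>A. 1 / real N)"
      by (rule order_trans[OF sum_abs], rule sum_mono) (use n that in \<open>auto intro: less_imp_le\<close>)
    then show ?thesis by (simp add: sum_subtractf sum_distrib_left)
  qed
  have "\<exists>v::'v \<Rightarrow> real. \<forall>e. edge_map G e ` {0..1} \<subseteq> X \<longrightarrow> real_of_int (n e) = v (trg G e) - v (src G e)"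
  proof (rule integral_cocycle_exact[OF hk r X_def])
    fix e assume "edge_map G e ` {0..1} \<inter> X \<noteq> {}"
    then have e: "e \<in> E" by (auto simp: E_def EE_def)
    have "1 / real N \<le> 1 / 3" by (simp add: N_def)
    moreover have "\<bar>of_int q * w e + of_int (n (rv G e))\<bar> < 1 / real N" using n[OF rvE[OF e]] anti[of e] by simp
    ultimately have "\<bar>real_of_int (n (rv G e) + n e)\<bar> < 1" using n[OF e] by simp
    then have "n (rv G e) + n e = 0" by (rule approx0)
    then show "n (rv G e) = - n e" by simp
  next
    fix f assume "face_map G f ` cball 0 1 \<inter> X \<noteq> {}"
    then have "f \<in> FF" by (simp add: FF_def)
    then have f: "{e. lface G e = f} \<subseteq> E" by (auto simp: E_def EE_def)
    have "card {e. lface G e = f} \<le> m" unfolding m_def by (rule card_mono[OF finE f])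
    then have "real (card {e. lface G e = f}) / real N < 1" by (simp add: N_def)
    then have "\<bar>real_of_int (\<Sum>e | lface G e = f. n e)\<bar> < 1" using sum_bound[OF f] face0[of f] by simp
    then show "(\<Sum>e | lface G e = f. n e) = 0" by (rule approx0)
  qed
  then obtain v :: "'v \<Rightarrow> real" where v: "\<And>e. edge_map G e ` {0..1} \<subseteq> X \<Longrightarrow> real_of_int (n e) = v (trg G e) - v (src G e)"
    by blast
  have "sum_list (map (\<lambda>e. real_of_int (n e)) es) = v x - v x"
    by (rule walk_sum_gradient[OF walk]) (use v esX in blast)
  moreover have approx: "\<bar>of_int q * sum_list (map w ds) - sum_list (map (\<lambda>e. real_of_int (n e)) ds)\<bar> \<le> real (length ds) / real N"
    if "set ds \<subseteq> E" for ds
    using that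
  proof (induction ds)
    case (Cons d ds)
    have "\<bar>of_int q * w d - of_int (n d)\<bar> < 1 / real N" using Cons.prems n by simp
    moreover have approx: "\<bar>of_int q * sum_list (map w ds) - sum_list (map (\<lambda>e. real_of_int (n e)) ds)\<bar> \<le> real (length ds) / real N"
      using Cons by simp
    moreover have "real (length (d # ds)) / real N = 1 / real N + real (length ds) / real N" by (simp add: add_divide_distrib)
    ultimately show ?case by (simp add: distrib_left)
  qed simp
  moreover have "set es \<subseteq> E" by (auto simp: E_def EE_def)
  ultimately have "\<bar>of_int q * ?S\<bar> \<le> real (length es) / real N" using approx[of es] by simp
  moreover have "\<bar>?S\<bar> \<le> \<bar>of_int q * ?S\<bar>" using q mult_right_mono[of 1 "real_of_int q" "\<bar>?S\<bar>"] by (simp add: abs_mult)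
  ultimately have "\<bar>?S\<bar> \<le> real (length es) / real N" by linarith
  then have "real N * \<bar>?S\<bar> \<le> real (length es)" using N by (simp add: field_simps)
  moreover have "real (length es) < real N0 * \<bar>?S\<bar>" using N0 S by (simp add: field_simps)
  moreover have "real N0 * \<bar>?S\<bar> \<le> real N * \<bar>?S\<bar>" by (intro mult_right_mono) (auto simp: N_def)
  ultimately show False by linarith
qed

text \<open>Integration along chosen walks from a base point: the walks to both ends of
  \<open>e\<close> together with \<open>e\<close> form a closed walk, whose sum vanishes.\<close>

lemma cocycle_exact:
  fixes w :: "'e \<Rightarrow> real"
  assumes anti: "\<And>e. w (rv G e) = - w e" and face0: "\<And>f. (\<Sum>e | lface G e = f. w e) = 0"
  shows "\<exists>v. \<forall>e. v (trg G e) - v (src G e) = w e"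
proof -
  fix x0 :: 'v
  define P where "P y = (SOME es. walk x0 es y)" for y
  have P: "walk x0 (P y) y" for y unfolding P_def using walk_exists by (rule someI_ex)
  have rev_sum: "sum_list (map w (map (rv G) (rev es))) = - sum_list (map w es)" for es
    by (induction es) (simp_all add: anti)
  have "sum_list (map w (P (trg G e))) - sum_list (map w (P (src G e))) = w e" for e
  proof -
    have "walk (trg G e) (map (rv G) (rev (P (trg G e)))) x0" by (rule walk_rev[OF P])
    then have "walk x0 (P (src G e) @ e # map (rv G) (rev (P (trg G e)))) x0"
      using P by (auto simp: walk_append)
    from closed_walk_sum[OF anti face0 this] show ?thesis
      using rev_sum[of "P (trg G e)"] by simp
  qed
  then show ?thesis by (intro exI[of _ "\<lambda>y. sum_list (map w (P y))"]) simp
qed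

lemma gradient_eq_0_imp_constant:
  assumes "\<And>e. v (trg G e) = v (src G e)"
  shows "v x = v y"
proof -
  have "walk x es y \<Longrightarrow> v x = v y" for es
    by (induction es arbitrary: x) (auto simp: assms[symmetric])
  then show ?thesis using walk_exists by blast
qed

end

section \<open>Rotations at vertices of finite degree, and exactness on the dual graph\<close>

locale bounded_disk_complex = disk_complex G
  for G :: "('v, 'e, 'f, 'p::topological_space) cell_complex" +
  assumes bounded: "bounded_degrees G"
begin

lemma finite_src: "finite {e. src G e = i}"
  using bounded unfolding bounded_degrees_def by blast

lemma bij_rho: "bij_betw (\<lambda>d. rho d) {e. src G e = i} {e. src G e = i}"
proof -
  have "(\<lambda>d. rho d) ` {e. src G e = i} \<subseteq> {e. src G e = i}" by auto
  moreover have "inj_on (\<lambda>d. rho d) {e. src G e = i}" using inj_rho by (rule inj_on_subset) simp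
  ultimately show ?thesis using finite_src endo_inj_surj[of "{e. src G e = i}"] by (simp add: bij_betw_def)
qed

text \<open>The faces around one vertex are linked by the rotation, and neighbouring vertices share
  a face, since \<open>nxt G d\<close> starts at the end of \<open>d\<close> and has the same left
  face.\<close>

lemma dual_gradient_eq_0_imp_constant:
  assumes u: "\<And>e. u (rface G e) = u (lface G e)"
  shows "u f = u f'"
proof -
  have pow: "u (lface G (((\<lambda>d. rho d) ^^ m) e)) = u (lface G e)" for m e
    by (induction m) (simp_all add: u)
  have same: "u (lface G e) = u (lface G e')" if "src G e = src G e'" for e e'
    using rho_transitive[OF finite_src, of e "src G e'" e'] that pow by metis
  have walk: "walk x es y \<Longrightarrow> src G e = x \<Longrightarrow> src G e' = y \<Longrightarrow> u (lface G e) = u (lface G e')" for es x y e e'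
  proof (induction es arbitrary: x e)
    case (Cons d es)
    have "u (lface G e) = u (lface G d)" using Cons.prems same by simp
    also have "\<dots> = u (lface G (nxt G d))" by simp
    also have "\<dots> = u (lface G e')" using Cons.IH[of "trg G d" "nxt G d"] Cons.prems by simp
    finally show ?case .
  qed (use same in simp)
  obtain e where "lface G e = f" using face_has_edge by blast
  moreover obtain e' where "lface G e' = f'" using face_has_edge by blast
  moreover obtain es where "walk (src G e) es (src G e')" using walk_exists by blast
  ultimately show ?thesis using walk by blast
qed

text \<open>Extend the sought \<open>u\<close> by unknown values \<open>v\<close> at the vertices.  The differences \<open>k\<close> of \<open>v\<close> and \<open>u\<close> at the corners are found,
  up to a constant at each vertex, by going around the vertices; the increments of \<open>k\<close> along the face boundaries are then a
  cocycle, and \<open>v\<close> is its primitive.\<close>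

lemma dual_cocycle_exact:
  fixes w :: "'e \<Rightarrow> real"
  assumes anti: "\<And>e. w (rv G e) = - w e" and vert0: "\<And>i. (\<Sum>e | src G e = i. w e) = 0"
  shows "\<exists>u. \<forall>e. u (rface G e) - u (lface G e) = w e"
proof -
  let ?\<rho> = "\<lambda>d. rho d"
  define base where "base i = (SOME e. src G e = i)" for i
  have base: "src G (base (src G e)) = src G e" for e
    unfolding base_def by (rule someI[of _ e]) simp
  define m where "m e = (LEAST m. (?\<rho> ^^ m) (base (src G e)) = e)" for e
  have m_exists: "\<exists>m. (?\<rho> ^^ m) (base (src G e)) = e" for e
    by (rule rho_transitive[OF finite_src base refl])
  have m: "(?\<rho> ^^ m e) (base (src G e)) = e" for e
    unfolding m_def by (rule LeastI_ex[OF m_exists])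
  have m_le: "m e \<le> j" if "(?\<rho> ^^ j) (base (src G e)) = e" for e j
    unfolding m_def using that by (rule Least_le)
  \<comment> \<open>Minus the sum of \<open>w\<close> over the edges passed when rotating from the
    base edge of the vertex to \<open>e\<close>.\<close>
  define k where "k e = - (\<Sum>j<m e. w ((?\<rho> ^^ j) (base (src G e))))" for e
  have k: "k (rho e) = k e - w e" for e
  proof (cases "rho e = base (src G e)")
    case False
    have "m (rho e) = Suc (m e)"
    proof (rule antisym)
      show "m (rho e) \<le> Suc (m e)" by (rule m_le) (simp add: m)
      show "Suc (m e) \<le> m (rho e)"
      proof (cases "m (rho e)")
        case 0
        then show ?thesis using m[of "rho e"] False by simp
      next
        case (Suc j)
        then have "?\<rho> ((?\<rho> ^^ j) (base (src G e))) = rho e" using m[of "rho e"] by simp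
        then have "(?\<rho> ^^ j) (base (src G e)) = e" using injD[OF inj_rho] by blast
        then show ?thesis using m_le Suc by simp
      qed
    qed
    then show ?thesis by (simp add: k_def m)
  next
    case True
    let ?b = "base (src G e)"
    \<comment> \<open>Here the rotation returns to the base edge. By minimality of
      \<open>m e\<close> it has then passed every edge at the vertex exactly once, so
      \<open>k e - w e\<close> is minus the full sum, which is 0.\<close>
    have per: "(?\<rho> ^^ Suc (m e)) ?b = ?b" using True m[of e] by simp
    have "inj_on (\<lambda>j. (?\<rho> ^^ j) ?b) {..<Suc (m e)}"
    proof (rule linorder_inj_onI)
      fix a c assume ac: "a < c" "a \<in> {..<Suc (m e)}" "c \<in> {..<Suc (m e)}"
      show "(?\<rho> ^^ a) ?b \<noteq> (?\<rho> ^^ c) ?b"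
      proof
        assume h: "(?\<rho> ^^ a) ?b = (?\<rho> ^^ c) ?b"
        have "(?\<rho> ^^ (m e - c + a)) ?b = (?\<rho> ^^ (m e - c)) ((?\<rho> ^^ a) ?b)" by (simp add: funpow_add)
        also have "\<dots> = (?\<rho> ^^ (m e - c)) ((?\<rho> ^^ c) ?b)" using h by simp
        also have "\<dots> = (?\<rho> ^^ (m e - c + c)) ?b" by (simp add: funpow_add)
        also have "m e - c + c = m e" using ac by simp
        finally have "m e \<le> m e - c + a" using m m_le by simp
        then show False using ac by simp
      qed
    qed auto
    moreover have "(\<lambda>j. (?\<rho> ^^ j) ?b) ` {..<Suc (m e)} = {d. src G d = src G e}"
    proof (intro equalityI subsetI)
      fix d assume "d \<in> {d. src G d = src G e}"
      then obtain M where "(?\<rho> ^^ M) ?b = d" using rho_transitive[OF finite_src base, of d] by auto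
      then have "(?\<rho> ^^ (M mod Suc (m e))) ?b = d" using funpow_mod_eq[OF per] by simp
      then show "d \<in> (\<lambda>j. (?\<rho> ^^ j) ?b) ` {..<Suc (m e)}" by (intro image_eqI[of _ _ "M mod Suc (m e)"]) auto
    next
      have "src G ((?\<rho> ^^ j) ?b) = src G e" for j by (induction j) (simp_all add: base)
      then show "d \<in> {d. src G d = src G e}" if "d \<in> (\<lambda>j. (?\<rho> ^^ j) ?b) ` {..<Suc (m e)}" for d
        using that by auto
    qed
    ultimately have "bij_betw (\<lambda>j. (?\<rho> ^^ j) ?b) {..<Suc (m e)} {d. src G d = src G e}"
      by (simp add: bij_betw_def)
    from sum.reindex_bij_betw[OF this, of w] vert0[of "src G e"]
    have "(\<Sum>j<Suc (m e). w ((?\<rho> ^^ j) ?b)) = 0" by simp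
    then have "k e - w e = 0" by (simp add: k_def m)
    moreover have "(?\<rho> ^^ 0) (base (src G (rho e))) = rho e" using True[symmetric] by simp
    from m_le[OF this] have "m (rho e) = 0" by simp
    then have "k (rho e) = 0" by (simp add: k_def)
    ultimately show ?thesis by simp
  qed
  have knxt: "k (nxt G e) = k (rv G e) + w e" for e using k[of "rv G e"] anti[of e] by simp
  have "\<exists>v. \<forall>e. v (trg G e) - v (src G e) = k (nxt G e) - k e"
  proof (rule cocycle_exact)
    show "k (nxt G (rv G e)) - k (rv G e) = - (k (nxt G e) - k e)" for e
      using k[of e] knxt[of e] by simp
    show "(\<Sum>e | lface G e = f. k (nxt G e) - k e) = 0" for f
      using sum.reindex_bij_betw[OF bij_nxt_face, of k f] by (simp add: sum_subtractf)
  qed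
  then obtain v where v: "\<And>e. v (trg G e) - v (src G e) = k (nxt G e) - k e" by blast
  \<comment> \<open>The value of \<open>v\<close> at a corner minus the difference \<open>k\<close>
    is constant along the face boundary: it is the sought value on the face.\<close>
  define c where "c e = v (src G e) - k e" for e
  have "c (nxt G e) = c e" for e using v[of e] by (simp add: c_def)
  then have cpow: "c ((nxt G ^^ j) e) = c e" for j e by (induction j) simp_all
  have u: "c (face_start (lface G e)) = c e" for e
    using nxt_transitive[of "face_start (lface G e)" e] lface_face_start cpow by metis
  have "c (face_start (rface G e)) - c (face_start (lface G e)) = w e" for e
    using u[of "rho e"] u[of e] k[of e] by (simp add: c_def)
  then show ?thesis by (intro exI[of _ "\<lambda>f. c (face_start f)"]) simp
qed

end

section \<open>Trigonometry of a kite\<close>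

text \<open>The half-angle at one face as a function of the logarithm \<open>x\<close> of the radius
  across the edge divided by the radius of the face itself. \<open>kite_log \<theta>\<close> is its
  inverse on the interval from 0 to \<open>pi - \<theta>\<close>.\<close>

definition kite_angle :: "real \<Rightarrow> real \<Rightarrow> real" where
  "kite_angle \<theta> x = arccot ((exp (- x) - cos \<theta>) / sin \<theta>)"

definition kite_log :: "real \<Rightarrow> real \<Rightarrow> real" where
  "kite_log \<theta> b = ln (sin b / sin (b + \<theta>))"

lemma arccot_cot:
  assumes "0 < b" "b < pi" shows "arccot (cot b) = b"
proof -
  have "cot b = tan (pi / 2 - b)" by (simp add: cot_def tan_def sin_diff cos_diff)
  moreover have "arctan (tan (pi / 2 - b)) = pi / 2 - b" using assms by (intro arctan_tan) auto
  ultimately show ?thesis by (simp add: arccot_def)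
qed

lemma arccot_bounds: "0 < arccot x" "arccot x < pi"
  using arctan_bounded[of x] by (simp_all add: arccot_def)

lemma cot_arccot: "cot (arccot x) = x"
proof -
  have "cot (arccot x) = sin (arctan x) / cos (arctan x)"
    by (simp add: arccot_def cot_def cos_diff sin_diff)
  also have "\<dots> = tan (arctan x)" by (simp only: tan_def)
  finally show ?thesis by (simp only: tan_arctan)
qed

lemma kite_angle_log:
  assumes t: "0 < \<theta>" "\<theta> < pi" and b: "0 < b" "b < pi - \<theta>"
  shows "kite_angle \<theta> (kite_log \<theta> b) = b"
proof -
  have s: "sin b > 0" "sin (b + \<theta>) > 0" "sin \<theta> > 0" using t b by (auto intro!: sin_gt_zero)
  have "exp (- kite_log \<theta> b) = sin (b + \<theta>) / sin b"
    using s by (simp add: kite_log_def exp_minus)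
  also have "\<dots> = cos \<theta> + cot b * sin \<theta>" using s by (simp add: sin_add cot_def field_simps)
  finally have "(exp (- kite_log \<theta> b) - cos \<theta>) / sin \<theta> = cot b" using s by simp
  then show ?thesis unfolding kite_angle_def using arccot_cot[of b] t b by simp
qed

lemma kite_angle_bounds:
  assumes t: "0 < \<theta>" "\<theta> < pi"
  shows "0 < kite_angle \<theta> x" "kite_angle \<theta> x < pi - \<theta>"
proof -
  show "0 < kite_angle \<theta> x" unfolding kite_angle_def by (rule arccot_bounds)
  have s: "sin \<theta> > 0" using t by (intro sin_gt_zero)
  have "cot (pi - \<theta>) = - cos \<theta> / sin \<theta>" by (simp add: cot_def)
  also have "\<dots> < (exp (- x) - cos \<theta>) / sin \<theta>" using s by (intro divide_strict_right_mono) auto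
  finally have "arccot ((exp (- x) - cos \<theta>) / sin \<theta>) < arccot (cot (pi - \<theta>))"
    unfolding arccot_def using arctan_less_iff by simp
  then show "kite_angle \<theta> x < pi - \<theta>" using arccot_cot[of "pi - \<theta>"] t by (simp add: kite_angle_def)
qed

lemma kite_angle_exp:
  assumes t: "0 < \<theta>" "\<theta> < pi"
  shows "exp x = sin (kite_angle \<theta> x) / sin (kite_angle \<theta> x + \<theta>)"
proof -
  let ?b = "kite_angle \<theta> x"
  have b: "0 < ?b" "?b < pi - \<theta>" using kite_angle_bounds[OF t] by auto
  have s: "sin ?b > 0" "sin (?b + \<theta>) > 0" "sin \<theta> > 0" using t b by (auto intro!: sin_gt_zero)
  have "cot ?b = (exp (- x) - cos \<theta>) / sin \<theta>" unfolding kite_angle_def by (rule cot_arccot)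
  then have "exp (- x) = cos \<theta> + cot ?b * sin \<theta>" using s by simp
  also have "\<dots> = sin (?b + \<theta>) / sin ?b" using s by (simp add: sin_add cot_def field_simps)
  finally have "inverse (exp x) = sin (?b + \<theta>) / sin ?b" by (simp add: exp_minus)
  then show ?thesis by (metis inverse_divide inverse_inverse_eq)
qed

lemma kite_log_angle:
  assumes t: "0 < \<theta>" "\<theta> < pi"
  shows "kite_log \<theta> (kite_angle \<theta> x) = x"
  unfolding kite_log_def kite_angle_exp[OF t, symmetric] by simp

text \<open>Exchanging the two circles of the kite inverts the ratio of the radii and exchanges the
  half-angles, whose sum is \<open>pi - \<theta>\<close>.\<close>

lemma kite_log_reflect:
  assumes t: "0 < \<theta>" "\<theta> < pi" and b: "0 < b" "b < pi - \<theta>"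
  shows "kite_log \<theta> (pi - \<theta> - b) = - kite_log \<theta> b"
proof -
  have s: "sin b > 0" "sin (b + \<theta>) > 0" using t b by (auto intro!: sin_gt_zero)
  have "sin (pi - \<theta> - b) = sin (b + \<theta>)" using sin_pi_minus[of "b + \<theta>"] by (simp add: algebra_simps)
  moreover have "sin (pi - \<theta> - b + \<theta>) = sin b" by simp
  ultimately show ?thesis using s by (simp add: kite_log_def ln_div)
qed

lemma kite_angle_reflect:
  assumes t: "0 < \<theta>" "\<theta> < pi"
  shows "kite_angle \<theta> (- x) = pi - \<theta> - kite_angle \<theta> x"
proof -
  let ?b = "kite_angle \<theta> x"
  have b: "0 < ?b" "?b < pi - \<theta>" using kite_angle_bounds[OF t] by auto
  have "kite_log \<theta> (pi - \<theta> - ?b) = - x" using kite_log_reflect[OF t b] kite_log_angle[OF t] by simp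
  then show ?thesis using kite_angle_log[OF t, of "pi - \<theta> - ?b"] b by simp
qed

section \<open>Half-angles for admissible intersection angles\<close>

locale angled_complex = bounded_disk_complex G
  for G :: "('v, 'e, 'f, 'p::topological_space) cell_complex" +
  fixes \<Theta> :: "'e \<Rightarrow> real" and \<epsilon>\<^sub>0 :: real
  assumes eps: "\<epsilon>\<^sub>0 > 0" and angles: "admissible_angles G \<epsilon>\<^sub>0 \<Theta>"
begin

lemma Theta_bounds: "\<epsilon>\<^sub>0 < \<Theta> e" "\<Theta> e < pi - \<epsilon>\<^sub>0" and Theta_rv [simp]: "\<Theta> (rv G e) = \<Theta> e"
  using angles by (auto simp: admissible_angles_def)

lemma Theta_pos: "0 < \<Theta> e" "\<Theta> e < pi"
  using Theta_bounds[of e] eps by auto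

lemma eps_lt: "\<epsilon>\<^sub>0 < pi / 2"
  using Theta_bounds[of "SOME e. True"] by linarith

lemma half_angle_kite:
  assumes "\<And>f. R f > 0"
  shows "half_angle G \<Theta> R e = kite_angle (\<Theta> e) (ln (R (rface G e)) - ln (R (lface G e)))"
proof -
  have "exp (- (ln (R (rface G e)) - ln (R (lface G e)))) = R (lface G e) / R (rface G e)"
    using assms by (simp add: exp_diff)
  moreover have "(R (lface G e) - R (rface G e) * cos (\<Theta> e)) / (R (rface G e) * sin (\<Theta> e)) =
      (R (lface G e) / R (rface G e) - cos (\<Theta> e)) / sin (\<Theta> e)"
    using assms[of "rface G e"] by (simp add: field_simps)
  ultimately show ?thesis by (simp add: half_angle_def kite_angle_def)
qed

context
  fixes R :: "'f \<Rightarrow> real"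
  assumes R: "\<And>f. R f > 0"
begin

lemma half_angle_bounds: "0 < half_angle G \<Theta> R e" "half_angle G \<Theta> R e < pi - \<Theta> e"
  unfolding half_angle_kite[OF R] using kite_angle_bounds Theta_pos by auto

lemma half_angle_rv: "half_angle G \<Theta> R (rv G e) = pi - \<Theta> e - half_angle G \<Theta> R e"
  unfolding half_angle_kite[OF R] using kite_angle_reflect[OF Theta_pos, of e "ln (R (rface G e)) - ln (R (lface G e))"]
  by simp

lemma half_angle_sin_pos: "0 < sin (half_angle G \<Theta> R e)"
  using half_angle_bounds[of e] Theta_pos[of e] by (intro sin_gt_zero) auto

text \<open>With the origin at the end point of \<open>e\<close> and the left centre on the positive
  real axis, this is the vector from the right to the left centre. Its length comes from the law of
  sines, its direction from the cotangent of the half-angle.\<close>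

lemma kite_law:
  "of_real (R (lface G e)) - of_real (R (rface G e)) * cis (\<Theta> e) =
    of_real (R (rface G e) * sin (\<Theta> e) / sin (half_angle G \<Theta> R e)) * cis (- half_angle G \<Theta> R e)"
proof -
  let ?a = "half_angle G \<Theta> R e" and ?l = "R (lface G e)" and ?r = "R (rface G e)"
  have s: "sin ?a > 0" "sin (\<Theta> e) > 0" using half_angle_sin_pos Theta_pos by (auto intro: sin_gt_zero)
  have "cot ?a = (?l - ?r * cos (\<Theta> e)) / (?r * sin (\<Theta> e))" unfolding half_angle_def by (rule cot_arccot)
  then have "?l - ?r * cos (\<Theta> e) = ?r * sin (\<Theta> e) / sin ?a * cos ?a"
    using s R[of "rface G e"] by (simp add: cot_def field_simps)
  then show ?thesis using s by (simp add: complex_eq_iff)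
qed

end

end

section \<open>A Ring Lemma\<close>

text \<open>\<open>A\<close> and \<open>B\<close> are the coordinates of \<open>q - z\<close> with
  respect to the unit vectors along the sides at \<open>z\<close>. They are positive inside the
  sector, and closeness to \<open>z\<close> keeps both barycentric coordinates at the far corners
  below 1/2. These conditions are open, so the point is interior.\<close>

lemma triangle_interior:
  fixes z d :: complex and l r \<theta> :: real
  assumes d: "norm d = 1" and t: "0 < \<theta>" "\<theta> < pi" and l: "l > 0" and r: "r > 0"
    and q: "Im ((q - z) * cnj d) > 0" "Im (cis \<theta> * d * cnj (q - z)) > 0"
    and small: "2 * norm (q - z) < sin \<theta> * min l r"
  shows "q \<in> interior (convex hull {z, z + of_real l * (cis \<theta> * d), z + of_real r * d})"
proof -
  define U where "U = {q. Im ((q - z) * cnj d) > 0} \<inter> {q. Im (cis \<theta> * d * cnj (q - z)) > 0} \<inter>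
    {q. 2 * norm (q - z) < sin \<theta> * min l r}"
  have "open U" unfolding U_def
    by (intro open_Int open_Collect_less continuous_intros)
  moreover have "U \<subseteq> convex hull {z, z + of_real l * (cis \<theta> * d), z + of_real r * d}"
  proof
    fix q assume "q \<in> U"
    then have q: "Im ((q - z) * cnj d) > 0" "Im (cis \<theta> * d * cnj (q - z)) > 0" "2 * norm (q - z) < sin \<theta> * min l r"
      by (auto simp: U_def)
    have s: "sin \<theta> > 0" using t by (intro sin_gt_zero)
    define u where "u = (q - z) * cnj d"
    define A where "A = Im u / sin \<theta>"
    define B where "B = Im (cis \<theta> * cnj u) / sin \<theta>"
    have dd: "d * cnj d = 1" using d by (metis complex_norm_square of_real_1 power_one)
    have u_eq: "u * d = q - z" unfolding u_def using dd by (metis mult.assoc mult.commute mult.right_neutral)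
    have cu: "cis \<theta> * cnj u = cis \<theta> * d * cnj (q - z)" by (simp add: u_def algebra_simps)
    have nu: "norm u = norm (q - z)" using d by (simp add: u_def norm_mult)
    have "Im u > 0" using q(1) by (simp only: u_def)
    moreover have "Im (cis \<theta> * cnj u) > 0" using q(2) by (simp only: cu)
    ultimately have AB: "A > 0" "B > 0" using s by (simp_all only: A_def B_def divide_pos_pos)
    have "A \<le> norm u / sin \<theta>" unfolding A_def using s abs_Im_le_cmod[of u] by (intro divide_right_mono) auto
    then have "A \<le> norm (q - z) / sin \<theta>" by (simp add: nu)
    moreover have "Im (cis \<theta> * cnj u) \<le> norm u" using abs_Im_le_cmod[of "cis \<theta> * cnj u"] by (simp add: norm_mult)
    then have "B \<le> norm (q - z) / sin \<theta>" unfolding B_def using s nu by (intro divide_right_mono) auto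
    moreover have "norm (q - z) / sin \<theta> < l / 2" "norm (q - z) / sin \<theta> < r / 2"
    proof -
      have "sin \<theta> * min l r \<le> sin \<theta> * l" "sin \<theta> * min l r \<le> sin \<theta> * r" using s by (auto intro: mult_left_mono)
      then have "2 * norm (q - z) < sin \<theta> * l" "2 * norm (q - z) < sin \<theta> * r" using q(3) by linarith+
      then show "norm (q - z) / sin \<theta> < l / 2" "norm (q - z) / sin \<theta> < r / 2" using s by (auto simp: field_simps)
    qed
    ultimately have ab: "A / l < 1/2" "B / r < 1/2" using l r by (auto simp: field_simps)
    have "of_real A * cis \<theta> + of_real B = u"
    proof (rule complex_eqI)
      show "Im (of_real A * cis \<theta> + of_real B) = Im u" using s by (simp add: A_def)
      have "B * sin \<theta> = sin \<theta> * Re u - cos \<theta> * Im u" using s by (simp add: B_def)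
      moreover have "A * sin \<theta> = Im u" using s by (simp add: A_def)
      moreover have "(A * cos \<theta> + B) * sin \<theta> = (A * sin \<theta>) * cos \<theta> + B * sin \<theta>"
        by (simp add: algebra_simps)
      ultimately have "(A * cos \<theta> + B) * sin \<theta> = Re u * sin \<theta>" by (simp add: algebra_simps)
      then show "Re (of_real A * cis \<theta> + of_real B) = Re u" using s by simp
    qed
    then have "q - z = of_real A * (cis \<theta> * d) + of_real B * d" using u_eq by (metis distrib_right mult.assoc)
    then have "q = (1 - A / l - B / r) *\<^sub>R z + (A / l) *\<^sub>R (z + of_real l * (cis \<theta> * d)) + (B / r) *\<^sub>R (z + of_real r * d)"
      using l r by (simp add: scaleR_conv_of_real algebra_simps)
    moreover have "0 \<le> 1 - A / l - B / r" using ab by linarith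
    moreover have "0 \<le> A / l" "0 \<le> B / r" using AB l r by simp_all
    ultimately show "q \<in> convex hull {z, z + of_real l * (cis \<theta> * d), z + of_real r * d}"
      unfolding convex_hull_3
      by (intro CollectI exI conjI) (assumption, assumption, assumption, assumption, simp)
  qed
  ultimately have "U \<subseteq> interior (convex hull {z, z + of_real l * (cis \<theta> * d), z + of_real r * d})"
    by (intro interior_maximal)
  moreover have "q \<in> U" using q small by (simp add: U_def)
  ultimately show ?thesis by blast
qed

lemma sin_ge_half:
  fixes x :: real assumes "0 \<le> x" "x \<le> pi / 2" shows "x / 2 \<le> sin x"
proof (cases "x \<le> 1")
  case True
  have sum: "(\<Sum>m<3. sin_coeff m * x ^ m) = x" by (simp add: numeral_eq_Suc sin_coeff_def)
  have "\<bar>sin x - x\<bar> \<le> inverse (fact 3) * \<bar>x\<bar> ^ 3" using Maclaurin_sin_bound[of x 3] unfolding sum .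
  moreover have "\<bar>x\<bar> ^ 3 \<le> x" using assms True power_decreasing[of 1 3 x] by simp
  moreover have "inverse (fact 3) = (1/6::real)" by (simp add: fact_numeral)
  ultimately have "\<bar>sin x - x\<bar> \<le> x / 6" by simp
  then show ?thesis using assms(1) by linarith
next
  case False
  have "sin 1 \<le> sin x" using False assms by (intro sin_monotone_2pi_le) auto
  moreover have "pi / 4 \<le> (1::real)" using pi_less_4 by simp
  then have "sin (pi / 4) \<le> sin 1" using pi_ge_two by (intro sin_monotone_2pi_le) auto
  moreover have "\<bar>sin (1::real) - (\<Sum>m<3. sin_coeff m * 1 ^ m)\<bar> \<le> inverse (fact 3) * \<bar>1\<bar> ^ 3" by (rule Maclaurin_sin_bound)
  moreover have "(\<Sum>m<3. sin_coeff m * (1::real) ^ m) = 1" by (simp add: numeral_eq_Suc sin_coeff_def)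
  ultimately have "sin x \<ge> 5/6" by (simp add: fact_numeral)
  moreover have "x / 2 \<le> 5/6"
  proof -
    have "pi < 3.2" using pi_approx by simp
    then show ?thesis using assms by simp
  qed
  ultimately show ?thesis by simp
qed

section \<open>Directions and lengths in a developed pattern\<close>

locale developed_pattern = angled_complex G \<Theta> \<epsilon>\<^sub>0
  for G :: "('v, 'e, 'f, 'p::topological_space) cell_complex" and \<Theta> \<epsilon>\<^sub>0 +
  fixes R :: "'f \<Rightarrow> real" and z :: "'v \<Rightarrow> complex" and w :: "'f \<Rightarrow> complex"
  assumes radii: "R \<in> pattern_radii G \<Theta>"
    and dev: "developing_map G \<Theta> R z w"
    and disjoint: "\<And>e e'. e \<noteq> e' \<Longrightarrow>
      interior (developed_triangle G z w e) \<inter> interior (developed_triangle G z w e') = {}"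
    and one_end: "one_ended G"
begin

abbreviation "\<alpha> \<equiv> half_angle G \<Theta> R"

lemma R_pos: "R f > 0" and alpha_sum: "(\<Sum>e | lface G e = f. \<alpha> e) = pi"
  using radii by (auto simp: pattern_radii_def)

lemmas alpha_bounds = half_angle_bounds[of R, OF R_pos]
lemmas alpha_rv = half_angle_rv[of R, OF R_pos]
lemmas alpha_sin_pos = half_angle_sin_pos[of R, OF R_pos]

text \<open>Directions towards the centre of the left face are used instead of directions of edges
  because they turn by known angles: by \<open>\<Theta>\<close> around a vertex and by twice the
  half-angle along a face.\<close>

definition dir :: "'e \<Rightarrow> complex" where
  "dir e = (w (lface G e) - z (src G e)) / of_real (R (lface G e))"

lemma norm_dir: "norm (dir e) = 1"
proof -
  have "cmod (w (lface G e) - z (src G e)) = R (lface G e)" using dev unfolding developing_map_def by blast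
  then show ?thesis using R_pos[of "lface G e"] by (simp add: dir_def norm_divide)
qed

lemma dir_rho: "dir e = cis (\<Theta> e) * dir (rho e)"
  using dev by (simp add: dir_def developing_map_def)

lemma w_lface: "w (lface G e) = z (src G e) + of_real (R (lface G e)) * dir e"
  using R_pos[of "lface G e"] by (simp add: dir_def)

lemma w_rface: "w (rface G e) = z (src G e) + of_real (R (rface G e)) * dir (rho e)"
  using w_lface[of "rho e"] by simp

text \<open>Both triangles of the kite express the same difference of centres; by
  \<open>kite_law\<close> and its complex conjugate the two expressions differ by the rotation
  through twice the half-angle, the angle that the edge subtends at the centre.\<close>

lemma dir_nxt: "dir (nxt G e) = dir e * cis (2 * \<alpha> e)"
proof -
  let ?l = "R (lface G e)" and ?r = "R (rface G e)"
  define c where "c = ?r * sin (\<Theta> e) / sin (\<alpha> e)"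
  have "c > 0" unfolding c_def using R_pos alpha_sin_pos[of e] sin_gt_zero[OF Theta_pos, of e] by simp
  have law: "of_real ?l - of_real ?r * cis (\<Theta> e) = of_real c * cis (- \<alpha> e)"
    unfolding c_def by (rule kite_law[of R, OF R_pos])
  then have "cnj (of_real ?l - of_real ?r * cis (\<Theta> e)) = cnj (of_real c * cis (- \<alpha> e))" by simp
  then have law': "of_real ?l - of_real ?r * cis (- \<Theta> e) = of_real c * cis (\<alpha> e)"
    by (simp add: cis_cnj)
  have 1: "w (lface G e) - w (rface G e) = of_real ?l * dir e - of_real ?r * dir (rho e)"
    using w_lface[of e] w_rface[of e] by simp
  have r: "dir (rho e) = cis (- \<Theta> e) * dir e"
    using dir_rho[of e] by (simp add: mult.assoc[symmetric] cis_mult)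
  have 2: "w (lface G e) - w (rface G e) = of_real ?l * dir (nxt G e) - of_real ?r * dir (rv G e)"
    using w_lface[of "rv G e"] w_rface[of "rv G e"] by simp
  have r': "dir (rv G e) = cis (\<Theta> e) * dir (nxt G e)" using dir_rho[of "rv G e"] by simp
  have "of_real c * cis (\<alpha> e) * dir e = of_real c * cis (- \<alpha> e) * dir (nxt G e)"
    using 1 2 unfolding r r' law[symmetric] law'[symmetric] by (simp add: algebra_simps)
  then have "cis (\<alpha> e) * dir e = cis (- \<alpha> e) * dir (nxt G e)" using \<open>c > 0\<close> by simp
  then have "cis (\<alpha> e) * (cis (\<alpha> e) * dir e) = cis (\<alpha> e) * (cis (- \<alpha> e) * dir (nxt G e))" by simp
  then show ?thesis by (simp add: mult.assoc[symmetric] cis_mult mult.commute)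
qed

lemma norm_cis_minus_1: "norm (cis (2 * x) - 1) = 2 * \<bar>sin x\<bar>"
proof -
  have "cis (2 * x) - 1 = cis x * (cis x - cis (- x))" by (simp add: algebra_simps cis_mult)
  also have "cis x - cis (- x) = 2 * \<i> * of_real (sin x)" by (simp add: complex_eq_iff)
  finally show ?thesis by (simp add: norm_mult)
qed

lemma vertex_distance:
  assumes "dir e' = dir e * cis (2 * x)" "lface G e' = lface G e"
  shows "norm (z (src G e) - z (src G e')) = 2 * R (lface G e) * \<bar>sin x\<bar>"
proof -
  have "z (src G e) - z (src G e') = of_real (R (lface G e)) * dir e * (cis (2 * x) - 1)"
    using w_lface[of e] w_lface[of e'] assms by (simp add: algebra_simps)
  then show ?thesis using R_pos[of "lface G e"] norm_dir[of e] by (simp add: norm_mult norm_cis_minus_1)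
qed

lemma edge_length: "norm (z (src G e) - z (trg G e)) = 2 * R (lface G e) * sin (\<alpha> e)"
  using vertex_distance[OF dir_nxt, of e] alpha_sin_pos[of e] by simp

lemma edge_length_rface: "norm (z (src G e) - z (trg G e)) = 2 * R (rface G e) * sin (\<alpha> (rv G e))"
  using edge_length[of "rv G e"] by (simp add: norm_minus_commute)

text \<open>At distance \<open>s\<close> from \<open>p\<close>, moving the apex from
  \<open>p\<close> to a vertex within \<open>r\<close> cannot push a point out of the sector if its
  angular distance to both sides is large enough. So all triangles at the vertices of a small
  cluster can be treated as if they had the common apex \<open>p\<close>, as long as
  \<open>s\<close> is small compared with the radii.\<close>

lemma triangle_sector:
  fixes p :: complex and t x r s :: real
  assumes dir: "dir e = cis t" and near: "norm (z (src G e) - p) \<le> r"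
    and t: "0 \<le> t - x" "t - x \<le> \<Theta> e"
    and sin1: "r < s * sin (t - x)" and sin2: "r < s * sin (\<Theta> e - (t - x))"
    and s: "s \<ge> 0" and small: "2 * (s + r) < sin (\<Theta> e) * R (lface G e)" "2 * (s + r) < sin (\<Theta> e) * R (rface G e)"
  shows "p + of_real s * cis x \<in> interior (developed_triangle G z w e)"
proof -
  let ?q = "p + of_real s * cis x" and ?d = "dir (rho e)"
  have d: "?d = cis (t - \<Theta> e)" using dir_rho[of e] dir
    by (metis (no_types, lifting) cis_divide cis_neq_zero nonzero_mult_div_cancel_left)
  have "?q \<in> interior (convex hull {z (src G e), z (src G e) + of_real (R (lface G e)) * (cis (\<Theta> e) * ?d),
     z (src G e) + of_real (R (rface G e)) * ?d})"
  proof (rule triangle_interior[OF norm_dir Theta_pos R_pos R_pos])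
    let ?\<delta> = "p - z (src G e)"
    have y: "?q - z (src G e) = of_real s * cis x + ?\<delta>" by simp
    have \<delta>: "norm ?\<delta> \<le> r" using near by (simp add: norm_minus_commute)
    have "x + - (t - \<Theta> e) = \<Theta> e - (t - x)" by simp
    then have "Im (of_real s * cis x * cnj ?d) = Im (of_real s * cis (\<Theta> e - (t - x)))"
      by (simp only: d cis_cnj mult.assoc cis_mult)
    also have "\<dots> = s * sin (\<Theta> e - (t - x))" by simp
    finally have "Im (of_real s * cis x * cnj ?d) = s * sin (\<Theta> e - (t - x))" .
    moreover have "\<bar>Im (?\<delta> * cnj ?d)\<bar> \<le> r"
      by (rule order_trans[OF abs_Im_le_cmod]) (use \<delta> norm_dir in \<open>simp add: norm_mult\<close>)
    ultimately show "0 < Im ((?q - z (src G e)) * cnj ?d)"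
      unfolding y using sin2 by (simp add: distrib_right)
    have dd: "cis (\<Theta> e) * ?d = cis t" unfolding d by (simp add: cis_mult)
    have "t + - x = t - x" by simp
    then have "Im (cis t * cnj (of_real s * cis x)) = Im (of_real s * cis (t - x))"
      by (simp only: complex_cnj_mult complex_cnj_complex_of_real cis_cnj mult.left_commute[of "cis t"] cis_mult)
    also have "\<dots> = s * sin (t - x)" by simp
    finally have "Im (cis t * cnj (of_real s * cis x)) = s * sin (t - x)" .
    moreover have "\<bar>Im (cis t * cnj ?\<delta>)\<bar> \<le> r"
      by (rule order_trans[OF abs_Im_le_cmod]) (use \<delta> in \<open>simp add: norm_mult del: complex_cnj_diff\<close>)
    ultimately show "0 < Im (cis (\<Theta> e) * ?d * cnj (?q - z (src G e)))"
      unfolding y dd using sin1 by (simp add: distrib_left del: complex_cnj_diff)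
    have "norm (?q - z (src G e)) \<le> s + r" unfolding y
      by (rule order_trans[OF norm_triangle_ineq]) (use \<delta> s in \<open>simp add: norm_mult\<close>)
    then show "2 * norm (?q - z (src G e)) < sin (\<Theta> e) * min (R (lface G e)) (R (rface G e))"
      using small by (auto simp: min_def)
  qed
  then show ?thesis unfolding developed_triangle_def
    using w_lface[of e] w_rface[of e] dir_rho[of e] by simp
qed

end

section \<open>Edges leaving a set of vertices and the dual loops they form\<close>

context disk_complex
begin

lemma nxt_face_len: "(nxt G ^^ face_len (lface G a)) a = a"
proof -
  let ?f = "lface G a"
  obtain m where m: "(nxt G ^^ m) (face_start ?f) = a" using nxt_transitive[of "face_start ?f" a] lface_face_start by metis
  have "(nxt G ^^ (face_len ?f + m)) (face_start ?f) = (nxt G ^^ (m + face_len ?f)) (face_start ?f)" by (simp add: add.commute)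
  then have "(nxt G ^^ face_len ?f) ((nxt G ^^ m) (face_start ?f)) = (nxt G ^^ m) ((nxt G ^^ face_len ?f) (face_start ?f))"
    by (simp only: funpow_add o_apply)
  then show ?thesis using m nxt_face_len_start by simp
qed

lemma bij_nxt_walk: "bij_betw (\<lambda>k. (nxt G ^^ k) a) {..<face_len (lface G a)} {d. lface G d = lface G a}"
proof -
  let ?n = "face_len (lface G a)" and ?F = "{d. lface G d = lface G a}"
  have im: "(\<lambda>k. (nxt G ^^ k) a) ` {..<?n} = ?F"
  proof (intro equalityI subsetI)
    fix d assume "d \<in> ?F"
    then obtain m where "(nxt G ^^ m) a = d" using nxt_transitive[of a d] by auto
    then have "(nxt G ^^ (m mod ?n)) a = d" using funpow_mod_eq[OF nxt_face_len] by simp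
    then show "d \<in> (\<lambda>k. (nxt G ^^ k) a) ` {..<?n}" using face_len_pos by (intro image_eqI[of _ _ "m mod ?n"]) auto
  qed auto
  have "card ?F = ?n" using bij_betw_same_card[OF bij_face_walk[of "lface G a"]] by simp
  then have "card ((\<lambda>k. (nxt G ^^ k) a) ` {..<?n}) = card {..<?n}" using im by simp
  then have "inj_on (\<lambda>k. (nxt G ^^ k) a) {..<?n}" by (intro eq_card_imp_inj_on) auto
  then show ?thesis using im by (simp add: bij_betw_def)
qed

definition exits :: "('v \<Rightarrow> bool) \<Rightarrow> 'e \<Rightarrow> bool" where
  "exits near e \<longleftrightarrow> near (src G e) \<and> \<not> near (trg G e)"

text \<open>Starting with an edge that leaves the set of the near vertices, \<open>exit_step\<close> follows the boundary of its right
  face back to the near vertices up to the next edge leaving them.\<close>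

definition exit_count :: "('v \<Rightarrow> bool) \<Rightarrow> 'e \<Rightarrow> nat" where
  "exit_count near e = (LEAST m. m \<ge> 1 \<and> \<not> near (trg G ((nxt G ^^ m) (rv G e))))"

definition exit_step :: "('v \<Rightarrow> bool) \<Rightarrow> 'e \<Rightarrow> 'e" where
  "exit_step near e = (nxt G ^^ exit_count near e) (rv G e)"

context
  fixes near :: "'v \<Rightarrow> bool" and e :: 'e
  assumes ex: "exits near e"
begin

text \<open>The boundary walk of the right face returns to \<open>rv G e\<close>, and the edge just
  before it ends at \<open>trg G e\<close>, which is not near. So the near vertices are left before
  the walk closes up.\<close>

lemma exit_count_bound: "exit_count near e \<ge> 1 \<and> \<not> near (trg G (exit_step near e)) \<and> exit_count near e < face_len (rface G e)"
proof -
  obtain n where n: "face_len (rface G e) = Suc n" using face_len_pos[of "rface G e"] by (cases "face_len (rface G e)") auto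
  have per: "nxt G ((nxt G ^^ n) (rv G e)) = rv G e" using nxt_face_len[of "rv G e"] n by simp
  then have "trg G ((nxt G ^^ n) (rv G e)) = trg G e" by (metis src_nxt src_rv)
  then have far: "\<not> near (trg G ((nxt G ^^ n) (rv G e)))" using ex by (simp add: exits_def)
  have "n \<noteq> 0"
  proof
    assume "n = 0"
    then show False using far ex by (simp add: exits_def)
  qed
  then have n1: "n \<ge> 1 \<and> \<not> near (trg G ((nxt G ^^ n) (rv G e)))" using far by simp
  have "exit_count near e \<ge> 1 \<and> \<not> near (trg G ((nxt G ^^ exit_count near e) (rv G e)))"
    unfolding exit_count_def using n1 by (rule LeastI)
  moreover have "exit_count near e \<le> n" unfolding exit_count_def using n1 by (rule Least_le)
  ultimately show ?thesis using n by (simp add: exit_step_def)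
qed

lemma near_trg_before_exit: "j < exit_count near e \<Longrightarrow> near (trg G ((nxt G ^^ j) (rv G e)))"
proof (cases "j = 0")
  case True
  then show ?thesis using ex by (simp add: exits_def)
next
  case False
  assume "j < exit_count near e"
  then have "\<not> (j \<ge> 1 \<and> \<not> near (trg G ((nxt G ^^ j) (rv G e))))"
    unfolding exit_count_def by (rule not_less_Least)
  then show ?thesis using False by simp
qed

lemma near_src_before_exit: "1 \<le> j \<Longrightarrow> j \<le> exit_count near e \<Longrightarrow> near (src G ((nxt G ^^ j) (rv G e)))"
  using near_trg_before_exit[of "j - 1"] by (cases j) auto

lemma exits_exit_step: "exits near (exit_step near e)"
  using near_src_before_exit[of "exit_count near e"] exit_count_bound
  by (simp add: exits_def) (simp add: exit_step_def)

lemma lface_exit_step: "lface G (exit_step near e) = rface G e"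
  by (simp add: exit_step_def)

end

text \<open>The step can be undone: going back along the face from the exit reached, the first edge
  that does not start at a near vertex is the reversal of the previous exit.\<close>

lemma exit_step_inj:
  assumes "exits near a" "exits near b" "exit_step near a = exit_step near b"
  shows "a = b"
proof -
  have *: "a = b" if ex: "exits near a" "exits near b" and eq: "exit_step near a = exit_step near b"
    and le: "exit_count near a \<le> exit_count near b" for a b
  proof -
    let ?m = "exit_count near a" and ?d = "exit_count near b - exit_count near a"
    have "(nxt G ^^ ?m) (rv G a) = (nxt G ^^ (?m + ?d)) (rv G b)" using eq le by (simp add: exit_step_def)
    then have "(nxt G ^^ ?m) (rv G a) = (nxt G ^^ ?m) ((nxt G ^^ ?d) (rv G b))" by (simp only: funpow_add o_apply)
    then have eq': "rv G a = (nxt G ^^ ?d) (rv G b)" using inj_fn[OF inj_nxt] injD by metis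
    have "?d = 0"
    proof (rule ccontr)
      assume "?d \<noteq> 0"
      then have "near (src G (rv G a))" unfolding eq' by (intro near_src_before_exit[OF ex(2)]) auto
      then show False using ex(1) by (simp add: exits_def)
    qed
    then show ?thesis using eq' by (metis funpow_0 rv_rv)
  qed
  show ?thesis
  proof (cases "exit_count near a \<le> exit_count near b")
    case True
    then show ?thesis using * assms by blast
  next
    case False
    then show ?thesis using *[of b a] assms by simp
  qed
qed

text \<open>The dual loop crossing the edges of \<open>es\<close> is an integral cocycle on the graph; its primitive takes just two values.\<close>

lemma exit_loop_bounds:
  assumes ex: "\<And>e. e \<in> set es \<Longrightarrow> exits near e" and ne: "es \<noteq> []" and dist: "distinct es"
    and step: "\<And>k. k < length es \<Longrightarrow> es ! (Suc k mod length es) = exit_step near (es ! k)"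
  shows "\<exists>S. S \<noteq> {} \<and> - S \<noteq> {} \<and> {e. e \<in> set es \<or> rv G e \<in> set es} = {e. src G e \<in> S \<longleftrightarrow> trg G e \<notin> S}"
proof -
  have not_rv: "rv G e \<notin> set es" if "e \<in> set es" for e
    using ex[OF that] ex[of "rv G e"] by (auto simp: exits_def)
  have step_mem: "exit_step near e \<in> set es" if e: "e \<in> set es" for e
  proof -
    obtain k where "k < length es" "e = es ! k" using e by (metis in_set_conv_nth)
    then have "exit_step near e = es ! (Suc k mod length es)" using step by simp
    then show ?thesis using ne by simp
  qed
  have step_inj: "inj_on (exit_step near) (set es)"
    by (rule inj_onI) (use exit_step_inj ex in blast)
  have step_im: "exit_step near ` set es = set es"
    by (rule endo_inj_surj[OF _ _ step_inj]) (use step_mem in auto)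
  define c :: "'e \<Rightarrow> real" where "c e = (if e \<in> set es then 1 else if rv G e \<in> set es then - 1 else 0)" for e
  have "\<exists>v. \<forall>e. v (trg G e) - v (src G e) = c e"
  proof (rule cocycle_exact)
    show "c (rv G e) = - c e" for e using not_rv by (auto simp: c_def)
    fix f
    let ?F = "{e. lface G e = f}"
    \<comment> \<open>\<open>exit_step\<close> permutes \<open>es\<close> and carries the edges with
      \<open>f\<close> on the right to those with \<open>f\<close> on the left, so the loop enters
      each face as often as it leaves it.\<close>
    have "(\<Sum>e\<in>?F. c e) = (\<Sum>e\<in>?F. (if e \<in> set es then 1 else 0) - (if rv G e \<in> set es then 1 else 0))"
      by (rule sum.cong[OF refl]) (use not_rv in \<open>auto simp: c_def\<close>)
    also have "\<dots> = real (card (?F \<inter> set es)) - real (card {e\<in>?F. rv G e \<in> set es})"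
      using finite_lface by (simp add: sum_subtractf sum.If_cases Int_def)
    also have "card {e\<in>?F. rv G e \<in> set es} = card {d\<in>set es. rface G d = f}"
      by (rule bij_betw_same_card[of "rv G"], rule bij_betw_byWitness[where f' = "rv G"]) auto
    also have "\<dots> = card (?F \<inter> set es)"
    proof (rule bij_betw_same_card[of "exit_step near"])
      have "exit_step near ` {d\<in>set es. rface G d = f} = ?F \<inter> set es"
      proof (intro equalityI subsetI)
        fix d assume d: "d \<in> ?F \<inter> set es"
        then obtain e where e: "e \<in> set es" "d = exit_step near e" using step_im by blast
        then have "rface G e = f" using d lface_exit_step[OF ex[OF e(1)]] by simp
        then show "d \<in> exit_step near ` {d\<in>set es. rface G d = f}" using e by blast
      qed (use step_mem lface_exit_step ex in auto)
      then show "bij_betw (exit_step near) {d\<in>set es. rface G d = f} (?F \<inter> set es)"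
        using inj_on_subset[OF step_inj] by (auto simp: bij_betw_def)
    qed
    finally show "(\<Sum>e\<in>?F. c e) = 0" by simp
  qed
  then obtain v where v: "\<And>e. v (trg G e) - v (src G e) = c e" by blast
  define e0 where "e0 = es ! 0"
  have e0: "e0 \<in> set es" using ne by (simp add: e0_def)
  \<comment> \<open>Between two consecutive exits the walk runs through near vertices only. Its
    edges are not crossed by the loop, so \<open>v\<close> stays constant there, and all exits start
    in the same level set of \<open>v\<close>.\<close>
  have src_step: "v (src G (exit_step near e)) = v (src G e)" if e: "e \<in> set es" for e
  proof -
    note exe = ex[OF e]
    have "v (src G ((nxt G ^^ j) (rv G e))) = v (src G e)" if "1 \<le> j" "j \<le> exit_count near e" for j
      using that
    proof (induction j)
      case (Suc j)
      show ?case
      proof (cases "j = 0")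
        case True
        then show ?thesis by simp
      next
        case False
        let ?d = "(nxt G ^^ j) (rv G e)"
        have "near (src G ?d)" "near (trg G ?d)"
          using near_src_before_exit[OF exe, of j] near_trg_before_exit[OF exe, of j] False Suc.prems by auto
        then have "?d \<notin> set es" "rv G ?d \<notin> set es" using ex[of ?d] ex[of "rv G ?d"] by (auto simp: exits_def)
        then have "v (trg G ?d) = v (src G ?d)" using v[of ?d] by (simp add: c_def)
        then show ?thesis using Suc False by simp
      qed
    qed simp
    then show ?thesis using exit_count_bound[OF exe] by (simp add: exit_step_def)
  qed
  have src_const: "v (src G e) = v (src G e0)" if "e \<in> set es" for e
  proof -
    have "v (src G (es ! k)) = v (src G e0)" if "k < length es" for k
      using that
    proof (induction k)
      case (Suc k)
      then have "es ! Suc k = exit_step near (es ! k)" using step[of k] by simp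
      then show ?case using Suc src_step[of "es ! k"] by simp
    qed (simp add: e0_def)
    then show ?thesis using that by (metis in_set_conv_nth)
  qed
  define S where "S = {x. v x = v (src G e0)}"
  have cross: "src G e \<in> S \<and> trg G e \<notin> S" if e: "e \<in> set es" for e
    using v[of e] src_const[OF e] e by (simp add: S_def c_def)
  have "e \<in> set es \<or> rv G e \<in> set es \<longleftrightarrow> (src G e \<in> S \<longleftrightarrow> trg G e \<notin> S)" for e
  proof (cases "e \<in> set es \<or> rv G e \<in> set es")
    case True
    then show ?thesis using cross[of e] cross[of "rv G e"] by auto
  next
    case False
    then have "v (trg G e) = v (src G e)" using v[of e] by (simp add: c_def)
    then show ?thesis using False by (simp add: S_def)
  qed
  moreover have "src G e0 \<in> S" "trg G e0 \<in> - S" using cross[OF e0] by auto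
  ultimately show ?thesis by (intro exI[of _ S]) blast
qed

lemma component_avoiding_refl: "x \<in> component_avoiding G K x"
  by (simp add: component_avoiding_def)

lemma component_avoiding_step:
  "src G e \<in> component_avoiding G K x \<Longrightarrow> src G e \<notin> K \<Longrightarrow> trg G e \<notin> K \<Longrightarrow> trg G e \<in> component_avoiding G K x"
  unfolding component_avoiding_def by (auto intro: rtrancl_into_rtrancl)

end

section \<open>Finite cuts of a one-ended graph and balls of faces\<close>

context bounded_disk_complex
begin

text \<open>Without the end points of the edges of the cut, every component lies on one side, and
  only one component is infinite. The side \<open>D\<close> missing it is covered by
  \<open>K\<close> and finite components. These are finitely many, since the graph is connected and
  each one used contains a neighbour of \<open>K\<close>.\<close>

lemma finite_side:
  assumes one: "one_ended G" and ES: "finite ES"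
    and cross: "\<And>e. (src G e \<in> S \<longleftrightarrow> trg G e \<notin> S) \<Longrightarrow> e \<in> ES"
  shows "finite S \<or> finite (- S)"
proof -
  fix x0 :: 'v
  \<comment> \<open>\<open>x0\<close> is put into \<open>K\<close> so that walks from
    \<open>x0\<close> to a vertex outside \<open>K\<close> pass through a neighbour of
    \<open>K\<close>.\<close>
  define K where "K = insert x0 (src G ` ES \<union> trg G ` ES)"
  have K: "finite K" using ES by (simp add: K_def)
  have inside: "component_avoiding G K x \<subseteq> D" if D: "D = S \<or> D = - S" and x: "x \<in> D" for x D
  proof
    fix y assume "y \<in> component_avoiding G K x"
    then have "(x, y) \<in> {(src G e, trg G e) | e. src G e \<notin> K \<and> trg G e \<notin> K}\<^sup>*"
      by (simp add: component_avoiding_def)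
    then show "y \<in> D"
    proof (induction rule: rtrancl_induct)
      case (step y z)
      then obtain e where e: "y = src G e" "z = trg G e" "src G e \<notin> K" by blast
      then have "e \<notin> ES" by (auto simp: K_def)
      then have "\<not> (src G e \<in> S \<longleftrightarrow> trg G e \<notin> S)" using cross by blast
      then show ?case using step.IH e D by auto
    qed (use x in simp)
  qed
  define Cs where "Cs = component_avoiding G K ` (- K)"
  have "\<exists>!C. C \<in> Cs \<and> infinite C"
    using one K unfolding one_ended_def Cs_def by simp
  then obtain C where C: "C \<in> Cs" "infinite C" and uniq: "\<And>C'. C' \<in> Cs \<Longrightarrow> infinite C' \<Longrightarrow> C' = C" by blast
  obtain x1 where x1: "C = component_avoiding G K x1" using C(1) unfolding Cs_def by (elim imageE)
  obtain D where D: "D = S \<or> D = - S" "D \<inter> C = {}"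
  proof (cases "x1 \<in> S")
    case True
    then show ?thesis using that[of "- S"] inside[of S x1] x1 by blast
  next
    case False
    then show ?thesis using that[of S] inside[of "- S" x1] x1 by blast
  qed
  define N where "N = trg G ` (\<Union>k\<in>K. {e. src G e = k})"
  have "finite N" unfolding N_def using K finite_src by auto
  have reach: "y \<in> K \<or> (\<exists>x\<in>N. x \<notin> K \<and> y \<in> component_avoiding G K x)" for y
    using graph_connected[of x0 y]
  proof (induction rule: rtrancl_induct)
    case base
    then show ?case by (simp add: K_def)
  next
    case (step y z)
    then obtain e where e: "y = src G e" "z = trg G e" by blast
    show ?case
    proof (cases "z \<in> K \<or> y \<in> K")
      case True
      moreover have "y \<in> K \<Longrightarrow> z \<in> N" using e by (auto simp: N_def)
      ultimately show ?thesis using component_avoiding_refl by blast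
    next
      case False
      then obtain x where "x \<in> N" "x \<notin> K" "y \<in> component_avoiding G K x" using step.IH by blast
      then show ?thesis using component_avoiding_step[of e K x] e False by blast
    qed
  qed
  have "D \<subseteq> K \<union> (\<Union>x\<in>{x\<in>N. x \<notin> K \<and> finite (component_avoiding G K x)}. component_avoiding G K x)"
  proof
    fix y assume y: "y \<in> D"
    show "y \<in> K \<union> (\<Union>x\<in>{x\<in>N. x \<notin> K \<and> finite (component_avoiding G K x)}. component_avoiding G K x)"
    proof (cases "y \<in> K")
      case False
      then obtain x where x: "x \<in> N" "x \<notin> K" "y \<in> component_avoiding G K x" using reach by blast
      have "finite (component_avoiding G K x)"
      proof (rule ccontr)
        assume "infinite (component_avoiding G K x)"
        then have "component_avoiding G K x = C" using uniq[of "component_avoiding G K x"] x(2) by (simp add: Cs_def)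
        then show False using x(3) y D(2) by blast
      qed
      then show ?thesis using x by blast
    qed simp
  qed
  then have "finite D" by (rule finite_subset) (use K \<open>finite N\<close> in auto)
  then show ?thesis using D(1) by blast
qed

primrec dual_ball :: "nat \<Rightarrow> 'f \<Rightarrow> 'f set" where
  "dual_ball 0 f = {f}"
| "dual_ball (Suc n) f = dual_ball n f \<union> rface G ` (\<Union>f'\<in>dual_ball n f. {e. lface G e = f'})"

lemma dual_ball_mono: "m \<le> n \<Longrightarrow> dual_ball m f \<subseteq> dual_ball n f"
  by (induction n rule: dec_induct) auto

lemma dual_ball_finite_card:
  assumes M: "\<And>f. card {e. lface G e = f} \<le> M"
  shows "finite (dual_ball n f) \<and> card (dual_ball n f) \<le> (M + 1) ^ n"
proof (induction n)
  case (Suc n)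
  let ?B = "dual_ball n f"
  have fin: "finite (\<Union>f'\<in>?B. {e. lface G e = f'})" using Suc finite_lface by blast
  have "card (dual_ball (Suc n) f) \<le> card ?B + card (rface G ` (\<Union>f'\<in>?B. {e. lface G e = f'}))"
    by (simp add: card_Un_le)
  also have "card (rface G ` (\<Union>f'\<in>?B. {e. lface G e = f'})) \<le> card (\<Union>f'\<in>?B. {e. lface G e = f'})"
    by (rule card_image_le[OF fin])
  also have "\<dots> \<le> (\<Sum>f'\<in>?B. card {e. lface G e = f'})" using Suc by (intro card_UN_le) simp
  also have "\<dots> \<le> card ?B * M" using sum_bounded_above[of ?B "\<lambda>f'. card {e. lface G e = f'}" M] M by simp
  also have "card ?B + card ?B * M = card ?B * (M + 1)" by simp
  also have "\<dots> \<le> (M + 1) ^ n * (M + 1)" using Suc by (intro mult_right_mono) auto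
  finally show ?case using Suc fin by (simp add: mult.commute)
qed simp

end

lemma sin_ge_sin_of_mem:
  fixes x \<delta> :: real
  assumes "0 \<le> \<delta>" "\<delta> \<le> x" "x \<le> pi - \<delta>"
  shows "sin \<delta> \<le> sin x"
proof (cases "x \<le> pi / 2")
  case True
  then show ?thesis using assms by (intro sin_monotone_2pi_le) auto
next
  case False
  then have "sin \<delta> \<le> sin (pi - x)" using assms by (intro sin_monotone_2pi_le) auto
  then show ?thesis by simp
qed

section \<open>Turning around a cluster of vertices and the lower bound for half-angles\<close>

context developed_pattern
begin

text \<open>Half of the angle, seen from the centre of the right face, that is spanned by the near
  part of its boundary between two consecutive exits.\<close>

definition turn :: "('v \<Rightarrow> bool) \<Rightarrow> 'e \<Rightarrow> real" where
  "turn near e = (\<Sum>j\<in>{1..<exit_count near e}. \<alpha> ((nxt G ^^ j) (rv G e)))"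

lemma turn_nonneg: "turn near e \<ge> 0"
  unfolding turn_def by (intro sum_nonneg) (use alpha_bounds in \<open>auto intro: less_imp_le\<close>)

lemma dir_exit_step_rho:
  assumes "exits near e"
  shows "dir (exit_step near e) = dir (rho e) * cis (2 * turn near e)"
proof -
  have "dir ((nxt G ^^ Suc j) (rv G e)) = dir (rho e) * cis (2 * (\<Sum>i\<in>{1..<Suc j}. \<alpha> ((nxt G ^^ i) (rv G e))))" for j
  proof (induction j)
    case (Suc j)
    have "dir ((nxt G ^^ Suc (Suc j)) (rv G e)) = dir ((nxt G ^^ Suc j) (rv G e)) * cis (2 * \<alpha> ((nxt G ^^ Suc j) (rv G e)))"
      using dir_nxt[of "(nxt G ^^ Suc j) (rv G e)"] by simp
    also have "\<dots> = dir (rho e) * cis (2 * (\<Sum>i\<in>{1..<Suc j}. \<alpha> ((nxt G ^^ i) (rv G e))) + 2 * \<alpha> ((nxt G ^^ Suc j) (rv G e)))"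
      unfolding Suc.IH by (simp only: mult.assoc cis_mult)
    also have "2 * (\<Sum>i\<in>{1..<Suc j}. \<alpha> ((nxt G ^^ i) (rv G e))) + 2 * \<alpha> ((nxt G ^^ Suc j) (rv G e)) =
        2 * (\<Sum>i\<in>{1..<Suc (Suc j)}. \<alpha> ((nxt G ^^ i) (rv G e)))" by simp
    finally show ?case .
  qed simp
  from this[of "exit_count near e - 1"] show ?thesis
    using exit_count_bound[OF assms] by (simp add: exit_step_def turn_def)
qed

lemma dir_exit_step:
  assumes "exits near e" "dir e = cis t"
  shows "dir (exit_step near e) = cis (t - (\<Theta> e - 2 * turn near e))"
proof -
  have "cis (- \<Theta> e) * dir e = dir (rho e)"
    using dir_rho[of e] by (simp add: mult.assoc[symmetric] cis_mult)
  then have "dir (rho e) = cis (- \<Theta> e + t)" using assms(2) by (simp add: cis_mult)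
  then have "dir (exit_step near e) = cis (- \<Theta> e + t + 2 * turn near e)"
    using dir_exit_step_rho[OF assms(1)] by (simp only: cis_mult)
  then show ?thesis by (simp add: algebra_simps)
qed

text \<open>The length bound is the triangle inequality; an edge is a chord of both adjacent
  circles, hence at most as long as their diameters.\<close>

lemma long_edge_radius:
  assumes near: "norm (z (src G e) - p) \<le> r" and far: "K * r \<le> norm (z (trg G e) - p)"
  shows "(K - 1) * r \<le> norm (z (src G e) - z (trg G e))" "(K - 1) * r / 2 \<le> R (lface G e)" "(K - 1) * r / 2 \<le> R (rface G e)"
proof -
  have "norm (z (trg G e) - p) \<le> norm (z (src G e) - z (trg G e)) + norm (z (src G e) - p)"
    using norm_triangle_ineq4[of "z (src G e) - p" "z (src G e) - z (trg G e)"] by (simp add: norm_minus_commute)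
  then show len: "(K - 1) * r \<le> norm (z (src G e) - z (trg G e))" using near far by (simp add: algebra_simps)
  have "R f * sin x \<le> R f" for f x using R_pos[of f] by (simp add: mult_le_cancel_left2)
  from this[of "lface G e" "\<alpha> e"] this[of "rface G e" "\<alpha> (rv G e)"]
  show "(K - 1) * r / 2 \<le> R (lface G e)" "(K - 1) * r / 2 \<le> R (rface G e)"
    using len edge_length[of e] edge_length_rface[of e] by auto
qed

text \<open>The near part of the boundary has a chord of length at most \<open>2 * r\<close> in a
  circle of radius at least \<open>(K - 1) * r / 2\<close>, so the sine of the turn is at most
  \<open>2 / (K - 1)\<close>. The turn is not close to \<open>pi\<close> instead, because the long
  exit edge takes a share of the same circle: its half-angle is at most \<open>pi\<close> minus the
  turn. The final factor comes from \<open>sin_ge_half\<close>.\<close>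

lemma turn_bound:
  assumes near_def: "near = (\<lambda>v. norm (z v - p) \<le> r)" and r: "r > 0" and K: "K > 3"
    and ex: "exits near e" and far: "K * r \<le> norm (z (trg G e) - p)"
  shows "turn near e \<le> 4 / (K - 1)"
proof -
  let ?m = "exit_count near e" and ?f = "rface G e" and ?T = "turn near e"
  let ?a = "\<lambda>j. (nxt G ^^ j) (rv G e)"
  have Rf: "R ?f > 0" by (rule R_pos)
  have nr: "norm (z (src G e) - p) \<le> r" using ex near_def by (simp add: exits_def)
  note len = long_edge_radius[OF nr far]
  have m: "1 \<le> ?m" "?m < face_len ?f" using exit_count_bound[OF ex] by auto
  have "(\<Sum>j\<in>{..?m}. \<alpha> (?a j)) \<le> (\<Sum>j<face_len ?f. \<alpha> (?a j))"
    by (rule sum_mono2) (use m alpha_bounds in \<open>auto intro: less_imp_le\<close>)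
  also have "\<dots> = pi"
    using sum.reindex_bij_betw[OF bij_nxt_walk[of "rv G e"], of \<alpha>] alpha_sum[of ?f] by simp
  finally have "(\<Sum>j\<in>{..?m}. \<alpha> (?a j)) \<le> pi" .
  moreover have "{..?m} = insert 0 (insert ?m {1..<?m})" using m by auto
  ultimately have sum: "\<alpha> (rv G e) + \<alpha> (?a ?m) + ?T \<le> pi" using m by (simp add: turn_def)
  then have T: "0 \<le> ?T" "?T < pi" "\<alpha> (rv G e) \<le> pi - ?T"
    using alpha_bounds[of "rv G e"] alpha_bounds[of "?a ?m"] turn_nonneg by auto
  have "norm (z (src G (rho e)) - z (src G (exit_step near e))) = 2 * R (lface G (rho e)) * \<bar>sin ?T\<bar>"
    by (rule vertex_distance[OF dir_exit_step_rho[OF ex]]) (simp add: lface_exit_step[OF ex])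
  then have "2 * R ?f * \<bar>sin ?T\<bar> = norm (z (src G e) - z (src G (exit_step near e)))" by simp
  also have "\<dots> \<le> norm (z (src G e) - p) + norm (z (src G (exit_step near e)) - p)"
    using norm_triangle_ineq4[of "z (src G e) - p" "z (src G (exit_step near e)) - p"] by simp
  also have "\<dots> \<le> r + r"
    using nr exits_exit_step[OF ex] near_def by (intro add_mono) (simp_all add: exits_def)
  finally have sT: "R ?f * sin ?T \<le> r" using T by (simp add: sin_ge_zero)
  have long: "(K - 1) * r \<le> 2 * R ?f * sin (\<alpha> (rv G e))" using len(1) edge_length_rface[of e] by simp
  have half: "?T \<le> pi / 2"
  proof (rule ccontr)
    assume "\<not> ?T \<le> pi / 2"
    then have "sin (\<alpha> (rv G e)) \<le> sin (pi - ?T)"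
      using T alpha_bounds[of "rv G e"] by (intro sin_monotone_2pi_le) auto
    then have "R ?f * sin (\<alpha> (rv G e)) \<le> R ?f * sin ?T" using Rf by simp
    then have "(K - 1) * r \<le> 2 * r" using long sT by linarith
    then show False using K r by simp
  qed
  have "(K - 1) * r / 2 * sin ?T \<le> R ?f * sin ?T"
    using len(3) T by (intro mult_right_mono sin_ge_zero) auto
  then have "(K - 1) * sin ?T * r \<le> 2 * r" using sT by (simp add: algebra_simps)
  then have "(K - 1) * sin ?T \<le> 2" using r by simp
  moreover have "(K - 1) * (?T / 2) \<le> (K - 1) * sin ?T"
    using sin_ge_half[OF T(1) half] K by (intro mult_left_mono) auto
  ultimately have "(K - 1) * ?T \<le> 4" by simp
  then show ?thesis using K by (simp add: field_simps)
qed

text \<open>A short edge of a large face cannot have a gap in the scales of the vertices around it: the boundary of the cluster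
  of vertices near it would be crossed by few long edges whose angles add up to only slightly more than \<open>2 * pi\<close>.\<close>

lemma no_isolated_cluster:
  fixes p :: complex and r K :: real and N :: nat
  defines "near \<equiv> \<lambda>v. norm (z v - p) \<le> r"
  assumes r: "r > 0"
    and N: "2 * pi + \<epsilon>\<^sub>0 \<le> real N * (\<epsilon>\<^sub>0 / 2)"
    and K: "K > 3" "4 / (K - 1) \<le> \<epsilon>\<^sub>0 / (4 * real N)" "4 * (2 / sin (\<epsilon>\<^sub>0 / 4) + 1) < (K - 1) * sin \<epsilon>\<^sub>0"
    and g0: "near (src G g0)" "near (trg G g0)" and far: "\<exists>a. lface G a = lface G g0 \<and> \<not> near (src G a)"
    and gap: "\<And>e. lface G e \<in> dual_ball N (lface G g0) \<Longrightarrow> near (src G e) \<or> K * r \<le> norm (z (src G e) - p)"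
  shows False
proof -
  let ?\<phi> = "lface G g0"
  have near_def': "near = (\<lambda>v. norm (z v - p) \<le> r)" by (simp add: near_def)
  have N0: "N > 0"
  proof (rule ccontr)
    assume "\<not> N > 0"
    then have "2 * pi + \<epsilon>\<^sub>0 \<le> 0" using N by simp
    then show False using eps pi_gt_zero by linarith
  qed
  \<comment> \<open>Going back from \<open>g0\<close> along its left face to the last far vertex
    yields an edge from a far to a near vertex. Its reversal is an exit whose turn contains the
    half-angle of \<open>g0\<close>; this will make the total turn strictly positive.\<close>
  obtain e0 where e0: "exits near e0" "rface G e0 = ?\<phi>" "turn near e0 > 0"
  proof -
    obtain a where a: "lface G a = ?\<phi>" "\<not> near (src G a)" using far by blast
    obtain q where q: "(nxt G ^^ q) a = g0" using nxt_transitive[OF a(1)] by blast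
    define I where "I = {i. i \<le> q \<and> \<not> near (src G ((nxt G ^^ i) a))}"
    have I: "finite I" "0 \<in> I" using a(2) by (auto simp: I_def)
    define i where "i = Max I"
    have iI: "i \<in> I" unfolding i_def using I by (intro Max_in) auto
    have "q \<notin> I" using q g0(1) by (simp add: I_def)
    then have iq: "i < q" using iI by (cases "i = q") (auto simp: I_def)
    have after: "near (src G ((nxt G ^^ j) a))" if "i < j" "j \<le> q" for j
    proof (rule ccontr)
      assume "\<not> near (src G ((nxt G ^^ j) a))"
      then have "j \<in> I" using that by (simp add: I_def)
      then show False using Max_ge[OF I(1)] that(1) unfolding i_def by fastforce
    qed
    define h where "h = (nxt G ^^ i) a"
    have hpow: "(nxt G ^^ j) h = (nxt G ^^ (j + i)) a" for j by (simp add: h_def funpow_add)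
    have src_h: "\<not> near (src G h)" using iI by (simp add: I_def h_def)
    have trg_near: "near (trg G ((nxt G ^^ j) h))" if "j \<le> q - i" for j
    proof (cases "j = q - i")
      case True
      then show ?thesis using iq q g0(2) by (simp add: hpow)
    next
      case False
      then have "near (src G ((nxt G ^^ (Suc j + i)) a))" using that iq by (intro after) auto
      then show ?thesis by (simp add: hpow)
    qed
    have ex: "exits near (rv G h)" using src_h trg_near[of 0] by (simp add: exits_def)
    have "q - i < exit_count near (rv G h)"
    proof (rule ccontr)
      assume "\<not> q - i < exit_count near (rv G h)"
      then have "near (trg G (exit_step near (rv G h)))" using trg_near by (simp add: exit_step_def)
      then show False using exit_count_bound[OF ex] by simp
    qed
    then have "q - i \<in> {1..<exit_count near (rv G h)}" using iq by simp
    then have "\<alpha> ((nxt G ^^ (q - i)) (rv G (rv G h))) \<le> turn near (rv G h)"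
      unfolding turn_def by (rule member_le_sum) (use alpha_bounds in \<open>auto intro: less_imp_le\<close>)
    then have "turn near (rv G h) > 0" using alpha_bounds[of "(nxt G ^^ (q - i)) h"] by simp
    moreover have "rface G (rv G h) = ?\<phi>" using a(1) by (simp add: h_def)
    ultimately show thesis using that ex by blast
  qed
  define ee where "ee k = (exit_step near ^^ k) e0" for k
  have ee_Suc: "ee (Suc k) = exit_step near (ee k)" and ee0: "ee 0 = e0" for k by (simp_all add: ee_def)
  have ex: "exits near (ee k)" for k
    by (induction k) (simp_all add: ee0 e0 ee_Suc exits_exit_step)
  \<comment> \<open>Each step moves to an adjacent face, so the gap in the scales, assumed on a ball
    of radius \<open>N\<close>, is available for exits number 0 to \<open>N\<close>.\<close>
  have rf: "rface G (ee k) \<in> dual_ball k ?\<phi>" for k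
  proof (induction k)
    case (Suc k)
    have "lface G (ee (Suc k)) = rface G (ee k)" using lface_exit_step[OF ex] by (simp add: ee_Suc)
    then show ?case using Suc by auto
  qed (simp add: ee0 e0)
  have far_ee: "K * r \<le> norm (z (trg G (ee k)) - p)" if "k \<le> N" for k
  proof -
    have "lface G (rv G (ee k)) \<in> dual_ball N ?\<phi>" using rf[of k] dual_ball_mono[OF that] by auto
    from gap[OF this] show ?thesis using ex[of k] by (simp add: exits_def)
  qed
  define \<eta> where "\<eta> = \<epsilon>\<^sub>0 / (4 * real N)"
  have turn: "turn near (ee k) \<le> \<eta>" if "k \<le> N" for k
    using turn_bound[OF near_def' r K(1) ex far_ee[OF that]] K(2) by (simp add: \<eta>_def)
  have \<eta>: "2 * \<eta> \<le> \<epsilon>\<^sub>0 / 2" "2 * real N * \<eta> \<le> \<epsilon>\<^sub>0"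
    using N0 eps by (simp_all add: \<eta>_def field_simps)
  have "dir e0 \<noteq> 0" using norm_dir[of e0] by auto
  then have "dir e0 = cis (Arg (dir e0))" using norm_dir[of e0] by (simp add: cis_Arg sgn_div_norm)
  then obtain t0 where t0: "dir e0 = cis t0" by blast
  \<comment> \<open>Arguments of the exit directions, lifted to the real line so that full turns are
    counted. Each step up to \<open>N\<close> lowers them by at least
    \<open>\<epsilon>\<^sub>0 / 2\<close>.\<close>
  define t where "t k = t0 - (\<Sum>j<k. \<Theta> (ee j) - 2 * turn near (ee j))" for k
  have t_Suc: "t (Suc k) = t k - (\<Theta> (ee k) - 2 * turn near (ee k))" for k by (simp add: t_def)
  have t_0: "t 0 = t0" by (simp add: t_def)
  have dir_ee: "dir (ee k) = cis (t k)" for k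
    by (induction k) (simp_all add: ee0 t_0 t0 ee_Suc t_Suc dir_exit_step[OF ex])
  have decr: "t (Suc k) \<le> t k - \<epsilon>\<^sub>0 / 2" if "k \<le> N" for k
    using turn[OF that] \<eta>(1) Theta_bounds(1)[of "ee k"] by (simp add: t_Suc)
  have lower: "t k - \<Theta> (ee k) \<le> t (Suc k)" for k
    using turn_nonneg[of near "ee k"] by (simp add: t_Suc)
  have t_le: "t k \<le> t0 - real k * (\<epsilon>\<^sub>0 / 2)" if "k \<le> N" for k
    using that
  proof (induction k)
    case (Suc k)
    have "real (Suc k) * (\<epsilon>\<^sub>0 / 2) = real k * (\<epsilon>\<^sub>0 / 2) + \<epsilon>\<^sub>0 / 2" by (simp add: field_simps)
    then show ?case using Suc decr[of k] by linarith
  qed (simp add: t_0)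
  have t_mono: "t b < t a" if "a < b" "b \<le> N" for a b
    using that
  proof (induction b)
    case (Suc b)
    have "t (Suc b) < t b" using decr[of b] Suc.prems eps by simp
    then show ?case using Suc by (cases "a = b") auto
  qed simp
  \<comment> \<open>The level at depth \<open>\<epsilon>\<^sub>0 / 2\<close> inside the sector of
    \<open>e0\<close> turned back by \<open>2 * pi\<close>, whose width exceeds
    \<open>\<epsilon>\<^sub>0\<close>. The first exit whose successor lies below
    \<open>\<tau>\<close> has a sector overlapping this one by an angle of at least
    \<open>\<epsilon>\<^sub>0 / 2\<close>; the middle \<open>x\<close> of the overlap keeps a margin
    of \<open>\<epsilon>\<^sub>0 / 4\<close> from all sides.\<close>
  define \<tau> where "\<tau> = t0 - 2 * pi - \<epsilon>\<^sub>0 / 2"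
  obtain N' where N': "N = Suc N'" using N0 by (cases N) auto
  have tN: "t (Suc N') < \<tau>" using t_le[of N] N eps by (simp add: \<tau>_def N')
  define n where "n = (LEAST n. t (Suc n) < \<tau>)"
  have n: "t (Suc n) < \<tau>" unfolding n_def using tN by (rule LeastI)
  have nN: "n < N" using Least_le[of "\<lambda>n. t (Suc n) < \<tau>", OF tN] by (simp add: n_def N')
  have tn: "\<tau> \<le> t n"
  proof (cases n)
    case 0
    then have "t n = t0" using t_0 by simp
    then show ?thesis using eps pi_gt_zero unfolding \<tau>_def by linarith
  next
    case (Suc m)
    then have "\<not> t (Suc m) < \<tau>" unfolding n_def by (intro not_less_Least) simp
    then show ?thesis using Suc by simp
  qed
  define lo where "lo = max (t n - \<Theta> (ee n)) (\<tau> - \<epsilon>\<^sub>0 / 2)"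
  define hi where "hi = min (t n) (\<tau> + \<epsilon>\<^sub>0 / 2)"
  have "lo + \<epsilon>\<^sub>0 / 2 \<le> hi"
    using Theta_bounds(1)[of "ee n"] tn n lower[of n] eps unfolding lo_def hi_def by linarith
  moreover define x where "x = (lo + hi) / 2"
  ultimately have x: "lo + \<epsilon>\<^sub>0 / 4 \<le> x" "x \<le> hi - \<epsilon>\<^sub>0 / 4" by simp_all
  have xn: "\<epsilon>\<^sub>0 / 4 \<le> t n - x" "t n - x \<le> \<Theta> (ee n) - \<epsilon>\<^sub>0 / 4" using x unfolding lo_def hi_def by linarith+
  have x0: "\<epsilon>\<^sub>0 / 4 \<le> t0 - 2 * pi - x" "t0 - 2 * pi - x \<le> \<Theta> e0 - \<epsilon>\<^sub>0 / 4"
    using x Theta_bounds(1)[of e0] unfolding lo_def hi_def \<tau>_def by linarith+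
  have s4: "sin (\<epsilon>\<^sub>0 / 4) > 0" using eps eps_lt by (intro sin_gt_zero) auto
  \<comment> \<open>Far enough from \<open>p\<close> for the margin
    \<open>\<epsilon>\<^sub>0 / 4\<close> to outweigh the size \<open>r\<close> of the cluster,
    while the third condition on \<open>K\<close> keeps \<open>s\<close> small compared with the
    radii of the faces at the exits.\<close>
  define s where "s = 2 * r / sin (\<epsilon>\<^sub>0 / 4)"
  have s0: "s \<ge> 0" using r s4 by (simp add: s_def)
  have s_sin: "r < s * sin y" if "\<epsilon>\<^sub>0 / 4 \<le> y" "y \<le> pi - \<epsilon>\<^sub>0 / 4" for y
  proof -
    have "s * sin (\<epsilon>\<^sub>0 / 4) \<le> s * sin y" using that eps s0 by (intro mult_left_mono sin_ge_sin_of_mem) auto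
    moreover have "s * sin (\<epsilon>\<^sub>0 / 4) = 2 * r" using s4 by (simp add: s_def)
    ultimately show ?thesis using r by simp
  qed
  have small: "2 * (s + r) < sin (\<Theta> e) * R (lface G e)" "2 * (s + r) < sin (\<Theta> e) * R (rface G e)"
    if e: "exits near e" "K * r \<le> norm (z (trg G e) - p)" for e
  proof -
    have "norm (z (src G e) - p) \<le> r" using e(1) by (simp add: exits_def near_def)
    note len = long_edge_radius[OF this e(2)]
    have "4 * (2 / sin (\<epsilon>\<^sub>0 / 4) + 1) * r < (K - 1) * sin \<epsilon>\<^sub>0 * r" using K(3) r by simp
    then have "2 * (s + r) < sin \<epsilon>\<^sub>0 * ((K - 1) * r / 2)" by (simp add: s_def algebra_simps)
    also have "\<dots> \<le> sin (\<Theta> e) * ((K - 1) * r / 2)"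
      using Theta_bounds[of e] eps K(1) r by (intro mult_right_mono sin_ge_sin_of_mem) auto
    finally have *: "2 * (s + r) < sin (\<Theta> e) * ((K - 1) * r / 2)" .
    have sp: "sin (\<Theta> e) \<ge> 0" using Theta_pos[of e] by (intro sin_ge_zero) auto
    show "2 * (s + r) < sin (\<Theta> e) * R (lface G e)" "2 * (s + r) < sin (\<Theta> e) * R (rface G e)"
      using * mult_left_mono[OF len(2) sp] mult_left_mono[OF len(3) sp] by linarith+
  qed
  have in_tri: "p + of_real s * cis x \<in> interior (developed_triangle G z w e)"
    if e: "exits near e" "K * r \<le> norm (z (trg G e) - p)" and d: "dir e = cis u"
      and ux: "\<epsilon>\<^sub>0 / 4 \<le> u - x" "u - x \<le> \<Theta> e - \<epsilon>\<^sub>0 / 4" for e u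
  proof (rule triangle_sector[OF d _ _ _ s_sin s_sin s0 small[OF e]])
    show "norm (z (src G e) - p) \<le> r" using e(1) by (simp add: exits_def near_def)
  qed (use ux eps Theta_bounds[of e] in linarith)+
  have "p + of_real s * cis x \<in> interior (developed_triangle G z w (ee n))"
    by (rule in_tri[OF ex far_ee dir_ee xn]) (use nN in simp)
  moreover have "p + of_real s * cis x \<in> interior (developed_triangle G z w e0)"
  proof (rule in_tri[OF e0(1) _ _ x0])
    show "K * r \<le> norm (z (trg G e0) - p)" using far_ee[of 0] by (simp add: ee0)
    have "cis (t0 - 2 * pi) = cis t0" by (simp add: cis_divide[symmetric])
    then show "dir e0 = cis (t0 - 2 * pi)" using t0 by simp
  qed
  \<comment> \<open>One point lies in the interior of both triangles, so they belong to the same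
    edge and the exits close up. Of the multiples of \<open>2 * pi\<close> by which the arguments
    may then differ, the bounds on \<open>t n\<close> leave exactly one full turn.\<close>
  ultimately have een: "ee n = e0" using disjoint[of "ee n" e0] by blast
  have period: "\<exists>m::int. t k = t0 + 2 * pi * of_int m" if "ee k = e0" for k
  proof -
    have "cis (t k) = cis t0" using dir_ee[of k] that t0 by simp
    then have "sin (t k) = sin t0 \<and> cos (t k) = cos t0" by (simp add: complex_eq_iff)
    then show ?thesis using sin_cos_eq_iff by auto
  qed
  have tn_eq: "t n = t0 - 2 * pi"
  proof -
    obtain m :: int where m: "t n = t0 + 2 * pi * of_int m" using period[OF een] by blast
    have "t n < t0 - pi" using n lower[of n] Theta_pos(2)[of "ee n"] eps unfolding \<tau>_def by linarith
    moreover have "t n > t0 - 4 * pi" using tn eps_lt pi_gt_zero unfolding \<tau>_def by linarith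
    ultimately have "pi * (2 * of_int m) < pi * (- 1)" "pi * (- 4) < pi * (2 * of_int m)" using m by auto
    then have "(2::real) * of_int m < - 1" "- 4 < (2::real) * of_int m"
      by (simp_all only: mult_less_cancel_left_pos pi_gt_zero)
    then have "m = -1" by linarith
    then show ?thesis using m by simp
  qed
  have n0: "n > 0"
  proof (rule ccontr)
    assume "\<not> n > 0"
    then show False using tn_eq t_0 by simp
  qed
  have sumeq: "(\<Sum>j<n. \<Theta> (ee j)) = 2 * pi + 2 * (\<Sum>j<n. turn near (ee j))"
    using tn_eq by (simp add: t_def sum_subtractf sum_distrib_left)
  define es where "es = map ee [0..<n]"
  have ee_cancel: "ee a = ee (a + d) \<Longrightarrow> e0 = ee d" for a d
  proof (induction a)
    case (Suc a)
    then have "ee a = ee (a + d)" using exit_step_inj[OF ex ex] by (simp add: ee_Suc)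
    then show ?case by (rule Suc.IH)
  qed (simp add: ee0)
  have ne: "ee a \<noteq> ee b" if "a < b" "b < n" for a b
  proof
    assume "ee a = ee b"
    then have "ee (b - a) = e0" using ee_cancel[of a "b - a"] that by simp
    then obtain m :: int where m: "t (b - a) = t0 + 2 * pi * of_int m" using period by blast
    have "t (b - a) < t0" using t_mono[of 0 "b - a"] that nN by (simp add: t_0)
    moreover have "t (b - a) > t0 - 2 * pi" using t_mono[of "b - a" n] that nN tn_eq by simp
    ultimately have "pi * of_int m < pi * 0" "pi * (- 1) < pi * of_int m" using m by auto
    then have "of_int m < (0::real)" "- 1 < (of_int m :: real)" by (simp_all only: mult_less_cancel_left_pos pi_gt_zero)
    then have "m < 0" "- 1 < m" using of_int_less_iff[of "- 1" m, where 'a = real] by simp_all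
    then show False by linarith
  qed
  have dist: "distinct es" unfolding es_def distinct_map
    by (simp, rule linorder_inj_onI) (use ne in auto)
  have step: "es ! (Suc k mod length es) = exit_step near (es ! k)" if k: "k < length es" for k
  proof (cases "Suc k < n")
    case True
    then show ?thesis by (simp add: es_def ee_Suc)
  next
    case False
    then have "Suc k = n" using k by (simp add: es_def)
    moreover have "es ! 0 = e0" using n0 by (simp add: es_def ee0)
    moreover have "es ! k = ee k" using k by (simp add: es_def)
    ultimately show ?thesis using een ee_Suc[of k] by (simp add: es_def)
  qed
  have ex_es: "exits near e" if "e \<in> set es" for e using that ex by (auto simp: es_def)
  have es0: "es \<noteq> []" using n0 by (simp add: es_def)
  obtain S where S: "S \<noteq> {}" "- S \<noteq> {}"
    "{e. e \<in> set es \<or> rv G e \<in> set es} = {e. src G e \<in> S \<longleftrightarrow> trg G e \<notin> S}"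
    using exit_loop_bounds[OF ex_es es0 dist step] by blast
  have "dual_loop G es" unfolding dual_loop_def
  proof (intro conjI ballI allI impI)
    fix e assume "e \<in> set es"
    then show "rv G e \<notin> set es" using ex_es[of e] ex_es[of "rv G e"] by (auto simp: exits_def)
  next
    fix k assume k: "k < length es"
    then have "exits near (es ! k)" using ex_es by simp
    then show "rface G (es ! k) = lface G (es ! (Suc k mod length es))"
      using step[OF k] lface_exit_step by simp
  qed (use es0 dist in auto)
  moreover have bnd: "bounds G es D" if "D = S \<or> D = - S" "finite D" for D
    unfolding bounds_def S(3) using that S(1,2) by auto
  moreover have "finite S \<or> finite (- S)"
  proof (rule finite_side[OF one_end])
    show "finite (set es \<union> rv G ` set es)" by simp
    fix e assume "src G e \<in> S \<longleftrightarrow> trg G e \<notin> S"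
    then have "e \<in> set es \<or> rv G e \<in> set es" using S(3) by blast
    then show "e \<in> set es \<union> rv G ` set es" by (metis UnCI image_eqI rv_rv)
  qed
  ultimately obtain D where D: "dual_loop G es" "bounds G es D" by blast
  have "finite D" "D \<noteq> {}" using D(2) by (simp_all add: bounds_def)
  then have "card D \<ge> 1" by (simp add: Suc_le_eq card_gt_0_iff)
  then have "card D = 1 \<or> card D > 1" by linarith
  moreover have sum_es: "(\<Sum>e\<leftarrow>es. \<Theta> e) = (\<Sum>j<n. \<Theta> (ee j))"
    by (simp add: es_def interv_sum_list_conv_sum_set_nat atLeast0LessThan o_def)
  moreover have "(\<Sum>j<n. turn near (ee j)) \<le> real n * \<eta>"
    using sum_bounded_above[of "{..<n}" "\<lambda>j. turn near (ee j)" \<eta>] turn nN by simp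
  moreover have "real n * \<eta> \<le> real N * \<eta>" using nN eps by (intro mult_right_mono) (auto simp: \<eta>_def)
  moreover have "turn near (ee 0) \<le> (\<Sum>j<n. turn near (ee j))"
    by (rule member_le_sum) (use n0 turn_nonneg in auto)
  \<comment> \<open>A loop around one vertex has angle sum exactly \<open>2 * pi\<close>, against
    the positive turn at \<open>e0\<close>; a loop around several vertices has more than
    \<open>2 * pi + \<epsilon>\<^sub>0\<close>, against the bound \<open>\<eta>\<close> on each of
    fewer than \<open>N\<close> turns.\<close>
  ultimately show False
    using angles D sumeq \<eta>(2) e0(3) unfolding admissible_angles_def ee0 by fastforce
qed

text \<open>Pigeonhole over scales: at most \<open>q\<close> vertices lie on faces of the dual ball,
  so one of the \<open>q + 1\<close> annuli between successive radii \<open>r0 * K ^ s\<close>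
  contains none of them. \<open>\<delta>\<close> is so small that even the last scale stays below
  the size of the circle, which therefore has a vertex outside the cluster.\<close>

lemma half_angles_bounded_below: "\<exists>\<delta>>0. \<forall>e. \<delta> \<le> \<alpha> e"
proof -
  obtain M where M: "\<And>f. card {e. lface G e = f} \<le> M"
    using bounded unfolding bounded_degrees_def by blast
  have Mpos: "M > 0"
  proof -
    fix f :: 'f
    have "card {e. lface G e = f} \<noteq> 0" using face_has_edge[of f] finite_lface by auto
    then show ?thesis using M[of f] by simp
  qed
  define N where "N = nat \<lceil>(2 * pi + \<epsilon>\<^sub>0) / (\<epsilon>\<^sub>0 / 2)\<rceil>"
  have "(2 * pi + \<epsilon>\<^sub>0) / (\<epsilon>\<^sub>0 / 2) \<le> real N" unfolding N_def by linarith
  then have N: "2 * pi + \<epsilon>\<^sub>0 \<le> real N * (\<epsilon>\<^sub>0 / 2)" using eps by (simp add: field_simps)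
  have "real N * (\<epsilon>\<^sub>0 / 2) > 0" using N eps pi_gt_zero by linarith
  then have Npos: "real N > 0" using eps by (simp add: zero_less_mult_iff)
  have sins: "sin (\<epsilon>\<^sub>0 / 4) > 0" "sin \<epsilon>\<^sub>0 > 0" using eps eps_lt by (auto intro!: sin_gt_zero)
  \<comment> \<open>One summand for each requirement of \<open>no_isolated_cluster\<close>: being
    larger than 3, small turns, and radii large compared with \<open>s\<close>.\<close>
  define K where "K = 5 + 16 * real N / \<epsilon>\<^sub>0 + 4 * (2 / sin (\<epsilon>\<^sub>0 / 4) + 1) / sin \<epsilon>\<^sub>0"
  have parts: "16 * real N / \<epsilon>\<^sub>0 > 0" "4 * (2 / sin (\<epsilon>\<^sub>0 / 4) + 1) / sin \<epsilon>\<^sub>0 > 0"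
    using Npos eps sins by (auto intro!: divide_pos_pos mult_pos_pos add_pos_pos)
  have K3: "K > 3" using parts by (simp add: K_def)
  have K1: "4 / (K - 1) \<le> \<epsilon>\<^sub>0 / (4 * real N)"
  proof -
    have "16 * real N / \<epsilon>\<^sub>0 \<le> K - 1" using parts by (simp add: K_def)
    then have "4 / (K - 1) \<le> 4 / (16 * real N / \<epsilon>\<^sub>0)" using parts(1) by (intro frac_le) auto
    then show ?thesis using Npos eps by (simp add: field_simps)
  qed
  have K2: "4 * (2 / sin (\<epsilon>\<^sub>0 / 4) + 1) < (K - 1) * sin \<epsilon>\<^sub>0"
  proof -
    have "4 * (2 / sin (\<epsilon>\<^sub>0 / 4) + 1) / sin \<epsilon>\<^sub>0 < K - 1" using parts by (simp add: K_def)
    then show ?thesis using sins by (simp add: pos_divide_less_eq)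
  qed
  define q where "q = M * (M + 1) ^ N"
  \<comment> \<open>Some half-angle of each face is at least \<open>pi / real M\<close>, as at most
    \<open>M\<close> of them add up to \<open>pi\<close>. Since half-angles are also less than
    \<open>pi - \<epsilon>\<^sub>0\<close>, the sine of this one is at least
    \<open>sin \<mu>\<close>.\<close>
  define \<mu> where "\<mu> = min (pi / real M) \<epsilon>\<^sub>0"
  have \<mu>: "\<mu> > 0" "\<mu> \<le> \<epsilon>\<^sub>0" using Mpos eps by (auto simp: \<mu>_def)
  have c: "sin \<mu> > 0" using \<mu> eps_lt by (intro sin_gt_zero) auto
  define \<delta> where "\<delta> = sin \<mu> / (2 * K ^ Suc q)"
  have \<delta>: "\<delta> > 0" using c K3 by (simp add: \<delta>_def)
  have "\<delta> \<le> \<alpha> g0" for g0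
  proof (rule ccontr)
    assume "\<not> \<delta> \<le> \<alpha> g0"
    then have small: "\<alpha> g0 < \<delta>" by simp
    let ?\<phi> = "lface G g0"
    define p where "p = z (src G g0)"
    define r0 where "r0 = norm (z (src G g0) - z (trg G g0))"
    have r0_eq: "r0 = 2 * R ?\<phi> * sin (\<alpha> g0)" unfolding r0_def by (rule edge_length)
    have r0: "r0 > 0" unfolding r0_eq using R_pos alpha_sin_pos by simp
    have "sin (\<alpha> g0) < \<delta>" using small alpha_bounds(1)[of g0] sin_x_le_x[of "\<alpha> g0"] by simp
    then have "r0 < 2 * R ?\<phi> * \<delta>" unfolding r0_eq using R_pos[of ?\<phi>] by simp
    then have "r0 < R ?\<phi> * sin \<mu> / K ^ Suc q" by (simp add: \<delta>_def)
    moreover have Kp: "K ^ Suc q > 0" using K3 by simp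
    ultimately have r0K: "r0 * K ^ Suc q < R ?\<phi> * sin \<mu>" by (simp only: pos_less_divide_eq)
    define B where "B = dual_ball N ?\<phi>"
    define Q where "Q = src G ` (\<Union>f\<in>B. {e. lface G e = f})"
    have B: "finite B" "card B \<le> (M + 1) ^ N" using dual_ball_finite_card[of M N ?\<phi>] M by (auto simp: B_def)
    have finU: "finite (\<Union>f\<in>B. {e. lface G e = f})" using B finite_lface by blast
    have finQ: "finite Q" unfolding Q_def using finU by simp
    have "card Q \<le> card (\<Union>f\<in>B. {e. lface G e = f})" unfolding Q_def by (rule card_image_le[OF finU])
    also have "\<dots> \<le> (\<Sum>f\<in>B. card {e. lface G e = f})" using B by (intro card_UN_le) simp
    also have "\<dots> \<le> card B * M" using sum_bounded_above[of B "\<lambda>f. card {e. lface G e = f}" M] M by simp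
    also have "\<dots> \<le> q" using B by (simp add: q_def)
    finally have cardQ: "card Q \<le> q" .
    have "\<exists>s\<le>q. \<forall>v\<in>Q. norm (z v - p) \<le> r0 * K ^ s \<or> r0 * K ^ Suc s \<le> norm (z v - p)"
    proof (rule ccontr)
      assume "\<not> ?thesis"
      then have *: "\<not> (\<forall>v\<in>Q. norm (z v - p) \<le> r0 * K ^ s \<or> r0 * K ^ Suc s \<le> norm (z v - p))" if "s \<le> q" for s
        using that by blast
      have "\<forall>s\<in>{..q}. \<exists>v. v \<in> Q \<and> r0 * K ^ s < norm (z v - p) \<and> norm (z v - p) < r0 * K ^ Suc s"
      proof
        fix s assume "s \<in> {..q}"
        then obtain v where "v \<in> Q" "\<not> (norm (z v - p) \<le> r0 * K ^ s \<or> r0 * K ^ Suc s \<le> norm (z v - p))"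
          using *[of s] by (auto simp del: power_Suc)
        then show "\<exists>v. v \<in> Q \<and> r0 * K ^ s < norm (z v - p) \<and> norm (z v - p) < r0 * K ^ Suc s"
          by (intro exI[of _ v]) (simp del: power_Suc)
      qed
      from bchoice[OF this] obtain V where V: "\<And>s. s \<le> q \<Longrightarrow> V s \<in> Q"
        "\<And>s. s \<le> q \<Longrightarrow> r0 * K ^ s < norm (z (V s) - p)" "\<And>s. s \<le> q \<Longrightarrow> norm (z (V s) - p) < r0 * K ^ Suc s"
        by auto
      have "inj_on V {..q}"
      proof (rule linorder_inj_onI)
        fix a b assume ab: "a < b" "a \<in> {..q}" "b \<in> {..q}"
        have "K ^ Suc a \<le> K ^ b" using ab(1) K3 by (intro power_increasing) auto
        then have "r0 * K ^ Suc a \<le> r0 * K ^ b" using r0 by simp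
        then have "norm (z (V a) - p) < norm (z (V b) - p)" using V(3)[of a] V(2)[of b] ab by simp
        then show "V a \<noteq> V b" by auto
      qed auto
      then have "card {..q} \<le> card Q" by (rule card_inj_on_le[OF _ _ finQ]) (use V(1) in auto)
      then show False using cardQ by simp
    qed
    then obtain s where s: "s \<le> q"
      "\<And>v. v \<in> Q \<Longrightarrow> norm (z v - p) \<le> r0 * K ^ s \<or> r0 * K ^ Suc s \<le> norm (z v - p)" by blast
    define r where "r = r0 * K ^ s"
    have r: "r > 0" using r0 K3 by (simp add: r_def)
    have "1 \<le> K ^ s" using K3 by (intro one_le_power) simp
    then have r0r: "r0 \<le> r" using r0 by (simp add: r_def)
    have "K ^ s \<le> K ^ Suc q" using s(1) K3 by (intro power_increasing) auto
    then have "r \<le> r0 * K ^ Suc q" using r0 by (simp add: r_def)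
    then have rR: "r < R ?\<phi> * sin \<mu>" using r0K by simp
    show False
    proof (rule no_isolated_cluster[OF r N K3 K1 K2])
      show "norm (z (src G g0) - p) \<le> r" using r by (simp add: p_def)
      show "norm (z (trg G g0) - p) \<le> r" using r0r by (simp add: p_def r0_def norm_minus_commute)
      show "\<exists>a. lface G a = ?\<phi> \<and> \<not> norm (z (src G a) - p) \<le> r"
      proof (rule ccontr)
        assume "\<not> ?thesis"
        then have all: "norm (z (src G a) - p) \<le> r" if "lface G a = ?\<phi>" for a using that by blast
        have "\<exists>e. lface G e = ?\<phi> \<and> pi / real M \<le> \<alpha> e"
        proof (rule ccontr)
          assume "\<not> ?thesis"
          then have "(\<Sum>e | lface G e = ?\<phi>. \<alpha> e) < (\<Sum>e | lface G e = ?\<phi>. pi / real M)"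
            by (intro sum_strict_mono finite_lface) auto
          also have "\<dots> = real (card {e. lface G e = ?\<phi>}) * (pi / real M)" by simp
          also have "\<dots> \<le> real M * (pi / real M)" using M by (intro mult_right_mono) auto
          also have "\<dots> = pi" using Mpos by simp
          finally show False using alpha_sum[of ?\<phi>] by simp
        qed
        then obtain e where e: "lface G e = ?\<phi>" "pi / real M \<le> \<alpha> e" by blast
        have "sin \<mu> \<le> sin (\<alpha> e)"
        proof (rule sin_ge_sin_of_mem)
          show "\<mu> \<le> \<alpha> e" using e(2) by (simp add: \<mu>_def)
          show "\<alpha> e \<le> pi - \<mu>" using alpha_bounds(2)[of e] Theta_bounds(1)[of e] \<mu>(2) by simp
        qed (use \<mu> in simp)
        then have "2 * R ?\<phi> * sin \<mu> \<le> 2 * R ?\<phi> * sin (\<alpha> e)" using R_pos[of ?\<phi>] by simp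
        also have "\<dots> = norm (z (src G e) - z (trg G e))" using edge_length[of e] e(1) by simp
        also have "\<dots> \<le> norm (z (src G e) - p) + norm (z (trg G e) - p)"
          using norm_triangle_ineq4[of "z (src G e) - p" "z (trg G e) - p"] by simp
        also have "\<dots> \<le> r + r" using all[of e] all[of "nxt G e"] e(1) by (intro add_mono) simp_all
        finally show False using rR by simp
      qed
      fix e assume "lface G e \<in> dual_ball N ?\<phi>"
      then have "src G e \<in> Q" by (auto simp: Q_def B_def)
      from s(2)[OF this] show "norm (z (src G e) - p) \<le> r \<or> K * r \<le> norm (z (src G e) - p)"
        by (simp add: r_def mult.assoc mult.left_commute)
    qed
  qed
  then show ?thesis using \<delta> by blast
qed

end

section \<open>Isometries between spaces of cochains\<close>

lemma dirichlet_space_l2: "u \<in> dirichlet_space s t \<longleftrightarrow> grad s t u \<in> l2"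
  by (simp add: dirichlet_space_def l2_def)

lemma dnorm_l2_sq: "dnorm s t u = sqrt (l2_sq (grad s t u) / 2)"
  by (simp add: dnorm_def energy_def l2_sq_def)

lemma grad_lincomb: "grad s t (\<lambda>x. a * u x + b * v x) = (\<lambda>e. a * grad s t u e + b * grad s t v e)"
  by (auto simp: grad_def algebra_simps)

lemma grad_diff: "grad s t (\<lambda>x. u x - v x) = (\<lambda>e. grad s t u e - grad s t v e)"
  by (auto simp: grad_def)

lemma grad_mod_const: "v \<in> mod_const u \<Longrightarrow> grad s t v = grad s t u"
  by (auto simp: mod_const_def grad_def)

lemma mod_const_self: "u \<in> mod_const u"
  unfolding mod_const_def by (intro CollectI exI[of _ 0]) simp

lemma mod_const_sym: "v \<in> mod_const u \<Longrightarrow> u \<in> mod_const v"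
proof -
  assume "v \<in> mod_const u"
  then obtain k where "v = (\<lambda>x. u x + k)" by (auto simp: mod_const_def)
  then show ?thesis unfolding mod_const_def by (intro CollectI exI[of _ "- k"]) auto
qed

lemma mod_const_trans: "v \<in> mod_const u \<Longrightarrow> x \<in> mod_const v \<Longrightarrow> x \<in> mod_const u"
proof -
  assume "v \<in> mod_const u" "x \<in> mod_const v"
  then obtain k l where "v = (\<lambda>x. u x + k)" "x = (\<lambda>y. v y + l)" by (auto simp: mod_const_def)
  then show ?thesis unfolding mod_const_def by (intro CollectI exI[of _ "k + l"]) auto
qed

lemma mod_const_eq: "v \<in> mod_const u \<Longrightarrow> mod_const v = mod_const u"
  using mod_const_sym mod_const_trans by blast

text \<open>Taylor estimates with constants independent of the edge: the condition under which the
  functions \<open>N e\<close>, applied edge by edge, give a continuously differentiable map of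
  square-summable cochains near \<open>x\<close>.\<close>

definition uniformly_C11 :: "('e \<Rightarrow> real \<Rightarrow> real) \<Rightarrow> ('e \<Rightarrow> real \<Rightarrow> real) \<Rightarrow> ('e \<Rightarrow> real) \<Rightarrow> bool" where
  "uniformly_C11 N N' x \<longleftrightarrow> (\<exists>\<rho>>0. \<exists>C\<ge>0. \<forall>e h. \<bar>h\<bar> \<le> \<rho> \<longrightarrow>
     \<bar>N e (x e + h) - N e (x e) - N' e (x e) * h\<bar> \<le> C * \<bar>h\<bar> * \<bar>h\<bar> \<and>
     \<bar>N' e (x e + h) - N' e (x e)\<bar> \<le> C * \<bar>h\<bar> \<and> \<bar>N' e (x e)\<bar> \<le> C)"

lemma lipschitz_from_derivative:
  fixes f f' :: "real \<Rightarrow> real"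
  assumes "\<And>y. min a b \<le> y \<Longrightarrow> y \<le> max a b \<Longrightarrow> (f has_real_derivative f' y) (at y)"
    and "\<And>y. min a b \<le> y \<Longrightarrow> y \<le> max a b \<Longrightarrow> \<bar>f' y\<bar> \<le> C"
  shows "\<bar>f b - f a\<bar> \<le> C * \<bar>b - a\<bar>"
proof -
  have "norm (f b - f a) \<le> C * norm (b - a)"
    by (rule field_differentiable_bound[where S = "{min a b..max a b}" and f' = f'])
      (use assms in \<open>auto intro: has_field_derivative_at_within\<close>)
  then show ?thesis by simp
qed

lemma uniformly_C11I:
  fixes N N' N'' :: "'e \<Rightarrow> real \<Rightarrow> real"
  assumes \<rho>: "\<rho> > 0"
    and d: "\<And>e y. \<bar>y - x e\<bar> \<le> \<rho> \<Longrightarrow> (N e has_real_derivative N' e y) (at y)"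
    and d': "\<And>e y. \<bar>y - x e\<bar> \<le> \<rho> \<Longrightarrow> (N' e has_real_derivative N'' e y) (at y)"
    and b: "\<And>e. \<bar>N' e (x e)\<bar> \<le> C" and b': "\<And>e y. \<bar>y - x e\<bar> \<le> \<rho> \<Longrightarrow> \<bar>N'' e y\<bar> \<le> C"
  shows "uniformly_C11 N N' x"
proof -
  have C: "C \<ge> 0" using b[of undefined] by linarith
  have lip: "\<bar>N' e y - N' e (x e)\<bar> \<le> C * \<bar>y - x e\<bar>" if "\<bar>y - x e\<bar> \<le> \<rho>" for e y
    by (rule lipschitz_from_derivative[where f' = "N'' e"]) (use that d' b' in auto)
  have "\<bar>N e (x e + h) - N e (x e) - N' e (x e) * h\<bar> \<le> C * \<bar>h\<bar> * \<bar>h\<bar>" if h: "\<bar>h\<bar> \<le> \<rho>" for e h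
  proof -
    let ?f = "\<lambda>y. N e y - N' e (x e) * y"
    have "\<bar>?f (x e + h) - ?f (x e)\<bar> \<le> (C * \<bar>h\<bar>) * \<bar>x e + h - x e\<bar>"
    proof (rule lipschitz_from_derivative[where f' = "\<lambda>y. N' e y - N' e (x e)"])
      fix y assume y: "min (x e) (x e + h) \<le> y" "y \<le> max (x e) (x e + h)"
      then have yh: "\<bar>y - x e\<bar> \<le> \<bar>h\<bar>" by auto
      then have y\<rho>: "\<bar>y - x e\<bar> \<le> \<rho>" using h by simp
      show "(?f has_real_derivative N' e y - N' e (x e)) (at y)"
        by (auto intro!: derivative_eq_intros d[OF y\<rho>])
      have "\<bar>N' e y - N' e (x e)\<bar> \<le> C * \<bar>y - x e\<bar>" by (rule lip[OF y\<rho>])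
      also have "\<dots> \<le> C * \<bar>h\<bar>" using yh C by (rule mult_left_mono)
      finally show "\<bar>N' e y - N' e (x e)\<bar> \<le> C * \<bar>h\<bar>" .
    qed
    then show ?thesis by (simp add: algebra_simps)
  qed
  moreover have "\<bar>N' e (x e + h) - N' e (x e)\<bar> \<le> C * \<bar>h\<bar>" if "\<bar>h\<bar> \<le> \<rho>" for e h
    using lip[of "x e + h" e] that by simp
  ultimately show ?thesis unfolding uniformly_C11_def using \<rho> C b by (intro exI[of _ \<rho>] exI[of _ C]) auto
qed

text \<open>In the first graph only the sums over the edges with a given initial point are used: they vanish
  exactly on the gradients of the second graph.\<close>

locale cochain_duality =
  fixes rv :: "'e \<Rightarrow> 'e" and s :: "'e \<Rightarrow> 'a" and s' t' :: "'e \<Rightarrow> 'b"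
  assumes finite_fibre: "finite {e. s e = x}"
    and involution: "rv (rv e) = e" and reverse: "t' e = s' (rv e)"
    and grad_sum: "(\<Sum>e | s e = x. grad s' t' v e) = 0"
    and exact: "(\<And>e. f (rv e) = - f e) \<Longrightarrow> (\<And>x. (\<Sum>e | s e = x. f e) = 0) \<Longrightarrow> \<exists>v. grad s' t' v = f"
    and grad_0: "grad s' t' v = (\<lambda>e. 0) \<Longrightarrow> v y = v y'"
begin

text \<open>By \<open>exact\<close> and \<open>grad_sum\<close> these are precisely the gradients of
  the Dirichlet functions on the second graph. Each condition involves finitely many edges, so it
  survives pointwise limits.\<close>

definition Z :: "('e \<Rightarrow> real) set" where
  "Z = {f \<in> l2. (\<forall>e. f (rv e) = - f e) \<and> (\<forall>x. (\<Sum>e | s e = x. f e) = 0)}"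

lemma grad_rv: "grad s' t' v (rv e) = - grad s' t' v e"
  by (simp add: grad_def reverse involution)

lemma grad_in_Z: "v \<in> dirichlet_space s' t' \<Longrightarrow> grad s' t' v \<in> Z"
  by (simp add: Z_def dirichlet_space_l2 grad_rv grad_sum)

sublocale closed_subspace Z
proof
  show "Z \<subseteq> l2" by (auto simp: Z_def)
  show "(\<lambda>_. 0) \<in> Z" by (simp add: Z_def l2_def)
  show "(\<lambda>e. a * f e + b * g e) \<in> Z" if "f \<in> Z" "g \<in> Z" for f g a b
    using that by (simp add: Z_def l2_lincomb sum.distrib sum_distrib_left[symmetric])
  show "g \<in> Z" if f: "\<And>n. f n \<in> Z" and lim: "\<And>e. (\<lambda>n. f n e) \<longlonglongrightarrow> g e" and g: "g \<in> l2"
    for f :: "nat \<Rightarrow> 'e \<Rightarrow> real" and g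
  proof -
    have "g (rv e) = - g e" for e
    proof (rule LIMSEQ_unique)
      show "(\<lambda>n. f n (rv e)) \<longlonglongrightarrow> g (rv e)" by (rule lim)
      have "(\<lambda>n. - f n e) \<longlonglongrightarrow> - g e" by (intro tendsto_intros lim)
      then show "(\<lambda>n. f n (rv e)) \<longlonglongrightarrow> - g e" using f by (simp add: Z_def)
    qed
    moreover have "(\<Sum>e | s e = x. g e) = 0" for x
    proof (rule LIMSEQ_unique)
      show "(\<lambda>n. \<Sum>e | s e = x. f n e) \<longlonglongrightarrow> (\<Sum>e | s e = x. g e)" by (intro tendsto_intros lim)
      show "(\<lambda>n. \<Sum>e | s e = x. f n e) \<longlonglongrightarrow> 0" using f by (simp add: Z_def)
    qed
    ultimately show ?thesis using g by (simp add: Z_def)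
  qed
qed

lemma grad_eq_imp_mod_const:
  assumes "grad s' t' v = grad s' t' w" shows "v \<in> mod_const w"
proof -
  fix y0 :: 'b
  have "grad s' t' (\<lambda>y. v y - w y) = (\<lambda>e. 0)" using assms by (simp add: grad_diff)
  from grad_0[OF this] have "v y - w y = v y0 - w y0" for y .
  then have "v = (\<lambda>y. w y + (v y0 - w y0))" by (auto simp: fun_eq_iff algebra_simps)
  then show ?thesis unfolding mod_const_def by blast
qed

text \<open>\<open>undefined\<close> is just an arbitrary base point; normalising there makes \<open>prim\<close> linear.\<close>

definition prim :: "('e \<Rightarrow> real) \<Rightarrow> ('b \<Rightarrow> real)" where
  "prim f = (\<lambda>y. (SOME v. grad s' t' v = f) y - (SOME v. grad s' t' v = f) undefined)"

lemma grad_prim: assumes "f \<in> Z" shows "grad s' t' (prim f) = f"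
proof -
  have "\<exists>v. grad s' t' v = f" by (rule exact) (use assms in \<open>auto simp: Z_def\<close>)
  then have S: "grad s' t' (SOME v. grad s' t' v = f) = f" by (rule someI_ex)
  define v where "v = (SOME v. grad s' t' v = f)"
  have "prim f = (\<lambda>y. v y - v undefined)" by (simp add: prim_def v_def)
  then have "grad s' t' (prim f) = grad s' t' v" by (simp add: grad_def fun_eq_iff)
  then show ?thesis using S by (simp add: v_def)
qed

lemma prim_undefined: "prim f undefined = 0"
  by (simp add: prim_def)

lemma prim_eqI:
  assumes "f \<in> Z" "grad s' t' v = f" "v undefined = 0" shows "prim f = v"
proof -
  have "prim f \<in> mod_const v" using assms grad_prim by (intro grad_eq_imp_mod_const) simp
  then obtain k where k: "prim f = (\<lambda>y. v y + k)" by (auto simp: mod_const_def)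
  then have "prim f undefined = v undefined + k" by simp
  then have "k = 0" using prim_undefined[of f] assms(3) by simp
  then show ?thesis using k by simp
qed

lemma prim_lincomb:
  assumes "f \<in> Z" "g \<in> Z"
  shows "prim (\<lambda>e. a * f e + b * g e) = (\<lambda>y. a * prim f y + b * prim g y)"
  by (rule prim_eqI) (use assms in \<open>auto simp: lincomb grad_lincomb grad_prim prim_undefined\<close>)

text \<open>Multiplication by the weights, made exact by the projection and then integrated. Where
  the product is closed already, as for harmonic arguments, the projection does nothing.\<close>

definition deriv_map :: "('e \<Rightarrow> real) \<Rightarrow> ('e \<Rightarrow> real) \<Rightarrow> ('b \<Rightarrow> real)" where
  "deriv_map c g = prim (proj (\<lambda>e. c e * g e))"

lemma mult_l2:
  assumes "g \<in> l2" "\<And>e. \<bar>c e\<bar> \<le> C"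
  shows "(\<lambda>e. c e * g e) \<in> l2" "l2_sq (\<lambda>e. c e * g e) \<le> C\<^sup>2 * l2_sq g"
proof -
  have "\<bar>c e * g e\<bar> \<le> C * \<bar>g e\<bar>" for e
    using mult_right_mono[OF assms(2)] by (simp add: abs_mult)
  from l2_dominated[OF assms(1) this]
  show "(\<lambda>e. c e * g e) \<in> l2" "l2_sq (\<lambda>e. c e * g e) \<le> C\<^sup>2 * l2_sq g" .
qed

lemma grad_deriv_map:
  assumes "g \<in> l2" "\<And>e. \<bar>c e\<bar> \<le> C"
  shows "grad s' t' (deriv_map c g) = proj (\<lambda>e. c e * g e)"
  unfolding deriv_map_def by (intro grad_prim proj_in mult_l2(1)[OF assms])

lemma bounded_linear_deriv_map:
  assumes c: "\<And>e. \<bar>c e\<bar> \<le> C"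
  shows "bounded_linear_dirichlet s t s' t' (\<lambda>w. deriv_map c (grad s t w))"
  unfolding bounded_linear_dirichlet_def
proof (intro conjI ballI allI exI[of _ C])
  have C: "C \<ge> 0" using c[of undefined] by linarith
  fix w assume "w \<in> dirichlet_space s t"
  then have w: "grad s t w \<in> l2" by (simp add: dirichlet_space_l2)
  note m = mult_l2[of _ c, OF w c]
  note g = grad_deriv_map[OF w c]
  show "deriv_map c (grad s t w) \<in> dirichlet_space s' t'"
    using proj_in[OF m(1)] sub by (auto simp: dirichlet_space_l2 g)
  have "l2_sq (grad s' t' (deriv_map c (grad s t w))) \<le> C\<^sup>2 * l2_sq (grad s t w)"
    unfolding g using l2_sq_proj_le[OF m(1)] m(2) by (rule order_trans)
  then have "dnorm s' t' (deriv_map c (grad s t w)) \<le> sqrt (C\<^sup>2 * (l2_sq (grad s t w) / 2))"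
    unfolding dnorm_l2_sq by (intro real_sqrt_le_mono) simp
  then show "dnorm s' t' (deriv_map c (grad s t w)) \<le> C * dnorm s t w"
    unfolding dnorm_l2_sq using C by (simp add: real_sqrt_mult real_sqrt_divide)
next
  fix w1 w2 a b assume "w1 \<in> dirichlet_space s t" "w2 \<in> dirichlet_space s t"
  then have w: "grad s t w1 \<in> l2" "grad s t w2 \<in> l2" by (simp_all add: dirichlet_space_l2)
  note m = mult_l2(1)[of _ c, OF w(1) c] mult_l2(1)[of _ c, OF w(2) c]
  have "(\<lambda>e. c e * (a * grad s t w1 e + b * grad s t w2 e)) =
    (\<lambda>e. a * (c e * grad s t w1 e) + b * (c e * grad s t w2 e))" by (auto simp: algebra_simps)
  then show "deriv_map c (grad s t (\<lambda>x. a * w1 x + b * w2 x)) =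
    (\<lambda>y. a * deriv_map c (grad s t w1) y + b * deriv_map c (grad s t w2) y)"
    unfolding deriv_map_def grad_lincomb using m by (simp add: proj_lincomb prim_lincomb proj_in)
qed

text \<open>Pointwise control by the Dirichlet norm turns smallness in norm into smallness uniform
  over the edges. The factor 2 is a convenient bound for \<open>sqrt 2\<close>.\<close>

lemma point_le_dnorm:
  assumes "u \<in> dirichlet_space s t" shows "\<bar>grad s t u e\<bar> \<le> 2 * dnorm s t u"
proof -
  have "(grad s t u e)\<^sup>2 \<le> l2_sq (grad s t u)"
    using assms by (intro l2_sq_ge_point) (simp add: dirichlet_space_l2)
  also have "\<dots> \<le> 2 * l2_sq (grad s t u)" using l2_sq_nonneg[of "grad s t u"] by simp
  finally have "\<bar>grad s t u e\<bar>\<^sup>2 \<le> (2 * dnorm s t u)\<^sup>2"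
    using l2_sq_nonneg[of "grad s t u"] by (simp add: dnorm_l2_sq power_mult_distrib)
  then show ?thesis by (rule power2_le_imp_le) (use l2_sq_nonneg[of "grad s t u"] in \<open>simp add: dnorm_l2_sq\<close>)
qed

lemma dnorm_le:
  assumes "l2_sq (grad s' t' v) \<le> K\<^sup>2 * l2_sq g" "K \<ge> 0"
  shows "dnorm s' t' v \<le> K * sqrt (l2_sq g / 2)"
proof -
  have "sqrt (l2_sq (grad s' t' v) / 2) \<le> sqrt (K\<^sup>2 * (l2_sq g / 2))" using assms(1) by (intro real_sqrt_le_mono) simp
  then show ?thesis unfolding dnorm_l2_sq using assms(2) by (simp add: real_sqrt_mult real_sqrt_divide)
qed

text \<open>The difference of the gradients of \<open>v'\<close> and \<open>v\<close> lies in
  \<open>Z\<close> and is fixed by the projection. Hence the error is the projection of the edgewise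
  Taylor remainder, bounded by \<open>C * \<bar>h\<bar> * \<bar>h\<bar>\<close>, and one factor
  \<open>C * \<bar>h\<bar>\<close> is at most \<open>\<epsilon>\<close> on all edges at
  once.\<close>

lemma c1_derivative_deriv_map:
  assumes A: "A \<subseteq> dirichlet_space s t"
    and \<Phi>: "\<And>u v. u \<in> A \<Longrightarrow> v \<in> \<Phi> (mod_const u) \<Longrightarrow> v \<in> dirichlet_space s' t'"
    and N: "\<And>u v e. u \<in> A \<Longrightarrow> v \<in> \<Phi> (mod_const u) \<Longrightarrow> grad s' t' v e = N e (grad s t u e)"
    and C11: "\<And>u. u \<in> A \<Longrightarrow> uniformly_C11 N N' (grad s t u)"
  shows "c1_derivative s t A s' t' \<Phi> (\<lambda>u w. deriv_map (\<lambda>e. N' e (grad s t u e)) (grad s t w))"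
  unfolding c1_derivative_def
proof (intro conjI ballI allI impI)
  fix u assume u: "u \<in> A"
  have A_l2: "grad s t u \<in> l2" if "u \<in> A" for u
    using A that by (auto simp: dirichlet_space_l2)
  obtain \<rho> C where \<rho>: "\<rho> > 0" "C \<ge> 0"
    "\<And>e h. \<bar>h\<bar> \<le> \<rho> \<Longrightarrow> \<bar>N e (grad s t u e + h) - N e (grad s t u e) - N' e (grad s t u e) * h\<bar> \<le> C * \<bar>h\<bar> * \<bar>h\<bar>"
    "\<And>e h. \<bar>h\<bar> \<le> \<rho> \<Longrightarrow> \<bar>N' e (grad s t u e + h) - N' e (grad s t u e)\<bar> \<le> C * \<bar>h\<bar>"
    "\<And>e. \<bar>N' e (grad s t u e)\<bar> \<le> C"
    using C11[OF u] unfolding uniformly_C11_def by (metis abs_0 less_eq_real_def)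
  show "bounded_linear_dirichlet s t s' t' (\<lambda>w. deriv_map (\<lambda>e. N' e (grad s t u e)) (grad s t w))"
    by (rule bounded_linear_deriv_map[OF \<rho>(5)])
  fix \<epsilon> :: real assume \<epsilon>: "\<epsilon> > 0"
  \<comment> \<open>With the factor 2 of \<open>point_le_dnorm\<close>, the first entry keeps
    increments within \<open>\<rho>\<close> and the second makes \<open>C\<close> times an increment
    at most \<open>\<epsilon>\<close>.\<close>
  define \<delta> where "\<delta> = min (\<rho> / 2) (\<epsilon> / (2 * C + 1))"
  have \<delta>: "\<delta> > 0" using \<rho>(1,2) \<epsilon> by (simp add: \<delta>_def)
  have close: "\<bar>grad s t u' e - grad s t u e\<bar> \<le> \<rho>" "C * \<bar>grad s t u' e - grad s t u e\<bar> \<le> \<epsilon>"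
    if u': "u' \<in> A" "dnorm s t (\<lambda>x. u' x - u x) < \<delta>" for u' e
  proof -
    have "(\<lambda>x. u' x - u x) \<in> dirichlet_space s t"
      unfolding dirichlet_space_l2 grad_diff by (rule l2_diff[OF A_l2[OF u'(1)] A_l2[OF u]])
    from point_le_dnorm[OF this, of e] have le: "\<bar>grad s t u' e - grad s t u e\<bar> \<le> 2 * \<delta>"
      using u'(2) by (simp add: grad_diff)
    then show "\<bar>grad s t u' e - grad s t u e\<bar> \<le> \<rho>" by (simp add: \<delta>_def)
    have "C * \<bar>grad s t u' e - grad s t u e\<bar> \<le> C * (2 * (\<epsilon> / (2 * C + 1)))"
      using le \<rho>(2) by (intro mult_left_mono) (auto simp: \<delta>_def)
    also have "\<dots> = \<epsilon> * (2 * C / (2 * C + 1))" by simp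
    also have "\<dots> \<le> \<epsilon> * 1" using \<rho>(2) \<epsilon> by (intro mult_left_mono) auto
    finally show "C * \<bar>grad s t u' e - grad s t u e\<bar> \<le> \<epsilon>" by simp
  qed
  show "\<exists>\<delta>>0. \<forall>u'\<in>A. dnorm s t (\<lambda>x. u' x - u x) < \<delta> \<longrightarrow>
     (\<forall>v\<in>\<Phi> (mod_const u). \<forall>v'\<in>\<Phi> (mod_const u').
        dnorm s' t' (\<lambda>y. v' y - v y - deriv_map (\<lambda>e. N' e (grad s t u e)) (grad s t (\<lambda>x. u' x - u x)) y)
          \<le> \<epsilon> * dnorm s t (\<lambda>x. u' x - u x))"
  proof (intro exI[of _ \<delta>] conjI \<delta> ballI impI)
    fix u' v v' assume u': "u' \<in> A" "dnorm s t (\<lambda>x. u' x - u x) < \<delta>"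
      and v: "v \<in> \<Phi> (mod_const u)" "v' \<in> \<Phi> (mod_const u')"
    let ?h = "\<lambda>e. grad s t u' e - grad s t u e" and ?f = "\<lambda>e. grad s' t' v' e - grad s' t' v e"
    let ?c = "\<lambda>e. N' e (grad s t u e)"
    have hs: "?h \<in> l2" by (rule l2_diff[OF A_l2[OF u'(1)] A_l2[OF u]])
    have fZ: "?f \<in> Z"
      using lincomb[of "grad s' t' v'" "grad s' t' v" 1 "-1"] grad_in_Z \<Phi> u u' v by simp
    note m = mult_l2(1)[of ?h ?c C, OF hs \<rho>(5)]
    have "grad s' t' (\<lambda>y. v' y - v y - deriv_map ?c (grad s t (\<lambda>x. u' x - u x)) y) =
        (\<lambda>e. ?f e - proj (\<lambda>e. ?c e * ?h e) e)"
      unfolding grad_diff grad_deriv_map[OF hs \<rho>(5)] ..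
    also have "\<dots> = proj (\<lambda>e. ?f e - ?c e * ?h e)"
      using proj_diff[of ?f "\<lambda>e. ?c e * ?h e"] fZ sub m by (auto simp: proj_id[OF fZ])
    finally have g: "grad s' t' (\<lambda>y. v' y - v y - deriv_map ?c (grad s t (\<lambda>x. u' x - u x)) y) =
        proj (\<lambda>e. ?f e - ?c e * ?h e)" .
    have "\<bar>?f e - ?c e * ?h e\<bar> \<le> \<epsilon> * \<bar>?h e\<bar>" for e
    proof -
      have "\<bar>?f e - ?c e * ?h e\<bar> \<le> C * \<bar>?h e\<bar> * \<bar>?h e\<bar>"
        using \<rho>(3)[OF close(1)[OF u', of e], of e] N[OF u v(1)] N[OF u'(1) v(2)] by simp
      also have "\<dots> \<le> \<epsilon> * \<bar>?h e\<bar>" using close(2)[OF u'] by (intro mult_right_mono) auto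
      finally show ?thesis .
    qed
    note r = l2_dominated[of ?h "\<lambda>e. ?f e - ?c e * ?h e", OF hs this]
    have "l2_sq (proj (\<lambda>e. ?f e - ?c e * ?h e)) \<le> \<epsilon>\<^sup>2 * l2_sq ?h" using l2_sq_proj_le[OF r(1)] r(2) by (rule order_trans)
    then have "l2_sq (grad s' t' (\<lambda>y. v' y - v y - deriv_map ?c (grad s t (\<lambda>x. u' x - u x)) y)) \<le> \<epsilon>\<^sup>2 * l2_sq ?h"
      by (simp only: g)
    from dnorm_le[OF this] \<epsilon> show "dnorm s' t' (\<lambda>y. v' y - v y - deriv_map ?c (grad s t (\<lambda>x. u' x - u x)) y)
          \<le> \<epsilon> * dnorm s t (\<lambda>x. u' x - u x)"
      by (simp add: dnorm_l2_sq[of s t] grad_diff)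
  qed
  show "\<exists>\<delta>>0. \<forall>u'\<in>A. dnorm s t (\<lambda>x. u' x - u x) < \<delta> \<longrightarrow>
     (\<forall>w\<in>dirichlet_space s t.
        dnorm s' t' (\<lambda>y. deriv_map (\<lambda>e. N' e (grad s t u' e)) (grad s t w) y -
           deriv_map (\<lambda>e. N' e (grad s t u e)) (grad s t w) y) \<le> \<epsilon> * dnorm s t w)"
  proof (intro exI[of _ \<delta>] conjI \<delta> ballI impI)
    fix u' w assume u': "u' \<in> A" "dnorm s t (\<lambda>x. u' x - u x) < \<delta>" and "w \<in> dirichlet_space s t"
    then have w: "grad s t w \<in> l2" by (simp add: dirichlet_space_l2)
    let ?c = "\<lambda>e. N' e (grad s t u e)" and ?c' = "\<lambda>e. N' e (grad s t u' e)"
    have diff: "\<bar>?c' e - ?c e\<bar> \<le> \<epsilon>" for e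
      using \<rho>(4)[OF close(1)[OF u', of e], of e] close(2)[OF u', of e] by simp
    have c': "\<bar>?c' e\<bar> \<le> C + \<epsilon>" for e using diff[of e] \<rho>(5)[of e] by linarith
    have "grad s' t' (\<lambda>y. deriv_map ?c' (grad s t w) y - deriv_map ?c (grad s t w) y) =
      (\<lambda>e. proj (\<lambda>e. ?c' e * grad s t w e) e - proj (\<lambda>e. ?c e * grad s t w e) e)"
      unfolding grad_diff grad_deriv_map[OF w \<rho>(5)] grad_deriv_map[OF w c'] ..
    also have "\<dots> = proj (\<lambda>e. ?c' e * grad s t w e - ?c e * grad s t w e)"
      by (rule proj_diff[OF mult_l2(1)[OF w c'] mult_l2(1)[OF w \<rho>(5)], symmetric])
    also have "(\<lambda>e. ?c' e * grad s t w e - ?c e * grad s t w e) = (\<lambda>e. (?c' e - ?c e) * grad s t w e)"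
      by (auto simp: algebra_simps)
    finally have g: "grad s' t' (\<lambda>y. deriv_map ?c' (grad s t w) y - deriv_map ?c (grad s t w) y) =
      proj (\<lambda>e. (?c' e - ?c e) * grad s t w e)" .
    note m = mult_l2[of "grad s t w" "\<lambda>e. ?c' e - ?c e", OF w diff]
    have "l2_sq (proj (\<lambda>e. (?c' e - ?c e) * grad s t w e)) \<le> \<epsilon>\<^sup>2 * l2_sq (grad s t w)"
      using l2_sq_proj_le[OF m(1)] m(2) by (rule order_trans)
    then have "l2_sq (grad s' t' (\<lambda>y. deriv_map ?c' (grad s t w) y - deriv_map ?c (grad s t w) y)) \<le> \<epsilon>\<^sup>2 * l2_sq (grad s t w)"
      by (simp only: g)
    from dnorm_le[OF this] \<epsilon>
    show "dnorm s' t' (\<lambda>y. deriv_map ?c' (grad s t w) y - deriv_map ?c (grad s t w) y) \<le> \<epsilon> * dnorm s t w"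
      by (simp add: dnorm_l2_sq[of s t])
  qed
qed

end

locale dual_cochains = F: cochain_duality rv s s' t' + B: cochain_duality rv s' s t
  for rv :: "'e \<Rightarrow> 'e" and s t :: "'e \<Rightarrow> 'a" and s' t' :: "'e \<Rightarrow> 'b"
begin

text \<open>Reciprocal weights exchange harmonic and closed: if \<open>w\<close> is harmonic,
  \<open>c * grad w\<close> is the gradient of some \<open>w'\<close>; and \<open>c'\<close> times
  this gradient is \<open>grad w\<close> again, which is closed, so \<open>w'\<close> is harmonic.
  The energies agree edge by edge, as \<open>c' * (c * g)\<^sup>2 = c * g\<^sup>2\<close>.\<close>

lemma riemannian_isometryI:
  fixes c :: "('a \<Rightarrow> real) \<Rightarrow> 'e \<Rightarrow> real" and c' :: "('b \<Rightarrow> real) \<Rightarrow> 'e \<Rightarrow> real"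
  assumes bij: "bij_betw \<Phi> (mod_const ` A) (mod_const ` B)"
    and A: "A \<subseteq> dirichlet_space s t" and B: "B \<subseteq> dirichlet_space s' t'"
    and A_mod: "\<And>u u'. u \<in> A \<Longrightarrow> u' \<in> mod_const u \<Longrightarrow> u' \<in> A"
    and B_mod: "\<And>v v'. v \<in> B \<Longrightarrow> v' \<in> mod_const v \<Longrightarrow> v' \<in> B"
    and N: "\<And>u v e. u \<in> A \<Longrightarrow> v \<in> \<Phi> (mod_const u) \<Longrightarrow> grad s' t' v e = N e (grad s t u e)"
    and M: "\<And>u v e. u \<in> A \<Longrightarrow> v \<in> \<Phi> (mod_const u) \<Longrightarrow> grad s t u e = M e (grad s' t' v e)"
    and c: "\<And>u e. u \<in> A \<Longrightarrow> c u e = N' e (grad s t u e)"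
    and c': "\<And>v e. v \<in> B \<Longrightarrow> c' v e = M' e (grad s' t' v e)"
    and N_C11: "\<And>u. u \<in> A \<Longrightarrow> uniformly_C11 N N' (grad s t u)"
    and M_C11: "\<And>v. v \<in> B \<Longrightarrow> uniformly_C11 M M' (grad s' t' v)"
    and c_rv: "\<And>u e. u \<in> A \<Longrightarrow> c u (rv e) = c u e"
    and cc': "\<And>u v e. u \<in> A \<Longrightarrow> v \<in> \<Phi> (mod_const u) \<Longrightarrow> c u e * c' v e = 1"
  shows "riemannian_isometry s t A c s' t' B c' \<Phi>"
proof -
  have \<Phi>B: "v \<in> B" if "u \<in> A" "v \<in> \<Phi> (mod_const u)" for u v
  proof -
    have "\<Phi> (mod_const u) \<in> mod_const ` B" using bij that(1) by (auto simp: bij_betw_def)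
    then show ?thesis using that(2) B_mod by auto
  qed
  have c_bounded: "\<exists>C. \<forall>e. \<bar>c u e\<bar> \<le> C" if "u \<in> A" for u
    using N_C11[OF that] c[OF that] unfolding uniformly_C11_def by (metis abs_0 less_eq_real_def)
  have c'_bounded: "\<exists>C. \<forall>e. \<bar>c' v e\<bar> \<le> C" if "v \<in> B" for v
    using M_C11[OF that] c'[OF that] unfolding uniformly_C11_def by (metis abs_0 less_eq_real_def)
  have finite_en: "finite_energy sa ta k w" if w: "grad sa ta w \<in> l2" and k: "\<And>e. \<bar>k e\<bar> \<le> C"
    for sa ta :: "'e \<Rightarrow> 'd" and k w C
  proof -
    have "(\<lambda>e. (k e * grad sa ta w e) * grad sa ta w e) summable_on UNIV"
      by (rule l2_prod_summable[OF F.mult_l2(1)[OF w k] w])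
    then show ?thesis by (simp add: finite_energy_def power2_eq_square mult.assoc)
  qed
  define L where "L u w = F.deriv_map (\<lambda>e. N' e (grad s t u e)) (grad s t w)" for u w
  define L' where "L' v w = B.deriv_map (\<lambda>e. M' e (grad s' t' v e)) (grad s' t' w)" for v w
  let ?\<Psi> = "inv_into (mod_const ` A) \<Phi>"
  have \<Psi>: "u \<in> A \<and> v \<in> \<Phi> (mod_const u)" if "v \<in> B" "u \<in> ?\<Psi> (mod_const v)" for u v
  proof -
    have mv: "mod_const v \<in> \<Phi> ` mod_const ` A" using bij that(1) by (auto simp: bij_betw_def)
    then have "?\<Psi> (mod_const v) \<in> mod_const ` A" by (rule inv_into_into)
    then obtain u0 where u0: "u0 \<in> A" "?\<Psi> (mod_const v) = mod_const u0" by blast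
    then have uu: "u \<in> mod_const u0" using that(2) by simp
    have "\<Phi> (?\<Psi> (mod_const v)) = mod_const v" using mv by (rule f_inv_into_f)
    then have "v \<in> \<Phi> (mod_const u)" using u0(2) mod_const_eq[OF uu] mod_const_self by metis
    then show ?thesis using A_mod[OF u0(1) uu] by blast
  qed
  have "c1_derivative s t A s' t' \<Phi> L" unfolding L_def
    by (rule F.c1_derivative_deriv_map[OF A _ N N_C11]) (use \<Phi>B B in blast)
  moreover have "c1_derivative s' t' B s t ?\<Psi> L'" unfolding L'_def
    by (rule B.c1_derivative_deriv_map[OF B _ _ M_C11]) (use \<Psi> A M in blast)+
  moreover have "bij_betw (\<lambda>W. \<Union>w\<in>W. mod_const (L u w))
            (mod_const ` harmonic_dirichlet s t (c u))
            (mod_const ` harmonic_dirichlet s' t' (c' v)) \<and>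
          (\<forall>w\<in>harmonic_dirichlet s t (c u).
             energy s' t' (c' v) (L u w) = energy s t (c u) w)" if u: "u \<in> A" and v: "v \<in> \<Phi> (mod_const u)" for u v
  proof -
    note vB = \<Phi>B[OF u v]
    have ceq: "(\<lambda>e. N' e (grad s t u e)) = c u" using c[OF u] by auto
    obtain C where C: "\<And>e. \<bar>c u e\<bar> \<le> C" using c_bounded[OF u] by blast
    obtain C' where C': "\<And>e. \<bar>c' v e\<bar> \<le> C'" using c'_bounded[OF vB] by blast
    have cc: "c u e * c' v e = 1" for e by (rule cc'[OF u v])
    have c'_rv: "c' v (rv e) = c' v e" for e
      using cc[of e] cc[of "rv e"] c_rv[OF u, of e] by (metis mult_cancel_left mult_zero_left zero_neq_one)
    have g: "grad s' t' (L u w) = (\<lambda>e. c u e * grad s t w e)" if w: "w \<in> harmonic_dirichlet s t (c u)" for w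
    proof -
      have ws: "grad s t w \<in> l2" using w by (simp add: harmonic_dirichlet_def dirichlet_space_l2)
      have "(\<lambda>e. c u e * grad s t w e) \<in> F.Z"
        using F.mult_l2(1)[OF ws C] w c_rv[OF u] B.grad_rv
        by (simp add: F.Z_def harmonic_dirichlet_def)
      then show ?thesis unfolding L_def ceq using F.grad_deriv_map[OF ws C] F.proj_id by simp
    qed
    have Lh: "L u w \<in> harmonic_dirichlet s' t' (c' v)" if w: "w \<in> harmonic_dirichlet s t (c u)" for w
    proof -
      have ws: "grad s t w \<in> l2" using w by (simp add: harmonic_dirichlet_def dirichlet_space_l2)
      have "c' v e * (c u e * grad s t w e) = grad s t w e" for e
        using cc[of e] by (metis mult.assoc mult.commute mult_1)
      then have "(\<Sum>e | s' e = x. c' v e * grad s' t' (L u w) e) = 0" for x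
        using B.grad_sum[of w x] unfolding g[OF w] by (simp only:)
      then show ?thesis using F.mult_l2(1)[OF ws C]
        by (simp add: harmonic_dirichlet_def dirichlet_space_l2 g[OF w])
    qed
    have Lmod: "(\<Union>w'\<in>mod_const w. mod_const (L u w')) = mod_const (L u w)" for w
    proof -
      have L_eq: "L u w' = L u w" if "w' \<in> mod_const w" for w'
        using grad_mod_const[OF that, of s t] by (simp add: L_def)
      have "(\<Union>w'\<in>mod_const w. mod_const (L u w')) = (\<Union>w'\<in>mod_const w. mod_const (L u w))"
        by (rule SUP_cong[OF refl]) (simp add: L_eq)
      moreover have "mod_const w \<noteq> {}" using mod_const_self[of w] by blast
      ultimately show ?thesis by simp
    qed
    have "bij_betw (\<lambda>W. \<Union>w\<in>W. mod_const (L u w))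
            (mod_const ` harmonic_dirichlet s t (c u)) (mod_const ` harmonic_dirichlet s' t' (c' v))"
      unfolding bij_betw_def
    proof
      show "inj_on (\<lambda>W. \<Union>w\<in>W. mod_const (L u w)) (mod_const ` harmonic_dirichlet s t (c u))"
      proof (rule inj_onI)
        fix W1 W2 assume W: "W1 \<in> mod_const ` harmonic_dirichlet s t (c u)" "W2 \<in> mod_const ` harmonic_dirichlet s t (c u)"
          and eq: "(\<Union>w\<in>W1. mod_const (L u w)) = (\<Union>w\<in>W2. mod_const (L u w))"
        obtain w1 where w1: "w1 \<in> harmonic_dirichlet s t (c u)" "W1 = mod_const w1" using W by blast
        obtain w2 where w2: "w2 \<in> harmonic_dirichlet s t (c u)" "W2 = mod_const w2" using W by blast
        have "L u w1 \<in> mod_const (L u w2)" using eq w1 w2 Lmod mod_const_self by metis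
        then have "grad s' t' (L u w1) = grad s' t' (L u w2)" by (rule grad_mod_const)
        then have "c u e * grad s t w1 e = c u e * grad s t w2 e" for e using g w1 w2 by metis
        moreover have "c u e \<noteq> 0" for e using cc[of e] by auto
        ultimately have "grad s t w1 = grad s t w2" by auto
        then have "w1 \<in> mod_const w2" by (rule B.grad_eq_imp_mod_const)
        then show "W1 = W2" using w1 w2 mod_const_eq by simp
      qed
      show "(\<lambda>W. \<Union>w\<in>W. mod_const (L u w)) ` mod_const ` harmonic_dirichlet s t (c u) =
        mod_const ` harmonic_dirichlet s' t' (c' v)"
      proof (intro equalityI subsetI)
        fix W' assume "W' \<in> mod_const ` harmonic_dirichlet s' t' (c' v)"
        then obtain w' where w': "w' \<in> harmonic_dirichlet s' t' (c' v)" "W' = mod_const w'" by blast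
        have ws: "grad s' t' w' \<in> l2" using w' by (simp add: harmonic_dirichlet_def dirichlet_space_l2)
        have fZ: "(\<lambda>e. c' v e * grad s' t' w' e) \<in> B.Z"
          using B.mult_l2(1)[OF ws C'] w' c'_rv F.grad_rv
          by (simp add: B.Z_def harmonic_dirichlet_def)
        define w where "w = B.prim (\<lambda>e. c' v e * grad s' t' w' e)"
        have gw: "grad s t w = (\<lambda>e. c' v e * grad s' t' w' e)" unfolding w_def by (rule B.grad_prim[OF fZ])
        have cw: "c u e * grad s t w e = grad s' t' w' e" for e
          using cc[of e] unfolding gw by (metis mult.assoc mult_1)
        have "(\<Sum>e | s e = x. c u e * grad s t w e) = 0" for x
          using F.grad_sum[of w' x] by (simp only: cw)
        moreover have "grad s t w \<in> l2" using fZ B.sub by (auto simp: gw)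
        ultimately have wh: "w \<in> harmonic_dirichlet s t (c u)"
          by (simp add: harmonic_dirichlet_def dirichlet_space_l2)
        have "L u w \<in> mod_const w'" by (rule F.grad_eq_imp_mod_const) (simp only: g[OF wh] cw)
        from mod_const_eq[OF this] have "W' = (\<Union>w\<in>mod_const w. mod_const (L u w))" using Lmod[of w] w'(2) by simp
        then show "W' \<in> (\<lambda>W. \<Union>w\<in>W. mod_const (L u w)) ` mod_const ` harmonic_dirichlet s t (c u)" using wh by blast
      qed (use Lmod Lh in auto)
    qed
    moreover have "energy s' t' (c' v) (L u w) = energy s t (c u) w" if w: "w \<in> harmonic_dirichlet s t (c u)" for w
    proof -
      have "c' v e * (c u e * grad s t w e)\<^sup>2 = c u e * (grad s t w e)\<^sup>2" for e
      proof -
        have "c' v e * (c u e * grad s t w e)\<^sup>2 = (c u e * c' v e) * (c u e * (grad s t w e)\<^sup>2)"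
          by (simp add: power2_eq_square algebra_simps)
        then show ?thesis using cc[of e] by simp
      qed
      then show ?thesis by (simp add: energy_def g[OF w])
    qed
    ultimately show ?thesis by blast
  qed
  moreover have "finite_energy s t (c u) w" if "u \<in> A" "w \<in> harmonic_dirichlet s t (c u)" for u w
    using that c_bounded[OF that(1)] finite_en[of s t w "c u"]
    by (auto simp: harmonic_dirichlet_def dirichlet_space_l2)
  moreover have "finite_energy s' t' (c' v) w" if "v \<in> B" "w \<in> harmonic_dirichlet s' t' (c' v)" for v w
    using that c'_bounded[OF that(1)] finite_en[of s' t' w "c' v"]
    by (auto simp: harmonic_dirichlet_def dirichlet_space_l2)
  ultimately show ?thesis unfolding riemannian_isometry_def using bij by blast
qed

end

section \<open>Derivatives of the kite angles\<close>

text \<open>The weight \<open>c\<^sup>*\<close> with numerator and denominator divided by twice the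
  product of the radii, as a function of the logarithm of their ratio.\<close>

definition kite_weight :: "real \<Rightarrow> real \<Rightarrow> real" where
  "kite_weight \<theta> x = sin \<theta> / (cosh x - cos \<theta>)"

lemma cos_less_1: "0 < \<theta> \<Longrightarrow> \<theta> < pi \<Longrightarrow> cos \<theta> < 1"
  using cos_monotone_0_pi[of 0 \<theta>] by simp

lemma cosh_minus_cos_pos:
  fixes x :: real assumes "0 < \<theta>" "\<theta> < pi" shows "cosh x - cos \<theta> > 0"
  using cos_less_1[OF assms] cosh_real_ge_1[of x] by linarith

lemma DERIV_kite_angle:
  assumes t: "0 < \<theta>" "\<theta> < pi"
  shows "(kite_angle \<theta> has_real_derivative kite_weight \<theta> x / 2) (at x)"
proof -
  define E where "E = exp (- x)"
  have E: "E > 0" by (simp add: E_def)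
  have s: "sin \<theta> > 0" using t by (intro sin_gt_zero)
  have "sin \<theta> * sin \<theta> + cos \<theta> * cos \<theta> = 1" using sin_cos_squared_add[of \<theta>] by (simp add: power2_eq_square)
  then have sc: "cos \<theta> * cos \<theta> = 1 - sin \<theta> * sin \<theta>" by linarith
  have "cosh x = (inverse E + E) / 2" by (simp add: cosh_def E_def exp_minus)
  then have ch: "2 * E * (cosh x - cos \<theta>) = 1 + E * E - 2 * E * cos \<theta>" using E by (simp add: field_simps)
  have chp: "cosh x - cos \<theta> > 0" using cosh_minus_cos_pos[OF t] .
  have "1 + ((E - cos \<theta>) / sin \<theta>)\<^sup>2 = (1 + E * E - 2 * E * cos \<theta>) / (sin \<theta> * sin \<theta>)"
    using s by (simp add: power2_eq_square field_simps sc)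
  also have "\<dots> = 2 * E * (cosh x - cos \<theta>) / (sin \<theta> * sin \<theta>)" by (simp only: ch)
  finally have y: "1 + ((E - cos \<theta>) / sin \<theta>)\<^sup>2 = 2 * E * (cosh x - cos \<theta>) / (sin \<theta> * sin \<theta>)" .
  have "((\<lambda>x. pi / 2 - arctan ((exp (- x) - cos \<theta>) / sin \<theta>)) has_real_derivative
      inverse (1 + ((E - cos \<theta>) / sin \<theta>)\<^sup>2) * (E / sin \<theta>)) (at x)"
    unfolding E_def using less_imp_neq[OF s] by (auto intro!: derivative_eq_intros)
  moreover have "inverse (1 + ((E - cos \<theta>) / sin \<theta>)\<^sup>2) * (E / sin \<theta>) = kite_weight \<theta> x / 2"
  proof -
    have "sin \<theta> \<noteq> 0" "cosh x - cos \<theta> \<noteq> 0" "E \<noteq> 0" using s chp E by simp_all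
    then show ?thesis unfolding y kite_weight_def by (simp add: divide_simps)
  qed
  ultimately show ?thesis unfolding kite_angle_def[abs_def] arccot_def by (rule DERIV_cong)
qed

lemma DERIV_kite_weight:
  assumes t: "0 < \<theta>" "\<theta> < pi"
  shows "(kite_weight \<theta> has_real_derivative - (sin \<theta> * sinh x / (cosh x - cos \<theta>)\<^sup>2)) (at x)"
  unfolding kite_weight_def[abs_def] using cosh_minus_cos_pos[OF t, of x]
  by (auto intro!: derivative_eq_intros simp: power2_eq_square)

text \<open>The denominator is at least \<open>1 - cos \<epsilon>\<close> and also at least
  \<open>(1 - cos \<epsilon>) * cosh x\<close>; the second bound absorbs \<open>sinh x\<close>, so
  the estimates hold for arbitrary ratios of radii.\<close>

lemma kite_weight_bounds:
  assumes e: "0 < \<epsilon>" "\<epsilon> < pi / 2" and t: "\<epsilon> \<le> \<theta>" "\<theta> < pi"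
  shows "\<bar>kite_weight \<theta> x\<bar> \<le> 1 / (1 - cos \<epsilon>)"
    and "\<bar>sin \<theta> * sinh x / (cosh x - cos \<theta>)\<^sup>2\<bar> \<le> 1 / (1 - cos \<epsilon>)\<^sup>2"
proof -
  let ?m = "1 - cos \<epsilon>"
  have c0: "cos \<epsilon> > 0" using e by (intro cos_gt_zero) auto
  have m: "?m > 0" using cos_less_1[of \<epsilon>] e by simp
  have ce: "cos \<theta> \<le> cos \<epsilon>" using e t by (intro cos_monotone_0_pi_le) auto
  have ch1: "cosh x \<ge> 1" by (rule cosh_real_ge_1)
  have d: "cosh x - cos \<theta> \<ge> ?m" using ce ch1 by linarith
  have "cos \<epsilon> * 1 \<le> cos \<epsilon> * cosh x" using c0 ch1 by (intro mult_left_mono) auto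
  then have d': "cosh x - cos \<theta> \<ge> ?m * cosh x" using ce by (simp add: algebra_simps)
  have s: "0 \<le> sin \<theta>" "sin \<theta> \<le> 1" using e t by (auto intro: sin_ge_zero)
  show "\<bar>kite_weight \<theta> x\<bar> \<le> 1 / ?m"
    unfolding kite_weight_def using s d m by (simp add: frac_le)
  have sh: "\<bar>sinh x\<bar> \<le> cosh x"
    using sinh_le_cosh_real[of x] sinh_le_cosh_real[of "- x"] by (simp add: abs_le_iff)
  have "\<bar>sin \<theta> * sinh x\<bar> \<le> 1 * cosh x" unfolding abs_mult using s sh by (intro mult_mono) auto
  moreover have "?m * cosh x * ?m \<le> (cosh x - cos \<theta>) * (cosh x - cos \<theta>)"
    using d d' m ch1 by (intro mult_mono) auto
  ultimately have "\<bar>sin \<theta> * sinh x\<bar> / (cosh x - cos \<theta>)\<^sup>2 \<le> (1 * cosh x) / (?m * cosh x * ?m)"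
    using m ch1 unfolding power2_eq_square by (intro frac_le) auto
  also have "\<dots> = 1 / ?m\<^sup>2" using ch1 by (simp add: power2_eq_square)
  finally show "\<bar>sin \<theta> * sinh x / (cosh x - cos \<theta>)\<^sup>2\<bar> \<le> 1 / ?m\<^sup>2" by (simp add: abs_mult)
qed

lemma DERIV_kite_log:
  assumes t: "0 < \<theta>" "\<theta> < pi" and b: "0 < b" "b < pi - \<theta>"
  shows "(kite_log \<theta> has_real_derivative cot b + cot (pi - \<theta> - b)) (at b)"
proof -
  have s: "sin b > 0" "sin (b + \<theta>) > 0" using t b by (auto intro!: sin_gt_zero)
  have "(kite_log \<theta> has_real_derivative (cos b * sin (b + \<theta>) - sin b * cos (b + \<theta>)) / (sin (b + \<theta>) * sin (b + \<theta>)) /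
     (sin b / sin (b + \<theta>))) (at b)"
    unfolding kite_log_def[abs_def] using s by (auto intro!: derivative_eq_intros)
  moreover have "(cos b * sin (b + \<theta>) - sin b * cos (b + \<theta>)) / (sin (b + \<theta>) * sin (b + \<theta>)) / (sin b / sin (b + \<theta>)) =
     cot b - cot (b + \<theta>)"
    using s by (simp add: cot_def field_simps)
  moreover have "cot (pi - \<theta> - b) = - cot (b + \<theta>)"
  proof -
    have "pi - \<theta> - b = pi - (b + \<theta>)" by simp
    then show ?thesis unfolding cot_def by (simp only: sin_pi_minus cos_pi_minus)
  qed
  ultimately show ?thesis by simp
qed

text \<open>With \<open>b' = pi - \<theta> - b\<close>, the law of cosines in a triangle with angles
  \<open>b\<close>, \<open>b'\<close>, \<open>\<theta>\<close> and sides equal to their sines gives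
  \<open>2 * sin b * sin b' * (cosh x - cos \<theta>) = (sin \<theta>)\<^sup>2\<close>, while the
  sum of the cotangents is \<open>sin \<theta> / (sin b * sin b')\<close>.\<close>

lemma kite_weight_kite_log:
  assumes t: "0 < \<theta>" "\<theta> < pi" and b: "0 < b" "b < pi - \<theta>"
  shows "kite_weight \<theta> (kite_log \<theta> b) * ((cot b + cot (pi - \<theta> - b)) / 2) = 1"
proof -
  define b' where "b' = pi - \<theta> - b"
  have s: "sin b > 0" "sin b' > 0" "sin \<theta> > 0" using t b by (auto intro!: sin_gt_zero simp: b'_def)
  have th: "\<theta> = pi - (b + b')" by (simp add: b'_def)
  have sin_th: "sin \<theta> = sin b * cos b' + cos b * sin b'" unfolding th sin_pi_minus sin_add ..
  have cos_th: "cos \<theta> = sin b * sin b' - cos b * cos b'" unfolding th cos_pi_minus cos_add by simp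
  have "sin (b + \<theta>) = sin b'" unfolding th using sin_pi_minus[of b'] by (simp add: algebra_simps)
  then have ex: "exp (kite_log \<theta> b) = sin b / sin b'" using s by (simp add: kite_log_def)
  have "2 * cosh (kite_log \<theta> b) = sin b / sin b' + sin b' / sin b"
    unfolding cosh_def exp_minus ex by (simp add: field_simps)
  then have ch: "2 * sin b * sin b' * cosh (kite_log \<theta> b) = sin b * sin b + sin b' * sin b'"
    using s by (simp add: field_simps)
  have sq: "sin y * sin y + cos y * cos y = 1" for y :: real using sin_cos_squared_add[of y] by (simp add: power2_eq_square)
  have "2 * sin b * sin b' * (cosh (kite_log \<theta> b) - cos \<theta>) = sin b * sin b + sin b' * sin b' - 2 * sin b * sin b' * cos \<theta>"
    using ch by (simp add: algebra_simps)
  also have "\<dots> = sin \<theta> * sin \<theta>" unfolding sin_th cos_th using sq[of b] sq[of b'] by algebra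
  finally have main: "2 * sin b * sin b' * (cosh (kite_log \<theta> b) - cos \<theta>) = sin \<theta> * sin \<theta>" .
  have "cot b + cot b' = sin \<theta> / (sin b * sin b')" unfolding cot_def sin_th using s by (simp add: field_simps)
  then have "kite_weight \<theta> (kite_log \<theta> b) * ((cot b + cot b') / 2) =
     sin \<theta> * sin \<theta> / (2 * sin b * sin b' * (cosh (kite_log \<theta> b) - cos \<theta>))"
    by (simp add: kite_weight_def field_simps)
  also have "\<dots> = 1" unfolding main using s by simp
  finally show ?thesis by (simp add: b'_def)
qed

lemma cot_bound:
  assumes "0 < \<delta>" "\<delta> < pi / 2" "\<delta> \<le> y" "y \<le> pi - \<delta>"
  shows "\<bar>cot y\<bar> \<le> 1 / sin \<delta>" "inverse ((sin y)\<^sup>2) \<le> 1 / (sin \<delta>)\<^sup>2"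
proof -
  have d: "sin \<delta> > 0" using assms by (intro sin_gt_zero) auto
  have le: "sin \<delta> \<le> sin y" using assms by (intro sin_ge_sin_of_mem) auto
  show "\<bar>cot y\<bar> \<le> 1 / sin \<delta>" unfolding cot_def abs_divide using d le by (intro frac_le) auto
  have "(sin \<delta>)\<^sup>2 \<le> (sin y)\<^sup>2" using d le by (intro power_mono) auto
  then show "inverse ((sin y)\<^sup>2) \<le> 1 / (sin \<delta>)\<^sup>2" using d by (simp add: inverse_eq_divide frac_le)
qed

section \<open>The conjugation map\<close>

text \<open>Bookkeeping with classes, kept apart from the geometry: \<open>rel\<close> respects
  constants and determines each partner up to a constant, so the image of a class is again a full
  class.\<close>

lemma bij_betw_mod_const:
  assumes \<Phi>: "\<And>U. \<Phi> U = {v \<in> B. \<exists>u\<in>U. rel u v}"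
    and AB: "\<And>u. u \<in> A \<Longrightarrow> \<exists>v\<in>B. rel u v" and BA: "\<And>v. v \<in> B \<Longrightarrow> \<exists>u\<in>A. rel u v"
    and B_mod: "\<And>v v'. v \<in> B \<Longrightarrow> v' \<in> mod_const v \<Longrightarrow> v' \<in> B"
    and shift: "\<And>u v u' v'. rel u v \<Longrightarrow> u' \<in> mod_const u \<Longrightarrow> v' \<in> mod_const v \<Longrightarrow> rel u' v'"
    and right: "\<And>u v v'. v \<in> B \<Longrightarrow> v' \<in> B \<Longrightarrow> rel u v \<Longrightarrow> rel u v' \<Longrightarrow> v' \<in> mod_const v"
    and left: "\<And>u u' v. v \<in> B \<Longrightarrow> rel u v \<Longrightarrow> rel u' v \<Longrightarrow> u' \<in> mod_const u"
  shows "bij_betw \<Phi> (mod_const ` A) (mod_const ` B)"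
    and "\<And>u v. v \<in> \<Phi> (mod_const u) \<Longrightarrow> v \<in> B \<and> rel u v"
proof -
  have fibre: "\<Phi> (mod_const u) = mod_const v" if "v \<in> B" "rel u v" for u v
  proof (intro equalityI subsetI)
    fix v' assume "v' \<in> \<Phi> (mod_const u)"
    then obtain u' where u': "v' \<in> B" "u' \<in> mod_const u" "rel u' v'" unfolding \<Phi> by blast
    have "rel u v'" using shift[OF u'(3) mod_const_sym[OF u'(2)] mod_const_self] .
    then show "v' \<in> mod_const v" using right that u'(1) by blast
  next
    fix v' assume v': "v' \<in> mod_const v"
    then show "v' \<in> \<Phi> (mod_const u)" unfolding \<Phi>
      using B_mod[OF that(1) v'] shift[OF that(2) mod_const_self v'] mod_const_self by blast
  qed
  show "v \<in> B \<and> rel u v" if v: "v \<in> \<Phi> (mod_const u)" for u v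
  proof -
    obtain u' where u': "v \<in> B" "u' \<in> mod_const u" "rel u' v" using v unfolding \<Phi> by blast
    then show ?thesis using shift[OF u'(3) mod_const_sym[OF u'(2)] mod_const_self] by blast
  qed
  show "bij_betw \<Phi> (mod_const ` A) (mod_const ` B)" unfolding bij_betw_def
  proof
    show "inj_on \<Phi> (mod_const ` A)"
    proof (rule inj_onI)
      fix U U' assume "U \<in> mod_const ` A" "U' \<in> mod_const ` A" and eq: "\<Phi> U = \<Phi> U'"
      then obtain u u' where u: "u \<in> A" "U = mod_const u" and u': "u' \<in> A" "U' = mod_const u'" by blast
      obtain v where v: "v \<in> B" "rel u v" using AB[OF u(1)] by blast
      have "v \<in> \<Phi> (mod_const u')" using fibre[OF v] eq u u' mod_const_self by blast
      then obtain u'' where u'': "u'' \<in> mod_const u'" "rel u'' v" unfolding \<Phi> by blast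
      have "rel u' v" using shift[OF u''(2) mod_const_sym[OF u''(1)] mod_const_self] .
      then have "u' \<in> mod_const u" using left v by blast
      then show "U = U'" using mod_const_eq[of u' u] u u' by simp
    qed
    show "\<Phi> ` mod_const ` A = mod_const ` B"
    proof (intro equalityI subsetI)
      fix W assume "W \<in> \<Phi> ` mod_const ` A"
      then obtain u where u: "u \<in> A" "W = \<Phi> (mod_const u)" by blast
      obtain v where v: "v \<in> B" "rel u v" using AB[OF u(1)] by blast
      then show "W \<in> mod_const ` B" using fibre[OF v] u by blast
    next
      fix W assume "W \<in> mod_const ` B"
      then obtain v where v: "v \<in> B" "W = mod_const v" by blast
      obtain u where u: "u \<in> A" "rel u v" using BA[OF v(1)] by blast
      have "\<Phi> (mod_const u) = W" using fibre[OF v(1) u(2)] v(2) by simp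
      then show "W \<in> \<Phi> ` mod_const ` A" using u(1) by blast
    qed
  qed
qed

lemma l2_finite_large:
  assumes f: "f \<in> l2" and d: "\<delta> > 0"
  shows "finite {e. \<bar>f e\<bar> \<ge> \<delta>}"
proof (rule ccontr)
  assume inf: "infinite {e. \<bar>f e\<bar> \<ge> \<delta>}"
  obtain n :: nat where n: "l2_sq f / \<delta>\<^sup>2 < real n" using reals_Archimedean2 by blast
  obtain F where F: "F \<subseteq> {e. \<bar>f e\<bar> \<ge> \<delta>}" "finite F" "card F = n"
    using infinite_arbitrarily_large[OF inf] by blast
  have "real n * \<delta>\<^sup>2 = (\<Sum>e\<in>F. \<delta>\<^sup>2)" by (simp add: F)
  also have "\<dots> \<le> (\<Sum>e\<in>F. (f e)\<^sup>2)"
  proof (rule sum_mono)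
    fix e assume "e \<in> F"
    then have "\<delta>\<^sup>2 \<le> \<bar>f e\<bar>\<^sup>2" using F(1) d by (intro power_mono) auto
    then show "\<delta>\<^sup>2 \<le> (f e)\<^sup>2" by simp
  qed
  also have "\<dots> \<le> l2_sq f" unfolding l2_sq_def using f F(2) by (intro finite_sum_le_infsum) (auto simp: l2_def)
  finally show False using n d by (simp add: field_simps)
qed

text \<open>Cochains of the graph and of its dual are functions on the same oriented edges.
  Gradients sum to 0 around faces and vertices because \<open>nxt\<close> permutes the edges of a
  face and \<open>rho\<close> those at a vertex.\<close>

sublocale bounded_disk_complex \<subseteq> dual_cochains "rv G" "lface G" "rface G" "src G" "trg G"
proof (intro dual_cochains.intro cochain_duality.intro)
  show "(\<Sum>e | lface G e = x. grad (src G) (trg G) v e) = 0" for x v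
    using sum.reindex_bij_betw[OF bij_nxt_face, of "\<lambda>e. v (src G e)" x] by (simp add: grad_def sum_subtractf)
  show "(\<Sum>e | src G e = x. grad (lface G) (rface G) v e) = 0" for x v
    using sum.reindex_bij_betw[OF bij_rho, of "\<lambda>e. v (lface G e)" x] by (simp add: grad_def sum_subtractf)
  show "\<exists>v. grad (src G) (trg G) v = f"
    if "\<And>e. f (rv G e) = - f e" "\<And>x. (\<Sum>e | lface G e = x. f e) = 0" for f
    using cocycle_exact[OF that] by (auto simp: grad_def fun_eq_iff)
  show "\<exists>v. grad (lface G) (rface G) v = f"
    if "\<And>e. f (rv G e) = - f e" "\<And>x. (\<Sum>e | src G e = x. f e) = 0" for f
    using dual_cocycle_exact[OF that] by (auto simp: grad_def fun_eq_iff)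
  show "v y = v y'" if "grad (src G) (trg G) v = (\<lambda>e. 0)" for v y y'
    by (rule gradient_eq_0_imp_constant) (use fun_cong[OF that] in \<open>simp add: grad_def\<close>)
  show "v y = v y'" if "grad (lface G) (rface G) v = (\<lambda>e. 0)" for v y y'
    by (rule dual_gradient_eq_0_imp_constant) (use fun_cong[OF that] in \<open>simp add: grad_def\<close>)
qed (simp_all add: finite_lface finite_src)

lemma (in angled_complex) uniformizing_half_angles_bounded_below:
  assumes "one_ended G" "uniformizing G \<Theta> R"
  shows "\<exists>\<delta>>0. \<forall>e. \<delta> \<le> half_angle G \<Theta> R e"
proof -
  obtain z w where "developing_map G \<Theta> R z w"
    "\<And>e e'. e \<noteq> e' \<Longrightarrow> interior (developed_triangle G z w e) \<inter> interior (developed_triangle G z w e') = {}"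
    "R \<in> pattern_radii G \<Theta>"
    using assms(2) unfolding uniformizing_def by blast
  then interpret developed_pattern G \<Theta> \<epsilon>\<^sub>0 R z w
    using assms(1) by unfold_locales auto
  show ?thesis by (rule half_angles_bounded_below)
qed

section \<open>The edge functions of the conjugation map and their uniform bounds\<close>

locale uniformized_pattern = angled_complex G \<Theta> \<epsilon>\<^sub>0
  for G :: "('v, 'e, 'f, 'p::topological_space) cell_complex" and \<Theta> \<epsilon>\<^sub>0 +
  fixes R\<^sub>0 :: "'f \<Rightarrow> real"
  assumes one_end: "one_ended G" and unif: "uniformizing G \<Theta> R\<^sub>0"
begin

abbreviation "\<alpha> \<equiv> half_angle G \<Theta> R\<^sub>0"
abbreviation "gradF \<equiv> grad (lface G) (rface G)"
abbreviation "gradV \<equiv> grad (src G) (trg G)"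

lemma R0_pos: "R\<^sub>0 f > 0" and alpha_sum: "(\<Sum>e | lface G e = f. \<alpha> e) = pi"
  using unif by (auto simp: uniformizing_def pattern_radii_def)

lemmas alpha_bounds = half_angle_bounds[of R\<^sub>0, OF R0_pos]
lemmas alpha_rv = half_angle_rv[of R\<^sub>0, OF R0_pos]

lemmas alpha_bounded_below = uniformizing_half_angles_bounded_below[OF one_end unif]

definition X where "X e = ln (R\<^sub>0 (rface G e)) - ln (R\<^sub>0 (lface G e))"

lemma X_rv: "X (rv G e) = - X e"
  by (simp add: X_def)

lemma kite_angle_X: "kite_angle (\<Theta> e) (X e) = \<alpha> e"
  using half_angle_kite[of R\<^sub>0, OF R0_pos] by (simp add: X_def)

lemma kite_log_alpha: "kite_log (\<Theta> e) (\<alpha> e) = X e"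
  using kite_log_angle[OF Theta_pos[of e], of "X e"] by (simp add: kite_angle_X)

lemma X_sum: "(\<Sum>e | src G e = i. X e) = 0"
  using B.grad_sum[of "\<lambda>f. ln (R\<^sub>0 f)" i] by (simp add: grad_def X_def)

text \<open>Conjugate \<open>u\<close> and \<open>v\<close> have \<open>gradV v = N (gradF u)\<close> and \<open>gradF u = M (gradV v)\<close>, edge by edge; the derivatives
  \<open>N'\<close> and \<open>M'\<close> are the weights \<open>c\<^sup>*\<close> and \<open>c\<close>.\<close>

definition N where "N e h = 2 * (kite_angle (\<Theta> e) (X e + h) - \<alpha> e)"
definition N' where "N' e h = kite_weight (\<Theta> e) (X e + h)"
definition M where "M e k = kite_log (\<Theta> e) (\<alpha> e + k / 2) - X e"
definition M' where "M' e k = (cot (\<alpha> e + k / 2) + cot (pi - \<Theta> e - (\<alpha> e + k / 2))) / 2"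

definition admissible :: "('v \<Rightarrow> real) \<Rightarrow> bool" where
  "admissible v \<longleftrightarrow> (\<forall>e. 0 < \<alpha> e + gradV v e / 2 \<and> \<alpha> e + gradV v e / 2 < pi - \<Theta> e)"

lemma N_M: "admissible v \<Longrightarrow> N e (M e (gradV v e)) = gradV v e"
  using kite_angle_log[OF Theta_pos[of e], of "\<alpha> e + gradV v e / 2"] by (simp add: N_def M_def admissible_def)

lemma M_N: "M e (N e h) = h"
  using kite_log_angle[OF Theta_pos[of e], of "X e + h"] by (simp add: N_def M_def diff_divide_distrib)

lemma admissible_N: "gradV v = (\<lambda>e. N e (h e)) \<Longrightarrow> admissible v"
  unfolding admissible_def using kite_angle_bounds[OF Theta_pos] by (simp add: N_def diff_divide_distrib)

lemma pattern_radii_iff: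
  "(\<lambda>f. exp (u f) * R\<^sub>0 f) \<in> pattern_radii G \<Theta> \<longleftrightarrow>
    (\<forall>f. (\<Sum>e | lface G e = f. kite_angle (\<Theta> e) (X e + gradF u e)) = pi)"
proof -
  have pos: "exp (u f) * R\<^sub>0 f > 0" for f using R0_pos by simp
  have "half_angle G \<Theta> (\<lambda>f. exp (u f) * R\<^sub>0 f) e = kite_angle (\<Theta> e) (X e + gradF u e)" for e
  proof -
    have "ln (exp (u f) * R\<^sub>0 f) = u f + ln (R\<^sub>0 f)" for f using R0_pos[of f] by (simp add: ln_mult)
    then show ?thesis
      unfolding half_angle_kite[of "\<lambda>f. exp (u f) * R\<^sub>0 f", OF pos] by (simp add: X_def grad_def algebra_simps)
  qed
  then show ?thesis using pos by (simp add: pattern_radii_def)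
qed

lemma P_radii_iff:
  "u \<in> P_radii G \<Theta> R\<^sub>0 \<longleftrightarrow> gradF u \<in> l2 \<and> (\<forall>f. (\<Sum>e | lface G e = f. kite_angle (\<Theta> e) (X e + gradF u e)) = pi)"
  by (simp add: P_radii_def dirichlet_space_l2 pattern_radii_iff)

lemma sin_alpha_rv:
  "sin (\<alpha> (rv G e) - k / 2) = sin (\<alpha> e + k / 2 + \<Theta> e)"
  using sin_pi_minus[of "\<alpha> e + k / 2 + \<Theta> e"] by (simp add: alpha_rv algebra_simps)

lemma P_angles_iff:
  "v \<in> P_angles G \<alpha> \<longleftrightarrow> gradV v \<in> l2 \<and> admissible v \<and>
     (\<forall>i. (\<Sum>e | src G e = i. kite_log (\<Theta> e) (\<alpha> e + gradV v e / 2)) = 0)"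
proof -
  have "\<alpha> (rv G e) - k / 2 > 0 \<longleftrightarrow> \<alpha> e + k / 2 < pi - \<Theta> e" for e k by (auto simp: alpha_rv)
  then show ?thesis
    unfolding P_angles_def admissible_def dirichlet_space_l2 grad_def[symmetric] kite_log_def sin_alpha_rv by simp
qed

lemma conjugate_iff:
  assumes v: "admissible v"
  shows "conjugate G \<alpha> u v \<longleftrightarrow> gradV v = (\<lambda>e. N e (gradF u e))"
proof -
  have eq: "ln ((sin (\<alpha> e + (v (trg G e) - v (src G e)) / 2) * sin (\<alpha> (rv G e)))
        / (sin (\<alpha> (rv G e) + (v (src G e) - v (trg G e)) / 2) * sin (\<alpha> e))) = M e (gradV v e)" for e
  proof -
    let ?k = "gradV v e"
    have b: "0 < \<alpha> e + ?k / 2" "\<alpha> e + ?k / 2 < pi - \<Theta> e" using v by (simp_all add: admissible_def)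
    have s: "sin (\<alpha> e + ?k / 2) > 0" "sin (\<alpha> e + ?k / 2 + \<Theta> e) > 0" "sin (\<alpha> e) > 0" "sin (\<alpha> e + \<Theta> e) > 0"
      using b alpha_bounds[of e] Theta_pos[of e] by (auto intro!: sin_gt_zero)
    have 1: "sin (\<alpha> (rv G e) + (v (src G e) - v (trg G e)) / 2) = sin (\<alpha> e + ?k / 2 + \<Theta> e)"
      using sin_alpha_rv[of e ?k] by (simp add: grad_def diff_divide_distrib add_diff_eq diff_diff_eq2)
    have 2: "sin (\<alpha> (rv G e)) = sin (\<alpha> e + \<Theta> e)" using sin_alpha_rv[of e 0] by simp
    have "M e ?k = kite_log (\<Theta> e) (\<alpha> e + ?k / 2) - kite_log (\<Theta> e) (\<alpha> e)" by (simp add: M_def kite_log_alpha)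
    also have "\<dots> = ln ((sin (\<alpha> e + ?k / 2) * sin (\<alpha> e + \<Theta> e)) / (sin (\<alpha> e + ?k / 2 + \<Theta> e) * sin (\<alpha> e)))"
      using s by (simp add: kite_log_def ln_div ln_mult)
    finally show ?thesis unfolding 1 2 by (simp add: grad_def)
  qed
  have "conjugate G \<alpha> u v \<longleftrightarrow> (\<forall>e. gradF u e = M e (gradV v e))"
    unfolding conjugate_def eq by (simp add: grad_def)
  also have "\<dots> \<longleftrightarrow> (\<forall>e. gradV v e = N e (gradF u e))"
    using N_M[OF v] M_N by metis
  finally show ?thesis by (simp add: fun_eq_iff)
qed

lemma weight_bound_constants: "\<epsilon>\<^sub>0 \<le> \<Theta> e" "\<Theta> e < pi"
  using Theta_bounds(1)[of e] Theta_pos(2)[of e] by auto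

lemma DERIV_N: "(N e has_real_derivative N' e y) (at y)"
proof -
  have "((\<lambda>h. kite_angle (\<Theta> e) (X e + h)) has_real_derivative kite_weight (\<Theta> e) (X e + y) / 2 * 1) (at y)"
    by (rule DERIV_chain'[OF _ DERIV_kite_angle[OF Theta_pos]]) (auto intro!: derivative_eq_intros)
  then show ?thesis unfolding N_def[abs_def] N'_def by (auto intro!: derivative_eq_intros)
qed

lemma N'_bound: "\<bar>N' e y\<bar> \<le> 1 / (1 - cos \<epsilon>\<^sub>0)"
  unfolding N'_def by (rule kite_weight_bounds(1)[OF eps eps_lt weight_bound_constants])

lemma N_C11: "uniformly_C11 N N' x"
proof (rule uniformly_C11I[where \<rho> = 1 and C = "max (1 / (1 - cos \<epsilon>\<^sub>0)) (1 / (1 - cos \<epsilon>\<^sub>0)\<^sup>2)"])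
  show "(N' e has_real_derivative - (sin (\<Theta> e) * sinh (X e + y) / (cosh (X e + y) - cos (\<Theta> e))\<^sup>2)) (at y)" for e y
  proof -
    have "((\<lambda>h. kite_weight (\<Theta> e) (X e + h)) has_real_derivative
        - (sin (\<Theta> e) * sinh (X e + y) / (cosh (X e + y) - cos (\<Theta> e))\<^sup>2) * 1) (at y)"
      by (rule DERIV_chain'[OF _ DERIV_kite_weight[OF Theta_pos]]) (auto intro!: derivative_eq_intros)
    then show ?thesis by (simp add: N'_def[abs_def])
  qed
  show "\<bar>- (sin (\<Theta> e) * sinh (X e + y) / (cosh (X e + y) - cos (\<Theta> e))\<^sup>2)\<bar>
      \<le> max (1 / (1 - cos \<epsilon>\<^sub>0)) (1 / (1 - cos \<epsilon>\<^sub>0)\<^sup>2)" for e y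
    unfolding abs_minus_cancel
    by (rule order_trans[OF kite_weight_bounds(2)[OF eps eps_lt weight_bound_constants] max.cobounded2])
  show "\<bar>N' e (x e)\<bar> \<le> max (1 / (1 - cos \<epsilon>\<^sub>0)) (1 / (1 - cos \<epsilon>\<^sub>0)\<^sup>2)" for e
    by (rule order_trans[OF N'_bound max.cobounded1])
qed (use DERIV_N in simp_all)

text \<open>\<open>N e\<close> vanishes at 0, so its derivative bound alone keeps the image of a
  square-summable gradient square-summable.\<close>

lemma N_lipschitz: "\<bar>N e h\<bar> \<le> 1 / (1 - cos \<epsilon>\<^sub>0) * \<bar>h\<bar>"
proof -
  have "\<bar>N e h - N e 0\<bar> \<le> 1 / (1 - cos \<epsilon>\<^sub>0) * \<bar>h - 0\<bar>"
    by (rule lipschitz_from_derivative[OF DERIV_N N'_bound])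
  then show ?thesis by (simp add: N_def kite_angle_X)
qed

text \<open>Except on finitely many edges the gradient is below the Ring Lemma bound, and half of it
  moves the half-angle by less than half of that bound. The remaining edges contribute a positive
  minimum. Upper bounds are lower bounds for the reversed edge.\<close>

lemma P_angles_margin:
  assumes v: "v \<in> P_angles G \<alpha>"
  shows "\<exists>\<delta>>0. \<forall>e. \<delta> \<le> \<alpha> e \<and> \<alpha> e \<le> pi - \<Theta> e - \<delta> \<and>
    \<delta> \<le> \<alpha> e + gradV v e / 2 \<and> \<alpha> e + gradV v e / 2 \<le> pi - \<Theta> e - \<delta>"
proof -
  have g: "gradV v \<in> l2" "admissible v" using v by (simp_all add: P_angles_iff)
  obtain \<delta>0 where \<delta>0: "\<delta>0 > 0" "\<And>e. \<delta>0 \<le> \<alpha> e" using alpha_bounded_below by blast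
  define F where "F = {e. \<bar>gradV v e\<bar> \<ge> \<delta>0}"
  have F: "finite F" unfolding F_def by (rule l2_finite_large[OF g(1) \<delta>0(1)])
  define b where "b e = \<alpha> e + gradV v e / 2" for e
  define \<delta> where "\<delta> = Min (insert (\<delta>0 / 2) (b ` F))"
  have \<delta>: "\<delta> > 0" unfolding \<delta>_def using F \<delta>0(1) g(2) by (auto simp: admissible_def b_def)
  have \<delta>_le: "\<delta> \<le> \<delta>0 / 2" unfolding \<delta>_def by (rule Min_le) (use F in auto)
  have \<delta>_le_b: "\<delta> \<le> b e" if "e \<in> F" for e unfolding \<delta>_def by (rule Min_le) (use F that in auto)
  have lo: "\<delta> \<le> b e" for e
  proof (cases "e \<in> F")
    case False
    then have "\<bar>gradV v e\<bar> < \<delta>0" by (simp add: F_def)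
    then show ?thesis using \<delta>_le \<delta>0(2)[of e] unfolding b_def by linarith
  qed (use \<delta>_le_b in simp)
  have lo': "\<delta> \<le> \<alpha> e" for e using \<delta>_le \<delta>0(1) \<delta>0(2)[of e] by linarith
  have "b (rv G e) = pi - \<Theta> e - b e" for e by (simp add: b_def alpha_rv F.grad_rv)
  then have "b e \<le> pi - \<Theta> e - \<delta>" for e using lo[of "rv G e"] by simp
  moreover have "\<alpha> e \<le> pi - \<Theta> e - \<delta>" for e using lo'[of "rv G e"] by (simp add: alpha_rv)
  ultimately show ?thesis using \<delta> lo lo' unfolding b_def by (intro exI[of _ \<delta>]) simp
qed

lemma M'_bounds:
  assumes \<delta>: "\<delta> > 0" and b: "\<delta> \<le> \<alpha> e + k / 2" "\<alpha> e + k / 2 \<le> pi - \<Theta> e - \<delta>"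
  shows "(M e has_real_derivative M' e k) (at k)"
    and "(M' e has_real_derivative (inverse ((sin (pi - \<Theta> e - (\<alpha> e + k / 2)))\<^sup>2) - inverse ((sin (\<alpha> e + k / 2))\<^sup>2)) / 4) (at k)"
    and "\<bar>M' e k\<bar> \<le> 1 / sin \<delta>"
    and "\<bar>(inverse ((sin (pi - \<Theta> e - (\<alpha> e + k / 2)))\<^sup>2) - inverse ((sin (\<alpha> e + k / 2))\<^sup>2)) / 4\<bar> \<le> 1 / (sin \<delta>)\<^sup>2"
proof -
  let ?b = "\<alpha> e + k / 2" and ?b' = "pi - \<Theta> e - (\<alpha> e + k / 2)"
  have t: "0 < \<Theta> e" "\<Theta> e < pi" by (rule Theta_pos)+
  have \<delta>2: "\<delta> < pi / 2" using b t by linarith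
  have mem: "\<delta> \<le> ?b" "?b \<le> pi - \<delta>" "\<delta> \<le> ?b'" "?b' \<le> pi - \<delta>" using b t by linarith+
  have s: "sin ?b > 0" "sin ?b' > 0" using mem \<delta> by (auto intro!: sin_gt_zero)
  have "((\<lambda>k. kite_log (\<Theta> e) (\<alpha> e + k / 2)) has_real_derivative (cot ?b + cot ?b') * (1 / 2)) (at k)"
    by (rule DERIV_chain'[OF _ DERIV_kite_log[OF t]]) (use b \<delta> in \<open>auto intro!: derivative_eq_intros\<close>)
  then show "(M e has_real_derivative M' e k) (at k)"
    unfolding M_def[abs_def] M'_def by (auto intro!: derivative_eq_intros)
  have c1: "((\<lambda>k. cot (\<alpha> e + k / 2)) has_real_derivative - inverse ((sin ?b)\<^sup>2) * (1 / 2)) (at k)"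
    by (rule DERIV_chain'[OF _ DERIV_cot]) (use s in \<open>auto intro!: derivative_eq_intros\<close>)
  have c2: "((\<lambda>k. cot (pi - \<Theta> e - (\<alpha> e + k / 2))) has_real_derivative - inverse ((sin ?b')\<^sup>2) * (- 1 / 2)) (at k)"
    by (rule DERIV_chain'[OF _ DERIV_cot]) (use s in \<open>auto intro!: derivative_eq_intros\<close>)
  show "(M' e has_real_derivative (inverse ((sin ?b')\<^sup>2) - inverse ((sin ?b)\<^sup>2)) / 4) (at k)"
    unfolding M'_def[abs_def]
    by (rule DERIV_cong[OF DERIV_cdivide[OF DERIV_add[OF c1 c2]]]) (simp add: field_simps)
  note c = cot_bound[OF \<delta> \<delta>2 mem(1,2)] cot_bound[OF \<delta> \<delta>2 mem(3,4)]
  have mean: "\<bar>(x + y) / 2\<bar> \<le> C" if "\<bar>x\<bar> \<le> C" "\<bar>y\<bar> \<le> C" for x y C :: real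
    using that by (simp add: abs_le_iff)
  show "\<bar>M' e k\<bar> \<le> 1 / sin \<delta>" unfolding M'_def by (rule mean[OF c(1,3)])
  have diff: "\<bar>(y - x) / 4\<bar> \<le> C" if "x \<le> C" "y \<le> C" "x \<ge> 0" "y \<ge> 0" for x y C :: real
    using that by (simp add: abs_le_iff)
  show "\<bar>(inverse ((sin ?b')\<^sup>2) - inverse ((sin ?b)\<^sup>2)) / 4\<bar> \<le> 1 / (sin \<delta>)\<^sup>2"
    by (rule diff[OF c(2,4)]) simp_all
qed

lemma M_C11:
  assumes v: "v \<in> P_angles G \<alpha>" shows "uniformly_C11 M M' (gradV v)"
proof -
  obtain \<delta> where \<delta>: "\<delta> > 0" "\<And>e. \<delta> \<le> \<alpha> e + gradV v e / 2" "\<And>e. \<alpha> e + gradV v e / 2 \<le> pi - \<Theta> e - \<delta>"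
    using P_angles_margin[OF v] by blast
  have \<delta>': "\<delta> / 2 > 0" using \<delta>(1) by simp
  \<comment> \<open>A change of the gradient by \<open>\<delta>\<close> moves the half-angle by
    \<open>\<delta> / 2\<close> only, so half of the margin is left.\<close>
  have near: "\<delta> / 2 \<le> \<alpha> e + y / 2" "\<alpha> e + y / 2 \<le> pi - \<Theta> e - \<delta> / 2" if "\<bar>y - gradV v e\<bar> \<le> \<delta>" for e y
    using that \<delta>(2)[of e] \<delta>(3)[of e] by linarith+
  show ?thesis
  proof (rule uniformly_C11I[OF \<delta>(1), where C = "max (1 / sin (\<delta> / 2)) (1 / (sin (\<delta> / 2))\<^sup>2)"])
    show "\<bar>M' e (gradV v e)\<bar> \<le> max (1 / sin (\<delta> / 2)) (1 / (sin (\<delta> / 2))\<^sup>2)" for e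
      by (rule order_trans[OF M'_bounds(3)[OF \<delta>' near] max.cobounded1]) (use \<delta>(1) in simp_all)
    fix e y assume y: "\<bar>y - gradV v e\<bar> \<le> \<delta>"
    show "(M e has_real_derivative M' e y) (at y)" by (rule M'_bounds(1)[OF \<delta>' near[OF y]])
    show "(M' e has_real_derivative (inverse ((sin (pi - \<Theta> e - (\<alpha> e + y / 2)))\<^sup>2) - inverse ((sin (\<alpha> e + y / 2))\<^sup>2)) / 4) (at y)"
      by (rule M'_bounds(2)[OF \<delta>' near[OF y]])
    show "\<bar>(inverse ((sin (pi - \<Theta> e - (\<alpha> e + y / 2)))\<^sup>2) - inverse ((sin (\<alpha> e + y / 2))\<^sup>2)) / 4\<bar>
        \<le> max (1 / sin (\<delta> / 2)) (1 / (sin (\<delta> / 2))\<^sup>2)"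
      by (rule order_trans[OF M'_bounds(4)[OF \<delta>' near[OF y]] max.cobounded2])
  qed
qed

text \<open>The half-angles of both patterns add up to \<open>pi\<close> on each face, so
  \<open>N\<close> of the gradient is closed and has a primitive \<open>v\<close>. The vertex
  equation for \<open>v\<close> holds because the logarithms of the ratios of the new radii are a
  gradient on the dual graph.\<close>

lemma conjugate_angles_exist:
  assumes u: "u \<in> P_radii G \<Theta> R\<^sub>0"
  shows "\<exists>v\<in>P_angles G \<alpha>. conjugate G \<alpha> u v"
proof -
  have g: "gradF u \<in> l2" "\<And>f. (\<Sum>e | lface G e = f. kite_angle (\<Theta> e) (X e + gradF u e)) = pi"
    using u by (simp_all add: P_radii_iff)
  have "\<exists>v. gradV v = (\<lambda>e. N e (gradF u e))"
  proof (rule F.exact)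
    fix e
    have "kite_angle (\<Theta> e) (- (X e + gradF u e)) = pi - \<Theta> e - kite_angle (\<Theta> e) (X e + gradF u e)"
      by (rule kite_angle_reflect[OF Theta_pos])
    then show "N (rv G e) (gradF u (rv G e)) = - N e (gradF u e)"
      by (simp add: N_def X_rv B.grad_rv alpha_rv)
  next
    show "(\<Sum>e | lface G e = f. N e (gradF u e)) = 0" for f
      by (simp add: N_def sum_distrib_left[symmetric] sum_subtractf g alpha_sum)
  qed
  then obtain v where v: "gradV v = (\<lambda>e. N e (gradF u e))" by blast
  have adm: "admissible v" by (rule admissible_N[OF v])
  have "gradV v \<in> l2" unfolding v by (rule l2_dominated(1)[OF g(1) N_lipschitz])
  moreover have "kite_log (\<Theta> e) (\<alpha> e + gradV v e / 2) = X e + gradF u e" for e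
    using M_N[of e "gradF u e"] by (simp add: M_def v)
  then have "(\<Sum>e | src G e = i. kite_log (\<Theta> e) (\<alpha> e + gradV v e / 2)) = 0" for i
    by (simp add: sum.distrib X_sum B.grad_sum)
  ultimately have "v \<in> P_angles G \<alpha>" using adm by (simp add: P_angles_iff)
  then show ?thesis using conjugate_iff[OF adm] v by blast
qed

text \<open>The vertex equations make \<open>M\<close> of the gradient closed around vertices. It is
  square-summable because 0 and \<open>gradV v e\<close> both respect the margin, hence so does the
  interval between them, where \<open>M'\<close> is bounded.\<close>

lemma conjugate_radii_exist:
  assumes v: "v \<in> P_angles G \<alpha>"
  shows "\<exists>u\<in>P_radii G \<Theta> R\<^sub>0. conjugate G \<alpha> u v"
proof -
  have g: "gradV v \<in> l2" "admissible v" "\<And>i. (\<Sum>e | src G e = i. kite_log (\<Theta> e) (\<alpha> e + gradV v e / 2)) = 0"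
    using v by (simp_all add: P_angles_iff)
  have b: "0 < \<alpha> e + gradV v e / 2" "\<alpha> e + gradV v e / 2 < pi - \<Theta> e" for e using g(2) by (simp_all add: admissible_def)
  have "\<exists>u. gradF u = (\<lambda>e. M e (gradV v e))"
  proof (rule B.exact)
    fix e
    have "\<alpha> (rv G e) + gradV v (rv G e) / 2 = pi - \<Theta> e - (\<alpha> e + gradV v e / 2)"
      by (simp add: alpha_rv F.grad_rv)
    then show "M (rv G e) (gradV v (rv G e)) = - M e (gradV v e)"
      using kite_log_reflect[OF Theta_pos b, of e] by (simp add: M_def X_rv)
  next
    show "(\<Sum>e | src G e = i. M e (gradV v e)) = 0" for i
      by (simp add: M_def sum_subtractf g X_sum)
  qed
  then obtain u where u: "gradF u = (\<lambda>e. M e (gradV v e))" by blast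
  have N_eq: "gradV v = (\<lambda>e. N e (gradF u e))" using N_M[OF g(2)] by (simp add: u)
  obtain \<delta> where \<delta>: "\<delta> > 0" "\<And>e. \<delta> \<le> \<alpha> e" "\<And>e. \<alpha> e \<le> pi - \<Theta> e - \<delta>"
    "\<And>e. \<delta> \<le> \<alpha> e + gradV v e / 2" "\<And>e. \<alpha> e + gradV v e / 2 \<le> pi - \<Theta> e - \<delta>"
    using P_angles_margin[OF v] by blast
  have "\<bar>M e (gradV v e)\<bar> \<le> 1 / sin \<delta> * \<bar>gradV v e\<bar>" for e
  proof -
    have "\<bar>M e (gradV v e) - M e 0\<bar> \<le> 1 / sin \<delta> * \<bar>gradV v e - 0\<bar>"
    proof (rule lipschitz_from_derivative[where f' = "M' e"])
      fix y assume y: "min 0 (gradV v e) \<le> y" "y \<le> max 0 (gradV v e)"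
      have yb: "\<delta> \<le> \<alpha> e + y / 2" "\<alpha> e + y / 2 \<le> pi - \<Theta> e - \<delta>"
        using y \<delta>(2-5)[of e] by (auto simp: min_def max_def split: if_splits)
      show "(M e has_real_derivative M' e y) (at y)" by (rule M'_bounds(1)[OF \<delta>(1) yb])
      show "\<bar>M' e y\<bar> \<le> 1 / sin \<delta>" by (rule M'_bounds(3)[OF \<delta>(1) yb])
    qed
    then show ?thesis by (simp add: M_def kite_log_alpha)
  qed
  then have "gradF u \<in> l2" unfolding u by (rule l2_dominated(1)[OF g(1)])
  moreover have "kite_angle (\<Theta> e) (X e + gradF u e) = \<alpha> e + gradV v e / 2" for e
    using fun_cong[OF N_eq, of e] by (simp add: N_def diff_divide_distrib)
  then have "(\<Sum>e | lface G e = f. kite_angle (\<Theta> e) (X e + gradF u e)) = pi" for f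
    by (simp add: sum.distrib alpha_sum sum_divide_distrib[symmetric] F.grad_sum)
  ultimately have "u \<in> P_radii G \<Theta> R\<^sub>0" by (simp add: P_radii_iff)
  then show ?thesis using conjugate_iff[OF g(2)] N_eq by blast
qed

lemma weight_radii_kite: "weight_radii G \<Theta> R\<^sub>0 u e = N' e (gradF u e)"
proof -
  define a where "a = exp (u (lface G e)) * R\<^sub>0 (lface G e)"
  define b where "b = exp (u (rface G e)) * R\<^sub>0 (rface G e)"
  have ab: "a > 0" "b > 0" using R0_pos by (simp_all add: a_def b_def)
  have "ln a = u (lface G e) + ln (R\<^sub>0 (lface G e))" "ln b = u (rface G e) + ln (R\<^sub>0 (rface G e))"
    using R0_pos[of "lface G e"] R0_pos[of "rface G e"] by (simp_all add: a_def b_def ln_mult)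
  then have x: "X e + gradF u e = ln b - ln a" by (simp add: X_def grad_def)
  have "2 * cosh (ln b - ln a) = b / a + a / b" using ab by (simp add: cosh_def exp_diff exp_minus field_simps)
  then have "2 * a * b * (cosh (ln b - ln a) - cos (\<Theta> e)) = a\<^sup>2 + b\<^sup>2 - 2 * a * b * cos (\<Theta> e)"
    using ab by (simp add: field_simps power2_eq_square)
  then have "2 * a * b * sin (\<Theta> e) / (a\<^sup>2 + b\<^sup>2 - 2 * a * b * cos (\<Theta> e)) =
     (2 * a * b) * sin (\<Theta> e) / ((2 * a * b) * (cosh (ln b - ln a) - cos (\<Theta> e)))" by simp
  also have "\<dots> = sin (\<Theta> e) / (cosh (ln b - ln a) - cos (\<Theta> e))"
    using ab by (intro mult_divide_mult_cancel_left) simp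
  finally show ?thesis by (simp add: weight_radii_def Let_def a_def b_def N'_def kite_weight_def x[unfolded a_def b_def])
qed

lemma weight_angles_kite: "weight_angles G \<alpha> v e = M' e (gradV v e)"
  by (simp add: weight_angles_def M'_def grad_def alpha_rv algebra_simps)

lemma isometry:
  "riemannian_isometry (lface G) (rface G) (P_radii G \<Theta> R\<^sub>0) (weight_radii G \<Theta> R\<^sub>0)
    (src G) (trg G) (P_angles G \<alpha>) (weight_angles G \<alpha>) (conjugation_map G \<alpha>)"
proof -
  have adm: "admissible v" if "v \<in> P_angles G \<alpha>" for v using that by (simp add: P_angles_iff)
  have P_radii_mod: "u' \<in> P_radii G \<Theta> R\<^sub>0" if "u \<in> P_radii G \<Theta> R\<^sub>0" "u' \<in> mod_const u" for u u'
    using that grad_mod_const[OF that(2), of "lface G" "rface G"] by (simp add: P_radii_iff)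
  have P_angles_mod: "v' \<in> P_angles G \<alpha>" if "v \<in> P_angles G \<alpha>" "v' \<in> mod_const v" for v v'
    using that grad_mod_const[OF that(2), of "src G" "trg G"] by (simp add: P_angles_iff admissible_def)
  note \<Phi> = bij_betw_mod_const[where \<Phi> = "conjugation_map G \<alpha>" and A = "P_radii G \<Theta> R\<^sub>0" and B = "P_angles G \<alpha>"
      and rel = "\<lambda>u v. gradV v = (\<lambda>e. N e (gradF u e))"]
  have "bij_betw (conjugation_map G \<alpha>) (mod_const ` P_radii G \<Theta> R\<^sub>0) (mod_const ` P_angles G \<alpha>) \<and>
    (\<forall>u v. v \<in> conjugation_map G \<alpha> (mod_const u) \<longrightarrow> v \<in> P_angles G \<alpha> \<and> gradV v = (\<lambda>e. N e (gradF u e)))"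
  proof (intro conjI allI impI)
    have 1: "conjugation_map G \<alpha> U = {v \<in> P_angles G \<alpha>. \<exists>u\<in>U. gradV v = (\<lambda>e. N e (gradF u e))}" for U
      unfolding conjugation_map_def using adm conjugate_iff by blast
    have 2: "\<exists>v\<in>P_angles G \<alpha>. gradV v = (\<lambda>e. N e (gradF u e))" if "u \<in> P_radii G \<Theta> R\<^sub>0" for u
      using conjugate_angles_exist[OF that] adm conjugate_iff by blast
    have 3: "\<exists>u\<in>P_radii G \<Theta> R\<^sub>0. gradV v = (\<lambda>e. N e (gradF u e))" if "v \<in> P_angles G \<alpha>" for v
      using conjugate_radii_exist[OF that] adm[OF that] conjugate_iff by blast
    have 4: "gradV v' = (\<lambda>e. N e (gradF u' e))"
      if "gradV v = (\<lambda>e. N e (gradF u e))" "u' \<in> mod_const u" "v' \<in> mod_const v" for u v u' v'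
      using that(1) grad_mod_const[OF that(2), of "lface G" "rface G"] grad_mod_const[OF that(3), of "src G" "trg G"]
      by simp
    have 5: "v' \<in> mod_const v" if "gradV v = (\<lambda>e. N e (gradF u e))" "gradV v' = (\<lambda>e. N e (gradF u e))" for u v v'
      by (rule F.grad_eq_imp_mod_const) (simp add: that)
    have 6: "u' \<in> mod_const u" if "gradV v = (\<lambda>e. N e (gradF u e))" "gradV v = (\<lambda>e. N e (gradF u' e))" for u u' v
    proof (rule B.grad_eq_imp_mod_const)
      have "N e (gradF u' e) = N e (gradF u e)" for e using that by metis
      then have "M e (N e (gradF u' e)) = M e (N e (gradF u e))" for e by simp
      then show "gradF u' = gradF u" by (auto simp: M_N)
    qed
    show "bij_betw (conjugation_map G \<alpha>) (mod_const ` P_radii G \<Theta> R\<^sub>0) (mod_const ` P_angles G \<alpha>)"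
      by (rule \<Phi>(1)[OF 1 2 3 P_angles_mod 4 5 6])
    fix u v assume v: "v \<in> conjugation_map G \<alpha> (mod_const u)"
    have "v \<in> P_angles G \<alpha> \<and> gradV v = (\<lambda>e. N e (gradF u e))"
      by (rule \<Phi>(2)[OF 1 2 3 P_angles_mod 4 5 6 v])
    then show "v \<in> P_angles G \<alpha>" "gradV v = (\<lambda>e. N e (gradF u e))" by auto
  qed
  then have bij: "bij_betw (conjugation_map G \<alpha>) (mod_const ` P_radii G \<Theta> R\<^sub>0) (mod_const ` P_angles G \<alpha>)"
    and rel: "\<And>u v. v \<in> conjugation_map G \<alpha> (mod_const u) \<Longrightarrow> v \<in> P_angles G \<alpha>"
    "\<And>u v e. v \<in> conjugation_map G \<alpha> (mod_const u) \<Longrightarrow> gradV v e = N e (gradF u e)" by auto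
  show ?thesis
  proof (rule riemannian_isometryI[where N = N and N' = N' and M = M and M' = M', OF bij])
    show "P_radii G \<Theta> R\<^sub>0 \<subseteq> dirichlet_space (lface G) (rface G)" by (auto simp: P_radii_def)
    show "P_angles G \<alpha> \<subseteq> dirichlet_space (src G) (trg G)" by (auto simp: P_angles_def)
    show "uniformly_C11 M M' (gradV v)" if "v \<in> P_angles G \<alpha>" for v by (rule M_C11[OF that])
    show "weight_radii G \<Theta> R\<^sub>0 u (rv G e) = weight_radii G \<Theta> R\<^sub>0 u e" for u e
    proof -
      have "X (rv G e) + gradF u (rv G e) = - (X e + gradF u e)" by (simp add: X_rv B.grad_rv)
      then show ?thesis by (simp only: weight_radii_kite N'_def kite_weight_def Theta_rv cosh_minus)
    qed
    fix u v e assume v: "v \<in> conjugation_map G \<alpha> (mod_const u)"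
    show "gradV v e = N e (gradF u e)" by (rule rel(2)[OF v])
    then show M: "gradF u e = M e (gradV v e)" by (simp add: M_N)
    have b: "0 < \<alpha> e + gradV v e / 2" "\<alpha> e + gradV v e / 2 < pi - \<Theta> e"
      using adm[OF rel(1)[OF v]] by (simp_all add: admissible_def)
    have "X e + gradF u e = kite_log (\<Theta> e) (\<alpha> e + gradV v e / 2)" using M by (simp add: M_def)
    then show "weight_radii G \<Theta> R\<^sub>0 u e * weight_angles G \<alpha> v e = 1"
      using kite_weight_kite_log[OF Theta_pos b] by (simp only: weight_radii_kite weight_angles_kite N'_def M'_def)
  qed (use P_radii_mod P_angles_mod N_C11 weight_radii_kite weight_angles_kite in auto)
qed

end

theorem corollary1p9:
  fixes G :: "('v, 'e, 'f, 'p::topological_space) cell_complex"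
    and \<Theta> :: "'e \<Rightarrow> real" and \<epsilon>\<^sub>0 :: real and R\<^sub>0 :: "'f \<Rightarrow> real"
  defines "\<alpha> \<equiv> half_angle G \<Theta> R\<^sub>0"
  assumes "disk_cell_decomposition G"
    and "one_ended G"
    and "bounded_degrees G"
    and "transient G"
    and "\<epsilon>\<^sub>0 > 0"
    and "admissible_angles G \<epsilon>\<^sub>0 \<Theta>"
    and "uniformizing G \<Theta> R\<^sub>0"
  shows "riemannian_isometry
    (lface G) (rface G) (P_radii G \<Theta> R\<^sub>0) (weight_radii G \<Theta> R\<^sub>0)
    (src G) (trg G) (P_angles G \<alpha>) (weight_angles G \<alpha>)
    (conjugation_map G \<alpha>)"
proof -
  interpret uniformized_pattern G \<Theta> \<epsilon>\<^sub>0 R\<^sub>0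
    using assms(2-) by unfold_locales
  show ?thesis unfolding \<alpha>_def by (rule isometry)
qed

end
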